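(* Let $d\ge 1$ be an integer and let $\Delta=\operatorname{conv}(v_1,\ldots,v_{2d})\subset\mathbb{R}^{2d-1}$ be a $(2d-1)$-dimensional lattice simplex (with respect to $\mathbb{Z}^{2d-1}$) all of whose codimension-$1$ facets are basic lattice simplices. Then the following statements are equivalent: (1) for all $k=1,\ldots,d-1$ there are no lattice points in the interior of $k\Delta$, i.e. $\mathrm{Int}(k\Delta)\cap\mathbb{Z}^{2d-1}=\emptyset$; (2) $\Delta\cong\Delta_1*\cdots*\Delta_d$ for some $1$-dimensional lattice simplices (lattice segments) $\Delta_1,\ldots,\Delta_d\subset\mathbb{R}^d$.
   Context: A $k$-dimensional lattice simplex $\operatorname{conv}(w_1,\ldots,w_{k+1})\subset\mathbb{R}^m$ (vertices in $\mathbb{Z}^m$, affinely independent) is called basic if $w_1-w_{k+1},\ldots,w_k-w_{k+1}$ is part of a lattice basis of $\mathbb{Z}^m$ (equivalently, it is mapped onto $\operatorname{conv}(0,e_1,\ldots,e_k)$ by an affine unimodular isomorphism of $\mathbb{R}^m$). Cayley polytope: for lattice polytopes $\Sigma_1,\ldots,\Sigma_r\subset\mathbb{R}^d$ ($r\le d$), $\Sigma_1*\cdots*\Sigma_r$ is the convex hull of $e_1\times\Sigma_1,\ldots,e_r\times\Sigma_r$ in $\mathbb{R}^{r+d}=\mathbb{R}^r\times\mathbb{R}^d$, where $e_i$ are the standard basis vectors of $\mathbb{R}^r$; it lies in the affine hyperplane $H=\{x\in\mathbb{R}^{r+d}:x_1+\cdots+x_r=1\}$, which carries the affine lattice $H\cap\mathbb{Z}^{r+d}$.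 Here $\Delta\cong P$ for $P\subset H$ (with $r=d$, so $H$ has dimension $2d-1$) means there is an affine isomorphism $\varphi:\mathbb{R}^{2d-1}\to H$ with $\varphi(\mathbb{Z}^{2d-1})=H\cap\mathbb{Z}^{2d}$ and $\varphi(\Delta)=P$. *)

theory Defs
  imports "HOL-Analysis.Analysis"
begin

text \<open>Taking the coordinates with respect to \<^const>\<open>Basis\<close> covers both the lattice of integer
  points of \<open>real ^ 'n\<close> and that of products such as \<open>(real ^ 'r) \<times> (real ^ 'd)\<close>.\<close>

definition integer_lattice :: "'a::euclidean_space set" where
  "integer_lattice = {x. \<forall>b\<in>Basis. x \<bullet> b \<in> \<int>}"

lemma integer_lattice_vec_iff:
  fixes x :: "real ^ 'n"
  shows "x \<in> integer_lattice \<longleftrightarrow> (\<forall>i. x $ i \<in> \<int>)"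
  by (auto simp: integer_lattice_def Basis_vec_def inner_axis)

lemma integer_lattice_prod_eq:
  "(integer_lattice :: ('a::euclidean_space \<times> 'b::euclidean_space) set)
     = integer_lattice \<times> integer_lattice"
  by (auto simp: integer_lattice_def Basis_prod_def ball_Un)

definition lattice_basis :: "'a::euclidean_space set \<Rightarrow> bool" where
  "lattice_basis B \<longleftrightarrow>
     independent B \<and>
     {\<Sum>b\<in>B. of_int (c b) *\<^sub>R b | c :: 'a \<Rightarrow> int. True} = integer_lattice"

definition lattice_simplex :: "nat \<Rightarrow> 'a::euclidean_space set \<Rightarrow> bool" where
  "lattice_simplex k S \<longleftrightarrow>
     (\<exists>W. W \<subseteq> integer_lattice \<and> \<not> affine_dependent W \<and> card W = k + 1 \<and> S = convex hull W)"

text \<open>The vertex \<open>w\<close> plays the role of the last vertex \<open>w\<^bsub>k+1\<^esub>\<close>; the notion does not depend on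
  which vertex is singled out.\<close>

definition basic_simplex :: "'a::euclidean_space set \<Rightarrow> bool" where
  "basic_simplex S \<longleftrightarrow>
     (\<exists>W w. W \<subseteq> integer_lattice \<and> \<not> affine_dependent W \<and> w \<in> W \<and> S = convex hull W \<and>
        (\<exists>B. lattice_basis B \<and> (\<lambda>u. u - w) ` (W - {w}) \<subseteq> B))"

definition cayley_polytope ::
  "('r::finite \<Rightarrow> 'a::euclidean_space set) \<Rightarrow> ((real ^ 'r) \<times> 'a) set" where
  "cayley_polytope \<Sigma> = convex hull (\<Union>i. {axis i 1} \<times> \<Sigma> i)"

definition cayley_hyperplane :: "((real ^ 'r::finite) \<times> 'a::euclidean_space) set" where
  "cayley_hyperplane = {(x, y). (\<Sum>i\<in>UNIV. x $ i) = 1}"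

definition affine_map :: "('a::real_vector \<Rightarrow> 'b::real_vector) \<Rightarrow> bool" where
  "affine_map f \<longleftrightarrow> (\<exists>L c. linear L \<and> (\<forall>x. f x = L x + c))"

definition cayley_isomorphic ::
  "'b::euclidean_space set \<Rightarrow> ((real ^ 'r::finite) \<times> 'a::euclidean_space) set \<Rightarrow> bool" where
  "cayley_isomorphic S P \<longleftrightarrow>
     (\<exists>\<phi>. affine_map \<phi> \<and> bij_betw \<phi> UNIV cayley_hyperplane \<and>
        \<phi> ` integer_lattice = cayley_hyperplane \<inter> integer_lattice \<and> \<phi> ` S = P)"

end

theory Submission
  imports Defs "HOL-Number_Theory.Residues"
begin

text \<open>Since all facets are basic, the lattice points modulo the lattice spanned by the vertices form
  a cyclic group, generated in barycentric coordinates by \<open>(a v / N)\<close> with every \<open>a v\<close> prime to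
  \<open>N\<close>. As \<open>j\<close> and \<open>- j\<close> have complementary fractional parts, the absence of interior lattice points
  in the dilates up to \<open>d - 1\<close> says exactly that the fractional parts of \<open>j * a v / N\<close> sum to
  \<open>d\<close> for all \<open>j\<close> not divisible by \<open>N\<close>. This forces the residues \<open>a v\<close> to cancel in pairs:
  otherwise the difference of the counts of \<open>x\<close> and \<open>- x\<close> generates, under dilation by units, an
  odd character \<open>\<chi>\<close> modulo \<open>N\<close> orthogonal to all sawtooth functions, and the finite Fourier
  transform together with the partial fractions of the cotangent gives \<open>L(1, cnj \<chi>) = 0\<close>,
  contradicting Dirichlet. Each pair of vertices becomes one segment of the Cayley polytope.
  Conversely, at an interior point of the \<open>k\<close>-th dilate of a Cayley polytope the first \<open>d\<close> coordinates
  are positive with sum \<open>k\<close>, so such a point can be integral only if \<open>k \<ge> d\<close>.\<close>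

section \<open>Summation by parts and characters modulo \<open>N\<close>\<close>

text \<open>For an imprimitive character the single sum of \<open>chi x * x\<close> may vanish,
  because Euler factors \<open>1 - \<psi> p\<close> of the inducing character \<open>\<psi>\<close>
  may be 0. Hence the balance condition is used for every multiplier, unit or not: its Fourier
  transform in the multiplier reaches \<open>L(1)\<close> of the character modulo \<open>N\<close>
  itself, where the corresponding factors are \<open>1 - \<psi> p / p\<close> and cannot vanish.
  Nonvanishing is therefore proved for all nonprincipal characters modulo \<open>N\<close> alike,
  with no reduction to primitive ones. It splits into two cases. If the square of the character is
  nonprincipal, the inequality behind \<open>3 + 4 cos t + cos (2 t) \<ge> 0\<close> suffices. For a
  quadratic character the square contributes a pole that cancels the gain, and a Lambert series
  takes its place. Both arguments stay on the real axis, so that partial summation replaces complex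
  analysis. Obtaining the character as a common eigenvector of the dilations spares the duality
  theory of the group of units.\<close>

lemma sum_by_parts:
  fixes f :: "nat \<Rightarrow> complex" and b :: "nat \<Rightarrow> real"
  shows "(\<Sum>k<n. f k * b k) = (\<Sum>k<n. (\<Sum>j<Suc k. f j) * (b k - b (Suc k))) + (\<Sum>j<n. f j) * b n"
  by (induction n) (auto simp: algebra_simps)

text \<open>After Abel summation the weights \<open>b k - b (Suc k)\<close> are nonnegative and,
  together with the boundary weight \<open>b n\<close>, telescope to \<open>b 0\<close>.\<close>

lemma norm_sum_decseq_le:
  fixes f :: "nat \<Rightarrow> complex" and b :: "nat \<Rightarrow> real"
  assumes S: "\<And>n. norm (\<Sum>k<n. f k) \<le> C" and dec: "\<And>n. b (Suc n) \<le> b n" and pos: "\<And>n. b n \<ge> 0"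
  shows "norm (\<Sum>k<n. f k * b k) \<le> C * b 0"
proof -
  have "norm (\<Sum>k<n. f k * b k) \<le> (\<Sum>k<n. norm ((\<Sum>j<Suc k. f j) * (b k - b (Suc k)))) + norm ((\<Sum>j<n. f j) * b n)"
    by (subst sum_by_parts) (intro order_trans[OF norm_triangle_ineq] add_mono norm_sum order_refl)
  also have "\<dots> \<le> (\<Sum>k<n. C * (b k - b (Suc k))) + C * b n"
  proof (intro add_mono sum_mono)
    fix k
    have "norm (complex_of_real (b k) - complex_of_real (b (Suc k))) = b k - b (Suc k)"
      using dec[of k] by (metis abs_of_nonneg diff_ge_0_iff_ge norm_of_real of_real_diff)
    then show "norm ((\<Sum>j<Suc k. f j) * (b k - b (Suc k))) \<le> C * (b k - b (Suc k))"
      unfolding norm_mult using dec[of k] S[of "Suc k"] by (simp add: mult_right_mono)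
  next
    show "norm ((\<Sum>j<n. f j) * b n) \<le> C * b n"
      unfolding norm_mult using pos[of n] S[of n] by (simp add: mult_right_mono)
  qed
  also have "\<dots> = C * b 0"
    unfolding sum_distrib_left[symmetric] sum_lessThan_telescope' by (simp add: right_diff_distrib)
  finally show ?thesis .
qed

text \<open>A block of consecutive terms is a difference of two initial sums, whence the factor
  2.\<close>

lemma norm_sum_decseq_shift_le:
  fixes f :: "nat \<Rightarrow> complex" and b :: "nat \<Rightarrow> real"
  assumes S: "\<And>n. norm (\<Sum>k<n. f k) \<le> C" and dec: "\<And>n. b (Suc n) \<le> b n" and pos: "\<And>n. b n \<ge> 0"
  shows "norm (\<Sum>k<n. f (m + k) * b (m + k)) \<le> 2 * C * b m"
proof -
  have "norm (\<Sum>k<n. f (m + k)) \<le> 2 * C" for n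
  proof -
    have "(\<Sum>k<m + n. f k) = (\<Sum>k<m. f k) + (\<Sum>k<n. f (m + k))"
      by (induction n) (auto simp: algebra_simps)
    then have "(\<Sum>k<n. f (m + k)) = (\<Sum>k<m + n. f k) - (\<Sum>k<m. f k)" by simp
    then show ?thesis using S[of "m + n"] S[of m] norm_triangle_ineq4[of "\<Sum>k<m + n. f k" "\<Sum>k<m. f k"] by simp
  qed
  from norm_sum_decseq_le[of "\<lambda>k. f (m + k)" _ "\<lambda>k. b (m + k)", OF this] dec pos
  show ?thesis by simp
qed

text \<open>Dirichlet's test: the bound on blocks tends to 0 with \<open>b\<close>, so the partial
  sums are Cauchy.\<close>

lemma summable_decseq:
  fixes f :: "nat \<Rightarrow> complex" and b :: "nat \<Rightarrow> real"
  assumes S: "\<And>n. norm (\<Sum>k<n. f k) \<le> C" and dec: "\<And>n. b (Suc n) \<le> b n" and lim: "b \<longlonglongrightarrow> 0"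
  shows "summable (\<lambda>k. f k * b k)"
proof -
  have "decseq b" using dec by (simp add: decseq_SucI)
  then have pos: "b n \<ge> 0" for n using decseq_ge lim by blast
  have C: "C \<ge> 0" using S[of 0] by simp
  show ?thesis unfolding summable_Cauchy
  proof (intro allI impI)
    fix e :: real assume "e > 0"
    have "(\<lambda>n. 2 * C * b n) \<longlonglongrightarrow> 2 * C * 0" by (intro tendsto_intros lim)
    then have "eventually (\<lambda>n. 2 * C * b n < e) sequentially"
      using \<open>e > 0\<close> by (intro order_tendstoD(2)[where y = "2 * C * 0"]) auto
    then obtain M where M: "\<And>m. m \<ge> M \<Longrightarrow> 2 * C * b m < e" by (auto simp: eventually_sequentially)
    show "\<exists>M. \<forall>m\<ge>M. \<forall>n. norm (\<Sum>k = m..<n. f k * b k) < e"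
    proof (intro exI[of _ M] allI impI)
      fix m n assume "M \<le> m"
      have "(\<Sum>k = m..<n. f k * b k) = (\<Sum>k<n - m. f (m + k) * b (m + k))"
        by (simp add: sum.atLeastLessThan_shift_0[of _ m n] atLeast0LessThan add.commute)
      then show "norm (\<Sum>k = m..<n. f k * b k) < e"
        using norm_sum_decseq_shift_le[where f = f and C = C and b = b and n = "n - m" and m = m, OF S dec pos] M[OF \<open>M \<le> m\<close>] by simp
    qed
  qed
qed

text \<open>Dirichlet characters, defined on naturals so that they serve directly as coefficients of
  series; the residue -1 is accordingly written \<open>N - 1\<close>.\<close>

locale residue_character =
  fixes N :: nat and chi :: "nat \<Rightarrow> complex"
  assumes N_pos: "N > 0"
    and chi_1: "chi 1 = 1"
    and chi_mult: "chi (x * y) = chi x * chi y"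
    and chi_mod: "chi (x mod N) = chi x"
    and chi_0: "\<not> coprime x N \<Longrightarrow> chi x = 0"
begin

lemma chi_power: "chi (x ^ k) = chi x ^ k"
  by (induction k) (simp_all add: chi_1[simplified] chi_mult)

lemma norm_chi:
  assumes "coprime x N"
  shows "norm (chi x) = 1"
proof -
  have "[x ^ totient N = 1] (mod N)" using assms by (rule euler_theorem)
  then have "chi (x ^ totient N) = 1" using chi_mod chi_1 by (metis cong_def)
  then have "norm (chi x) ^ totient N = 1" by (metis chi_power norm_one norm_power)
  moreover have "totient N > 0" using N_pos by simp
  ultimately show ?thesis by (metis norm_ge_zero power_eq_imp_eq_base power_one zero_le_one)
qed

lemma norm_chi_le: "norm (chi x) \<le> 1"
  using norm_chi[of x] chi_0[of x] by (cases "coprime x N") auto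

lemma residue_character_square: "residue_character N (\<lambda>x. chi x ^ 2)"
  by unfold_locales (simp_all add: N_pos chi_1[simplified] chi_mult chi_mod chi_0 power_mult_distrib)

lemma residue_character_cnj: "residue_character N (\<lambda>x. cnj (chi x))"
  by unfold_locales (simp_all add: N_pos chi_1[simplified] chi_mult chi_mod chi_0)

end

lemma bij_betw_mult_mod:
  fixes m N :: nat
  assumes "coprime m N" "N > 0"
  shows "bij_betw (\<lambda>x. m * x mod N) {..<N} {..<N}"
proof -
  have inj: "inj_on (\<lambda>x. m * x mod N) {..<N}"
  proof (rule inj_onI)
    fix x y assume xy: "x \<in> {..<N}" "y \<in> {..<N}" "m * x mod N = m * y mod N"
    then have "[x = y] (mod N)" using assms(1) by (metis cong_def cong_mult_lcancel_nat)
    then show "x = y" using xy by (simp add: cong_def)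
  qed
  moreover have "(\<lambda>x. m * x mod N) ` {..<N} = {..<N}"
    by (rule endo_inj_surj) (use inj assms in auto)
  ultimately show ?thesis by (simp add: bij_betw_def)
qed

locale nonprincipal_character = residue_character +
  fixes m :: nat
  assumes coprime_m: "coprime m N" and chi_m: "chi m \<noteq> 1"
begin

lemma N_gt_1: "N > 1"
proof (rule ccontr)
  assume "\<not> N > 1"
  then have "N = 1" using N_pos by simp
  then show False using chi_mod[of m] chi_mod[of 1] chi_1 chi_m by simp
qed

lemma chi_zero: "chi 0 = 0"
  using chi_0[of 0] N_gt_1 by simp

text \<open>Dilation by the witness \<open>m\<close> permutes the residues but multiplies the sum by
  \<open>chi m\<close>, which is not 1.\<close>

lemma sum_period: "(\<Sum>x<N. chi x) = 0"
proof -
  have "(\<Sum>x<N. chi x) = (\<Sum>x<N. chi (m * x mod N))"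
    using sum.reindex_bij_betw[OF bij_betw_mult_mod[OF coprime_m N_pos], of chi] by simp
  also have "\<dots> = chi m * (\<Sum>x<N. chi x)"
    by (simp add: chi_mod chi_mult sum_distrib_left)
  finally show ?thesis using chi_m by (simp add: mult_cancel_right1)
qed

text \<open>Full periods cancel, and fewer than \<open>N\<close> terms of norm at most 1
  remain.\<close>

lemma norm_partial_sum_le: "norm (\<Sum>x<n. chi x) \<le> N"
proof -
  have per: "(\<Sum>x<q * N + r. chi x) = (\<Sum>x<r. chi x)" for q r
  proof (induction q)
    case (Suc q)
    have shift: "chi (N + x) = chi x" for x using chi_mod[of "N + x"] chi_mod[of x] by simp
    have "(\<Sum>x<N + k. chi x) = (\<Sum>x<N. chi x) + (\<Sum>x<k. chi (N + x))" for k
      by (induction k) (auto simp: algebra_simps)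
    from this[of "q * N + r"] show ?case using Suc by (simp add: shift sum_period add.assoc)
  qed simp
  have "(\<Sum>x<n. chi x) = (\<Sum>x<n mod N. chi x)"
    using per[of "n div N" "n mod N"] by simp
  also have "norm \<dots> \<le> (\<Sum>x<n mod N. 1)" by (intro order_trans[OF norm_sum] sum_mono norm_chi_le)
  also have "\<dots> \<le> N" using N_pos by (simp add: less_imp_le)
  finally show ?thesis .
qed

lemma norm_partial_sum_Suc_le: "norm (\<Sum>k<n. chi (Suc k)) \<le> N"
  using norm_partial_sum_le[of "Suc n"] by (simp add: sum.lessThan_Suc_shift chi_zero del: sum.lessThan_Suc)

lemma summable_L1: "summable (\<lambda>k. chi (Suc k) / Suc k)"
proof -
  have "(\<lambda>k. 1 / real (Suc k)) \<longlonglongrightarrow> 0" using LIMSEQ_Suc[OF lim_1_over_n] by simp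
  then have "summable (\<lambda>k. chi (Suc k) * complex_of_real (1 / real (Suc k)))"
    by (intro summable_decseq[OF norm_partial_sum_Suc_le]) (simp add: frac_le)
  then show ?thesis by simp
qed

end

text \<open>The local factor at one prime in the argument of Hadamard and Mertens. Its logarithm is
  a power series whose coefficients are negative multiples of
  \<open>3 + 4 * Re w + Re (w^2) = 2 * (1 + Re w)^2\<close> with \<open>norm w = 1\<close>. The case
  \<open>q = 0\<close> serves the primes dividing the modulus.\<close>

lemma norm_341_le_1:
  fixes q :: complex and r :: real
  assumes q: "norm q = 1 \<or> q = 0" and r: "0 \<le> r" "r < 1"
  shows "norm ((1 - of_real r) ^ 3 * (1 - q * r) ^ 4 * (1 - q ^ 2 * r)) \<le> 1"
  using q
proof
  assume "q = 0"
  moreover have "norm (1 - complex_of_real r) = 1 - r" using r by (metis abs_of_nonneg diff_ge_0_iff_ge less_imp_le norm_of_real of_real_1 of_real_diff)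
  ultimately show ?thesis using r by (simp add: norm_mult norm_power power_le_one)
next
  assume q1: "norm q = 1"
  have ser: "(\<lambda>n. - Re (w ^ n) * r ^ n / n) sums Re (ln (1 - w * r))" and nz: "1 - w * r \<noteq> 0" if "norm w = 1" for w :: complex
  proof -
    have n: "norm (- (w * r)) < 1" using that r by (simp add: norm_mult)
    from sums_Re[OF Ln_series'[OF this]]
    show "(\<lambda>n. - Re (w ^ n) * r ^ n / n) sums Re (ln (1 - w * r))"
      by (simp add: power_mult_distrib flip: of_real_power)
    show "1 - w * r \<noteq> 0" using n by auto
  qed
  have sm: "(\<lambda>n. 3 * (- Re (1 ^ n) * r ^ n / n) + 4 * (- Re (q ^ n) * r ^ n / n) + (- Re ((q^2) ^ n) * r ^ n / n))
     sums (3 * Re (ln (1 - 1 * complex_of_real r)) + 4 * Re (ln (1 - q * r)) + Re (ln (1 - q^2 * r)))" (is "?f sums ?s")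
    using q1 by (intro sums_add[OF sums_add[OF sums_mult[OF ser[of 1]] sums_mult[OF ser[of q]]] ser[of "q^2"]])
      (simp_all only: norm_power norm_one power_one)
  have np: "?f n \<le> 0" for n
  proof -
    define w where "w = q ^ n"
    have "norm w = 1" by (simp add: w_def norm_power q1)
    then have *: "Re w ^ 2 + Im w ^ 2 = 1" by (simp add: cmod_def)
    have "3 + 4 * Re w + Re (w ^ 2) = 2 * (1 + Re w) ^ 2" using *
      by (simp add: power2_eq_square algebra_simps)
    then have "3 + 4 * Re w + Re (w ^ 2) \<ge> 0" by simp
    moreover have "?f n = - ((3 + 4 * Re w + Re (w ^ 2)) * (r ^ n / n))"
      unfolding w_def power_mult[symmetric] mult.commute[of 2 n] power_one by (simp add: algebra_simps)
    ultimately show ?thesis using r by simp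
  qed
  have "?s \<le> 0" by (rule sums_le[OF np sm sums_zero])
  moreover have "norm ((1 - of_real r) ^ 3 * (1 - q * r) ^ 4 * (1 - q ^ 2 * r)) = exp ?s"
  proof -
    have e: "exp (Re (ln (1 - w * r))) = norm (1 - w * r)" if "norm w = 1" for w :: complex
      using nz[OF that] by (metis exp_Ln norm_exp_eq_Re)
    have "exp ?s = exp (Re (ln (1 - 1 * complex_of_real r))) ^ 3 * exp (Re (ln (1 - q * r))) ^ 4 * exp (Re (ln (1 - q^2 * r)))"
      by (simp only: exp_add exp_of_nat_mult[symmetric] of_nat_numeral)
    then show ?thesis using e[of 1] e[of q] e[of "q^2"] q1
      by (simp only: norm_mult norm_power norm_one power_one simp_thms mult_1)
  qed
  ultimately show ?thesis by simp
qed

section \<open>Nonvanishing of \<open>L(1, \<chi>)\<close> for complex characters\<close>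

definition rough :: "nat \<Rightarrow> nat set" where
  "rough P = {n. n > 0 \<and> (\<forall>p. prime p \<and> p < P \<longrightarrow> \<not> p dvd n)}"

text \<open>Sieving by one prime at a time: for prime \<open>P\<close>, what is removed from
  \<open>rough P\<close> is exactly \<open>P\<close> times \<open>rough P\<close>, so the sum loses
  the factor \<open>1 - f P\<close>. This gives the Euler product with finitely many factors at each
  stage.\<close>

lemma infsum_rough:
  fixes f :: "nat \<Rightarrow> complex"
  assumes sum: "(\<lambda>n. norm (f n)) summable_on UNIV" and mult: "\<And>m n. f (m * n) = f m * f n" and f0: "f 0 = 0"
  shows "infsum f (rough P) = infsum f UNIV * (\<Prod>p | prime p \<and> p < P. 1 - f p)"
proof (induction P)
  case 0
  have "infsum f (rough 0) = infsum f UNIV"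
    by (rule infsum_cong_neutral) (use f0 in \<open>auto simp: rough_def\<close>)
  then show ?case by simp
next
  case (Suc P)
  have sm: "f summable_on A" for A
    using sum abs_summable_summable summable_on_subset_banach by blast
  show ?case
  proof (cases "prime P")
    case False
    then have "rough (Suc P) = rough P" and "{p. prime p \<and> p < Suc P} = {p. prime p \<and> p < P}"
      by (auto simp: rough_def less_Suc_eq)
    then show ?thesis using Suc by simp
  next
    case True
    have im: "(*) P ` rough P = {n \<in> rough P. P dvd n}"
    proof (intro equalityI subsetI)
      fix n assume "n \<in> (*) P ` rough P"
      then obtain k where k: "n = P * k" "k \<in> rough P" by auto
      have "\<not> p dvd n" if "prime p" "p < P" for p
      proof
        assume "p dvd n"
        then have "p dvd P \<or> p dvd k" using that k by (simp add: prime_dvd_mult_iff)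
        then show False using that k True by (auto simp: rough_def dest: primes_dvd_imp_eq)
      qed
      then show "n \<in> {n \<in> rough P. P dvd n}" using k True by (auto simp: rough_def prime_gt_0_nat)
    next
      fix n assume n: "n \<in> {n \<in> rough P. P dvd n}"
      then obtain k where k: "n = P * k" by auto
      with n have "k \<in> rough P" by (auto simp: rough_def)
      then show "n \<in> (*) P ` rough P" using k by auto
    qed
    have "rough P = rough (Suc P) \<union> (*) P ` rough P" "rough (Suc P) \<inter> (*) P ` rough P = {}"
      unfolding im using True by (auto simp: rough_def less_Suc_eq)
    then have "infsum f (rough P) = infsum f (rough (Suc P)) + infsum f ((*) P ` rough P)"
      by (metis infsum_Un_disjoint sm)
    also have "infsum f ((*) P ` rough P) = infsum (\<lambda>k. f P * f k) (rough P)"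
      using True by (subst infsum_reindex) (auto simp: inj_on_def o_def mult prime_gt_0_nat)
    also have "\<dots> = f P * infsum f (rough P)" by (rule infsum_cmult_right) (use sm in auto)
    finally have "infsum f (rough (Suc P)) = (1 - f P) * infsum f (rough P)"
      unfolding left_diff_distrib mult_1 eq_diff_eq by (rule sym)
    moreover have "{p. prime p \<and> p < Suc P} = insert P {p. prime p \<and> p < P}"
      using True by (auto simp: less_Suc_eq)
    ultimately show ?thesis using Suc by simp
  qed
qed

text \<open>A number in \<open>rough P\<close> other than 1 has a prime factor that is at least
  \<open>P\<close>, so everything but the term at 1 lies in a tail of a convergent series.\<close>

lemma tendsto_infsum_rough:
  fixes f :: "nat \<Rightarrow> complex"
  assumes sum: "(\<lambda>n. norm (f n)) summable_on UNIV" and f1: "f 1 = 1"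
  shows "(\<lambda>P. infsum f (rough P)) \<longlonglongrightarrow> 1"
proof -
  have sm: "f summable_on A" "(\<lambda>n. norm (f n)) summable_on A" for A
    using sum abs_summable_summable summable_on_subset_banach by blast+
  define T where "T P = infsum (\<lambda>n. norm (f n)) UNIV - (\<Sum>n<P. norm (f n))" for P
  have T: "infsum (\<lambda>n. norm (f n)) {P..} = T P" for P
  proof -
    have "infsum (\<lambda>n. norm (f n)) UNIV = infsum (\<lambda>n. norm (f n)) ({..<P} \<union> {P..})"
      by (rule arg_cong2[where f = infsum]) auto
    also have "\<dots> = (\<Sum>n<P. norm (f n)) + infsum (\<lambda>n. norm (f n)) {P..}"
      by (subst infsum_Un_disjoint) (use sm(2) in auto)
    finally show ?thesis by (simp add: T_def)
  qed
  have "(\<lambda>P. \<Sum>n<P. norm (f n)) \<longlonglongrightarrow> infsum (\<lambda>n. norm (f n)) UNIV"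
    using has_sum_imp_sums[OF has_sum_infsum[OF sum]] by (simp add: sums_def)
  from tendsto_diff[OF tendsto_const[of "infsum (\<lambda>n. norm (f n)) UNIV"] this]
  have T0: "T \<longlonglongrightarrow> 0" by (simp add: T_def[abs_def])
  have bd: "norm (infsum f (rough P) - 1) \<le> T P" for P
  proof -
    have mem: "1 \<in> rough P" by (auto simp: rough_def)
    then have "infsum f (rough P) = infsum f ({1} \<union> (rough P - {1}))" by (simp add: insert_absorb)
    also have "\<dots> = 1 + infsum f (rough P - {1})"
      by (subst infsum_Un_disjoint) (use sm f1 in auto)
    finally have "norm (infsum f (rough P) - 1) = norm (infsum f (rough P - {1}))" by simp
    also have "\<dots> \<le> infsum (\<lambda>n. norm (f n)) (rough P - {1})"
      by (rule norm_infsum_bound) (use sm in auto)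
    also have "\<dots> \<le> infsum (\<lambda>n. norm (f n)) {P..}"
    proof (rule infsum_mono_neutral)
      fix n assume "n \<in> rough P - {1} - {P..}"
      then have n: "n \<in> rough P" "n \<noteq> 1" "n < P" by auto
      then obtain p where p: "prime p" "p dvd n" using prime_factor_nat by blast
      then have "p \<le> n" using n by (intro dvd_imp_le) (auto simp: rough_def)
      then show "norm (f n) \<le> 0" using p n by (auto simp: rough_def)
    qed (use sm in auto)
    finally show ?thesis by (simp add: T)
  qed
  have "(\<lambda>P. infsum f (rough P) - 1) \<longlonglongrightarrow> 0"
    by (rule Lim_null_comparison[OF always_eventually T0]) (use bd in blast)
  then show ?thesis by (simp add: LIM_zero_iff)
qed

text \<open>Mean value theorem on a unit interval: the derivative is estimated at the left end here
  and at the right end in \<open>powr_le_diff\<close>.\<close>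

lemma powr_diff_le:
  fixes e :: real
  assumes "e > 0"
  shows "real (Suc k) powr - e - real (Suc (Suc k)) powr - e \<le> e * real (Suc k) powr (- e - 1)"
proof -
  have "\<exists>z>real (Suc k). z < real (Suc (Suc k)) \<and>
      real (Suc (Suc k)) powr - e - real (Suc k) powr - e = (real (Suc (Suc k)) - real (Suc k)) * (- e * z powr (- e - 1))"
    by (rule MVT2) (auto intro!: derivative_eq_intros simp: field_simps powr_diff)
  then obtain z where z: "z > real (Suc k)"
    "real (Suc (Suc k)) powr - e - real (Suc k) powr - e = - e * z powr (- e - 1)" by auto
  have "e * z powr (- e - 1) \<le> e * real (Suc k) powr (- e - 1)"
    using z assms by (intro mult_left_mono powr_mono2') auto
  then show ?thesis using z by linarith
qed

lemma powr_le_diff: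
  fixes e :: real
  assumes "e > 0"
  shows "e * real (Suc (Suc k)) powr (- e - 1) \<le> real (Suc k) powr - e - real (Suc (Suc k)) powr - e"
proof -
  have "\<exists>z>real (Suc k). z < real (Suc (Suc k)) \<and>
      real (Suc (Suc k)) powr - e - real (Suc k) powr - e = (real (Suc (Suc k)) - real (Suc k)) * (- e * z powr (- e - 1))"
    by (rule MVT2) (auto intro!: derivative_eq_intros simp: field_simps powr_diff)
  then obtain z where z: "z > real (Suc k)" "z < real (Suc (Suc k))"
    "real (Suc (Suc k)) powr - e - real (Suc k) powr - e = - e * z powr (- e - 1)" by auto
  have "e * real (Suc (Suc k)) powr (- e - 1) \<le> e * z powr (- e - 1)"
    using z assms by (intro mult_left_mono powr_mono2') auto
  then show ?thesis using z by linarith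
qed

text \<open>Partial sums of zeta at \<open>1 + e\<close>: the summand at 0 is 0, the one at 1 is 1,
  and the others telescope through \<open>powr_le_diff\<close>.\<close>

lemma sum_powr_le:
  fixes e :: real
  assumes "0 < e"
  shows "(\<Sum>n<M. real n powr (- 1 - e)) \<le> 1 + 1 / e"
proof -
  have "e * (\<Sum>k<M. real (Suc (Suc k)) powr (- e - 1)) \<le> (\<Sum>k<M. real (Suc k) powr - e - real (Suc (Suc k)) powr - e)" for M
    unfolding sum_distrib_left using assms by (intro sum_mono powr_le_diff)
  also have "\<dots> M = 1 - real (Suc M) powr - e" for M
    by (induction M) auto
  also have "\<dots> M \<le> 1" for M by simp
  finally have *: "(\<Sum>k<M. real (Suc (Suc k)) powr (- e - 1)) \<le> 1 / e" for M
    using assms by (simp add: field_simps)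
  have "(\<Sum>n<M. real n powr (- 1 - e)) \<le> (\<Sum>n<Suc (Suc M). real n powr (- 1 - e))"
    by simp
  also have "\<dots> = 1 + (\<Sum>k<M. real (Suc (Suc k)) powr (- e - 1))"
    by (simp add: sum.lessThan_Suc_shift add.commute minus_diff_commute del: sum.lessThan_Suc)
  finally show ?thesis using *[of M] by linarith
qed

lemma abs_summable_powr:
  fixes g :: "nat \<Rightarrow> complex"
  assumes "0 < e" and "\<And>n. norm (g n) \<le> 1"
  shows "(\<lambda>n. norm (g n * complex_of_real (real n powr (- 1 - e)))) summable_on UNIV"
proof -
  have "summable (\<lambda>n. real n powr (- 1 - e))" using assms by (subst summable_real_powr_iff) simp
  then have "summable (\<lambda>n. norm (g n * of_real (real n powr (- 1 - e))))"
    by (rule summable_comparison_test[rotated]) (use assms in \<open>auto simp: norm_mult mult_left_le_one_le\<close>)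
  then show ?thesis by (subst summable_on_UNIV_nonneg_real_iff) auto
qed

lemma infsum_powr_LIMSEQ:
  fixes g :: "nat \<Rightarrow> complex"
  assumes "0 < e" and "\<And>n. norm (g n) \<le> 1"
  shows "(\<lambda>M. \<Sum>k<M. g (Suc k) * of_real (real (Suc k) powr (- 1 - e)))
     \<longlonglongrightarrow> infsum (\<lambda>n. g n * of_real (real n powr (- 1 - e))) UNIV"
proof -
  let ?f = "\<lambda>n. g n * of_real (real n powr (- 1 - e))"
  have "?f summable_on UNIV" using abs_summable_powr[of e g, OF assms] by (rule abs_summable_summable)
  then have "?f sums infsum ?f UNIV" by (simp add: has_sum_imp_sums)
  then have "(\<lambda>M. \<Sum>k<Suc M. ?f k) \<longlonglongrightarrow> infsum ?f UNIV"
    unfolding sums_def by (rule LIMSEQ_Suc)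
  then show ?thesis by (simp add: sum.lessThan_Suc_shift del: sum.lessThan_Suc)
qed

context nonprincipal_character
begin

text \<open>The weights decrease from 1, so the bound on the partial sums of \<open>chi\<close>
  survives uniformly in \<open>e\<close>.\<close>

lemma norm_L_le:
  assumes e: "0 < e"
  shows "norm (infsum (\<lambda>n. chi n * of_real (real n powr (- 1 - e))) UNIV) \<le> N"
proof (rule LIMSEQ_le_const2[OF tendsto_norm[OF infsum_powr_LIMSEQ[OF e norm_chi_le]]])
  have "norm (\<Sum>k<M. chi (Suc k) * of_real (real (Suc k) powr (- 1 - e))) \<le> N * real (Suc 0) powr (- 1 - e)" for M
    by (rule norm_sum_decseq_le[OF norm_partial_sum_Suc_le]) (use e in \<open>auto intro!: powr_mono2'\<close>)
  then show "\<exists>K. \<forall>M\<ge>K. norm (\<Sum>k<M. chi (Suc k) * of_real (real (Suc k) powr (- 1 - e))) \<le> N" by simp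
qed

text \<open>If the series sums to 0, a partial sum is minus its tail, and tails are blocks with
  first weight \<open>1 / Suc n\<close>.\<close>

lemma L1_tail_le:
  assumes "(\<lambda>k. chi (Suc k) / Suc k) sums 0"
  shows "norm (\<Sum>k<n. chi (Suc k) / Suc k) \<le> 2 * N / Suc n"
proof -
  let ?f = "\<lambda>k. chi (Suc k) / Suc k"
  have "(\<lambda>M. \<Sum>k<M + n. ?f k) \<longlonglongrightarrow> 0"
    using assms unfolding sums_def by (rule LIMSEQ_ignore_initial_segment)
  moreover have "(\<Sum>k<M + n. ?f k) = (\<Sum>k<n. ?f k) + (\<Sum>k<M. ?f (n + k))" for M
    by (induction M) (auto simp: algebra_simps)
  ultimately have "(\<lambda>M. (\<Sum>k<n. ?f k) + (\<Sum>k<M. ?f (n + k)) - (\<Sum>k<n. ?f k)) \<longlonglongrightarrow> 0 - (\<Sum>k<n. ?f k)"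
    by (intro tendsto_diff) simp_all
  then have "(\<lambda>M. norm (\<Sum>k<M. ?f (n + k))) \<longlonglongrightarrow> norm (\<Sum>k<n. ?f k)"
    using tendsto_norm by fastforce
  moreover have "norm (\<Sum>k<M. chi (Suc (n + k)) * of_real (1 / Suc (n + k))) \<le> 2 * real N * (1 / Suc n)" for M
    by (rule norm_sum_decseq_shift_le[where f = "\<lambda>k. chi (Suc k)" and b = "\<lambda>k. 1 / real (Suc k)", OF norm_partial_sum_Suc_le])
      (auto simp: frac_le)
  ultimately show ?thesis by (intro LIMSEQ_le_const2) auto
qed

text \<open>A zero at 1 makes the value at \<open>1 + e\<close> of order \<open>e\<close>. Summation
  by parts against \<open>k powr - e\<close> pairs partial sums of order \<open>1 / k\<close> with
  differences of order \<open>e / k\<close>, which leaves \<open>e\<close> times the series of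
  \<open>1 / k^2\<close>.\<close>

lemma norm_L_le_if_L1_eq_0:
  assumes L1: "(\<lambda>k. chi (Suc k) / Suc k) sums 0" and e: "0 < e"
  shows "norm (infsum (\<lambda>n. chi n * of_real (real n powr (- 1 - e))) UNIV) \<le> 2 * N * (\<Sum>k. 1 / real (Suc k) ^ 2) * e"
proof -
  define C where "C = (\<Sum>k. 1 / real (Suc k) ^ 2)"
  have smC: "summable (\<lambda>k. 1 / real (Suc k) ^ 2)"
    using inverse_power_summable[of 2, where 'a = real] by (subst summable_Suc_iff) (simp add: field_simps)
  define T where "T n = (\<Sum>k<n. chi (Suc k) / Suc k)" for n
  have T: "norm (T n) \<le> 2 * N / Suc n" for n unfolding T_def by (rule L1_tail_le[OF L1])
  have bd: "norm (\<Sum>k<M. chi (Suc k) * of_real (real (Suc k) powr (- 1 - e))) \<le> 2 * N * C * e + 2 * N / Suc M" for M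
  proof -
    let ?b = "\<lambda>k. real (Suc k) powr - e"
    have "(\<Sum>k<M. chi (Suc k) * of_real (real (Suc k) powr (- 1 - e))) = (\<Sum>k<M. chi (Suc k) / Suc k * of_real (?b k))"
    proof (rule sum.cong[OF refl])
      fix k
      have "real (Suc k) powr (- 1 - e) = 1 / real (Suc k) * ?b k"
        by (simp add: powr_diff powr_minus field_simps)
      then show "chi (Suc k) * of_real (real (Suc k) powr (- 1 - e)) = chi (Suc k) / Suc k * of_real (?b k)"
        by simp
    qed
    also have "\<dots> = (\<Sum>k<M. T (Suc k) * (?b k - ?b (Suc k))) + T M * ?b M"
      unfolding T_def by (rule sum_by_parts)
    also have "norm \<dots> \<le> (\<Sum>k<M. norm (T (Suc k) * (?b k - ?b (Suc k)))) + norm (T M * ?b M)"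
      by (intro order_trans[OF norm_triangle_ineq] add_mono norm_sum order_refl)
    also have "\<dots> \<le> (\<Sum>k<M. 2 * N * e * (1 / real (Suc k) ^ 2)) + 2 * N / Suc M"
    proof (intro add_mono sum_mono)
      fix k
      have d0: "?b k - ?b (Suc k) \<ge> 0" using e by (simp add: powr_mono2')
      have "?b k - ?b (Suc k) \<le> e * real (Suc k) powr (- e - 1)" using powr_diff_le[OF e] .
      also have "\<dots> \<le> e * real (Suc k) powr - 1" using e by (intro mult_left_mono powr_mono) auto
      finally have d: "?b k - ?b (Suc k) \<le> e * (1 / Suc k)" by (simp add: powr_minus field_simps)
      have t: "norm (T (Suc k)) \<le> 2 * N * (1 / Suc k)"
        using T[of "Suc k"] frac_le[of "2 * real N" "2 * real N" "Suc k" "Suc (Suc k)"] by simp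
      have "norm (T (Suc k)) * (?b k - ?b (Suc k)) \<le> (2 * N * (1 / Suc k)) * (e * (1 / Suc k))"
        using t d d0 by (intro mult_mono) auto
      moreover have "norm (complex_of_real (?b k - ?b (Suc k))) = ?b k - ?b (Suc k)"
        using d0 by (simp only: norm_of_real abs_of_nonneg)
      ultimately show "norm (T (Suc k) * (?b k - ?b (Suc k))) \<le> 2 * N * e * (1 / real (Suc k) ^ 2)"
        by (simp only: norm_mult) (simp add: power2_eq_square mult_ac)
    next
      have "?b M \<le> 1" using e powr_mono[of "- e" 0 "real (Suc M)"] by simp
      then have "norm (T M) * ?b M \<le> (2 * N / Suc M) * 1" using T[of M] by (intro mult_mono) auto
      then show "norm (T M * ?b M) \<le> 2 * N / Suc M" by (simp add: norm_mult)
    qed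
    also have "(\<Sum>k<M. 2 * N * e * (1 / real (Suc k) ^ 2)) = 2 * N * e * (\<Sum>k<M. 1 / real (Suc k) ^ 2)"
      by (simp only: sum_distrib_left)
    also have "\<dots> \<le> 2 * N * e * C" unfolding C_def
      using e smC by (intro mult_left_mono sum_le_suminf) auto
    finally show ?thesis by (simp add: mult_ac)
  qed
  have "(\<lambda>M. 2 * N * C * e + 2 * N / Suc M) \<longlonglongrightarrow> 2 * N * C * e + 0"
    by (intro tendsto_add tendsto_const LIMSEQ_Suc lim_const_over_n)
  from LIMSEQ_le[OF tendsto_norm[OF infsum_powr_LIMSEQ[OF e norm_chi_le]] this] bd
  show ?thesis unfolding C_def by auto
qed

text \<open>At \<open>1 + e\<close> zeta is at most \<open>2 / e\<close>, the assumed zero gives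
  \<open>C * e\<close>, and the second hypothesis makes the square nonprincipal, hence bounded. Thus
  zeta cubed times the fourth power of \<open>L(chi)\<close> times \<open>L(chi^2)\<close> is of
  order \<open>e\<close>, although it is at least 1 in norm.\<close>

lemma L1_nonzero_if_complex:
  assumes c: "coprime m' N" "chi m' ^ 2 \<noteq> 1"
  shows "\<not> (\<lambda>k. chi (Suc k) / Suc k) sums 0"
proof
  assume L1: "(\<lambda>k. chi (Suc k) / Suc k) sums 0"
  interpret sq: residue_character N "\<lambda>x. chi x ^ 2" by (rule residue_character_square)
  interpret sq: nonprincipal_character N "\<lambda>x. chi x ^ 2" m' by unfold_locales (use c in auto)
  define C where "C = 2 * N * (\<Sum>k. 1 / real (Suc k) ^ 2)"
  have main: "1 \<le> 8 * C ^ 4 * N * e" if e: "0 < e" "e \<le> 1" for e :: real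
  proof -
    define r where "r n = real n powr (- 1 - e)" for n :: nat
    define F where "F j n = chi n ^ j * of_real (r n)" for j n
    define Z where "Z n = complex_of_real (r n)" for n
    have r_mult: "r (m * n) = r m * r n" and r0: "r 0 = 0" and r1: "r 1 = 1" for m n
      by (simp_all add: r_def powr_mult)
    have r01: "0 \<le> r p" "prime p \<Longrightarrow> r p < 1" for p
      using e powr_less_mono[of "- 1 - e" 0 "real p"] prime_gt_1_nat[of p] by (auto simp: r_def)
    have sF: "(\<lambda>n. norm (F j n)) summable_on UNIV" for j unfolding F_def r_def
      using e norm_chi_le by (intro abs_summable_powr) (auto simp: norm_power power_le_one)
    have sZ: "(\<lambda>n. norm (Z n)) summable_on UNIV" unfolding Z_def r_def
      using abs_summable_powr[of e "\<lambda>_. 1"] e by simp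
    have pF: "infsum (F j) (rough P) = infsum (F j) UNIV * (\<Prod>p | prime p \<and> p < P. 1 - F j p)" for j P
      by (rule infsum_rough[OF sF]) (auto simp: F_def r_mult r0 chi_mult power_mult_distrib)
    have pZ: "infsum Z (rough P) = infsum Z UNIV * (\<Prod>p | prime p \<and> p < P. 1 - Z p)" for P
      by (rule infsum_rough[OF sZ]) (auto simp: Z_def r_mult r0)
    \<comment> \<open>The same product of sums taken over \<open>rough P\<close> tends to 1, yet it
      is \<open>A\<close> times finitely many local factors of norm at most 1. Hence
      \<open>1 \<le> norm A\<close>.\<close>
    define A where "A = infsum Z UNIV ^ 3 * infsum (F 1) UNIV ^ 4 * infsum (F 2) UNIV"
    have "(\<lambda>P. infsum Z (rough P) ^ 3 * infsum (F 1) (rough P) ^ 4 * infsum (F 2) (rough P)) \<longlonglongrightarrow> 1 ^ 3 * 1 ^ 4 * 1"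
      by (intro tendsto_intros tendsto_infsum_rough sF sZ) (use chi_1 r1 in \<open>auto simp: F_def Z_def\<close>)
    then have lim: "(\<lambda>P. norm (infsum Z (rough P) ^ 3 * infsum (F 1) (rough P) ^ 4 * infsum (F 2) (rough P))) \<longlonglongrightarrow> 1"
      using tendsto_norm by fastforce
    have "norm (infsum Z (rough P) ^ 3 * infsum (F 1) (rough P) ^ 4 * infsum (F 2) (rough P)) \<le> norm A" for P
    proof -
      let ?q = "\<lambda>p. (1 - Z p) ^ 3 * (1 - F 1 p) ^ 4 * (1 - F 2 p)"
      have "infsum Z (rough P) ^ 3 * infsum (F 1) (rough P) ^ 4 * infsum (F 2) (rough P) = A * (\<Prod>p | prime p \<and> p < P. ?q p)"
        unfolding pF pZ A_def by (simp add: power_mult_distrib prod.distrib prod_power_distrib mult_ac)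
      moreover have "norm (?q p) \<le> 1" if "prime p" for p
        using norm_341_le_1[of "chi p" "r p"] r01[of p] that norm_chi[of p] chi_0[of p]
        by (cases "coprime p N") (auto simp: Z_def F_def)
      then have "norm (\<Prod>p | prime p \<and> p < P. ?q p) \<le> 1"
        unfolding prod_norm[symmetric] by (intro prod_le_1) auto
      ultimately show ?thesis by (simp add: norm_mult mult_left_le)
    qed
    then have "1 \<le> norm A" by (intro LIMSEQ_le_const2[OF lim]) auto
    also have "norm A = norm (infsum Z UNIV) ^ 3 * norm (infsum (F 1) UNIV) ^ 4 * norm (infsum (F 2) UNIV)"
      by (simp add: A_def norm_mult norm_power)
    also have "\<dots> \<le> (2 / e) ^ 3 * (C * e) ^ 4 * N"
    proof (intro mult_mono power_mono)
      have "norm (infsum Z UNIV) \<le> 1 + 1 / e"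
      proof (rule LIMSEQ_le_const2)
        show "(\<lambda>M. norm (\<Sum>n<M. Z n)) \<longlonglongrightarrow> norm (infsum Z UNIV)"
          using sZ abs_summable_summable has_sum_imp_sums[OF has_sum_infsum[of Z UNIV]]
          unfolding sums_def by (intro tendsto_norm) blast
        have "norm (\<Sum>n<M. Z n) \<le> 1 + 1 / e" for M
          using sum_powr_le[OF e(1), of M] by (intro order_trans[OF norm_sum]) (simp add: Z_def r_def)
        then show "\<exists>K. \<forall>M\<ge>K. norm (\<Sum>n<M. Z n) \<le> 1 + 1 / e" by blast
      qed
      also have "\<dots> \<le> 2 / e" using e by (simp add: field_simps)
      finally show "norm (infsum Z UNIV) \<le> 2 / e" .
      show "norm (infsum (F 1) UNIV) \<le> C * e"
        using norm_L_le_if_L1_eq_0[OF L1 e(1)] by (simp add: C_def F_def[abs_def] r_def)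
      show "norm (infsum (F 2) UNIV) \<le> N"
        using sq.norm_L_le[OF e(1)] by (simp add: F_def[abs_def] r_def)
    qed (use e in \<open>auto simp: C_def intro!: mult_nonneg_nonneg suminf_nonneg\<close>)
    also have "\<dots> = 8 * C ^ 4 * N * e" using e by (simp add: field_simps power2_eq_square power3_eq_cube power4_eq_xxxx)
    finally show ?thesis .
  qed
  define K where "K = 8 * C ^ 4 * N"
  have K: "K \<ge> 0" by (simp add: K_def)
  \<comment> \<open>The choice \<open>e = 1 / (K + 1)\<close> makes
    \<open>K * e < 1\<close>.\<close>
  have "1 \<le> K * (1 / (K + 1))" unfolding K_def by (rule main) (use K in \<open>auto simp flip: K_def\<close>)
  then show False using K by (simp add: field_simps)
qed

end

section \<open>Nonvanishing of \<open>L(1, \<chi>)\<close> for real characters\<close>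

lemma sum_divisors_coprime_mult:
  fixes f :: "nat \<Rightarrow> real"
  assumes cop: "coprime a b" and mult: "\<And>m n. f (m * n) = f m * f n"
  shows "(\<Sum>d | d dvd a * b. f d) = (\<Sum>d | d dvd a. f d) * (\<Sum>d | d dvd b. f d)"
proof -
  let ?g = "\<lambda>(x, y). x * y :: nat"
  have inj: "inj_on ?g ({d. d dvd a} \<times> {d. d dvd b})"
  proof (rule inj_onI, clarsimp)
    fix x y x' y' assume d: "x dvd a" "y dvd b" "x' dvd a" "y' dvd b" "x * y = x' * y'"
    have g: "gcd (x * y) a = x" "gcd (x * y) b = y" if "x dvd a" "y dvd b" for x y
    proof -
      have "coprime y a" "coprime x b"
        using that cop by (meson coprime_commute coprime_divisors dvd_refl)+
      then show "gcd (x * y) a = x" "gcd (x * y) b = y" using that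
        by (metis gcd_mult_right_right_cancel gcd_mult_right_left_cancel gcd.commute gcd_proj1_iff nat_1 coprime_commute gcd_nat.absorb_iff1)+
    qed
    show "x = x' \<and> y = y'" using g[of x y] g[of x' y'] d by metis
  qed
  have im: "?g ` ({d. d dvd a} \<times> {d. d dvd b}) = {d. d dvd a * b}"
  proof (intro equalityI subsetI)
    fix d assume "d \<in> {d. d dvd a * b}"
    then obtain x y where "d = x * y" "x dvd a" "y dvd b" using division_decomp[of d a b] by auto
    then show "d \<in> ?g ` ({d. d dvd a} \<times> {d. d dvd b})" by (auto intro!: image_eqI[of _ _ "(x, y)"])
  qed (auto intro: mult_dvd_mono)
  have "(\<Sum>d | d dvd a * b. f d) = (\<Sum>z\<in>{d. d dvd a} \<times> {d. d dvd b}. f (?g z))"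
    unfolding im[symmetric] by (rule sum.reindex[OF inj, unfolded o_def])
  also have "\<dots> = (\<Sum>(x, y)\<in>{d. d dvd a} \<times> {d. d dvd b}. f x * f y)"
    by (intro sum.cong) (auto simp: mult)
  also have "\<dots> = (\<Sum>d | d dvd a. f d) * (\<Sum>d | d dvd b. f d)"
    by (simp add: sum_product sum.cartesian_product)
  finally show ?thesis .
qed

locale sign_function =
  fixes f :: "nat \<Rightarrow> real"
  assumes mult: "f (m * n) = f m * f n" and one: "f 1 = 1" and sign: "f n \<in> {-1, 0, 1}"
begin

text \<open>According as \<open>f p\<close> is 1, 0 or -1, the geometric sum is
  \<open>k + 1\<close>, is 1, or alternates between 1 and 0.\<close>

lemma sum_divisors_prime_power:
  assumes "prime p"
  shows "(\<Sum>d | d dvd p ^ k. f d) \<ge> (if even k then 1 else 0)"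
proof -
  have "{d. d dvd p ^ k} = (^) p ` {..k}" using divides_primepow_nat[OF assms] by auto
  then have "(\<Sum>d | d dvd p ^ k. f d) = (\<Sum>i\<le>k. f (p ^ i))"
    using prime_gt_1_nat[OF assms] by (simp add: sum.reindex inj_on_def o_def)
  also have "\<dots> = (\<Sum>i\<le>k. f p ^ i)"
  proof (rule sum.cong[OF refl])
    show "f (p ^ i) = f p ^ i" for i using one by (induction i) (auto simp: mult)
  qed
  also have "\<dots> \<ge> (if even k then 1 else 0)"
  proof -
    have "(\<Sum>i\<le>k. (-1::real) ^ i) = (if even k then 1 else 0)" by (induction k) auto
    moreover have "(\<Sum>i\<le>k. (0::real) ^ i) = 1" by (induction k) auto
    ultimately show ?thesis using sign[of p] by auto
  qed
  finally show ?thesis .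
qed

lemma sum_divisors_nonneg: "n > 0 \<Longrightarrow> (\<Sum>d | d dvd n. f d) \<ge> 0"
proof (induction n rule: less_induct)
  case (less n)
  show ?case
  proof (cases "n = 1")
    case False
    then obtain p where p: "prime p" "p dvd n" using prime_factor_nat by blast
    define k where "k = multiplicity p n"
    obtain m where m: "n = p ^ k * m" "\<not> p dvd m"
      using multiplicity_decompose'[of n p] less.prems p unfolding k_def by (metis not_prime_unit neq0_conv)
    have k: "k > 0" using m p by (cases k) auto
    have "p ^ k > 1" using k p by (metis one_less_power prime_gt_1_nat)
    then have m': "m < n" "m > 0" using m less.prems by auto
    have "coprime (p ^ k) m" using m p by (simp add: prime_imp_coprime)
    then have "(\<Sum>d | d dvd p ^ k * m. f d) = (\<Sum>d | d dvd p ^ k. f d) * (\<Sum>d | d dvd m. f d)"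
      using m' p by (intro sum_divisors_coprime_mult mult) (auto simp: prime_gt_0_nat)
    moreover have "(\<Sum>d | d dvd p ^ k. f d) \<ge> 0"
      using sum_divisors_prime_power[OF p(1), of k] by (simp split: if_splits)
    ultimately show ?thesis using less.IH[OF m'] m(1) by simp
  qed (use one in simp)
qed

text \<open>All prime exponents of a square are even, so each prime power contributes a factor at
  least 1.\<close>

lemma sum_divisors_square: "n > 0 \<Longrightarrow> (\<Sum>d | d dvd n ^ 2. f d) \<ge> 1"
proof (induction n rule: less_induct)
  case (less n)
  show ?case
  proof (cases "n = 1")
    case False
    then obtain p where p: "prime p" "p dvd n" using prime_factor_nat by blast
    define k where "k = multiplicity p n"
    obtain m where m: "n = p ^ k * m" "\<not> p dvd m"
      using multiplicity_decompose'[of n p] less.prems p unfolding k_def by (metis not_prime_unit neq0_conv)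
    have k: "k > 0" using m p by (cases k) auto
    have "p ^ k > 1" using k p by (metis one_less_power prime_gt_1_nat)
    then have m': "m < n" "m > 0" using m less.prems by auto
    have "coprime (p ^ (2 * k)) (m ^ 2)" using m p by (simp add: prime_imp_coprime)
    then have "(\<Sum>d | d dvd p ^ (2 * k) * m ^ 2. f d) = (\<Sum>d | d dvd p ^ (2 * k). f d) * (\<Sum>d | d dvd m ^ 2. f d)"
      using m' p by (intro sum_divisors_coprime_mult mult) (auto simp: prime_gt_0_nat)
    moreover have "(\<Sum>d | d dvd p ^ (2 * k). f d) \<ge> 1" using sum_divisors_prime_power[OF p(1), of "2 * k"] by simp
    moreover have "(\<Sum>d | d dvd m ^ 2. f d) \<ge> 1" using less.IH m' by simp
    ultimately have "(\<Sum>d | d dvd p ^ (2 * k) * m ^ 2. f d) \<ge> 1 * 1" using mult_mono[of 1 _ 1] by fastforce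
    moreover have "n ^ 2 = p ^ (2 * k) * m ^ 2" by (simp add: m power_mult_distrib power_mult[symmetric] mult.commute)
    ultimately show ?thesis by simp
  qed (use one in simp)
qed

text \<open>On the left only square exponents of the power series of divisor sums are kept.
  Exchanging summations turns the series cut at \<open>M\<close> into geometric series in
  \<open>x ^ d\<close> cut at \<open>M\<close>; each of the \<open>M\<close> cuts costs at most
  \<open>x ^ M / (1 - x)\<close>.\<close>

lemma lambert_sum_ge:
  fixes x :: real
  assumes x: "0 < x" "x < 1" and K: "K ^ 2 \<le> M"
  shows "(\<Sum>k=1..K. x ^ (k ^ 2)) \<le> (\<Sum>d=1..M. f d * (x ^ d / (1 - x ^ d))) + real M * x ^ M / (1 - x)"
proof -
  have "(\<Sum>k=1..K. x ^ (k ^ 2)) \<le> (\<Sum>k=1..K. (\<Sum>d | d dvd k ^ 2. f d) * x ^ (k ^ 2))"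
    using x by (intro sum_mono) (auto intro!: mult_right_mono[of 1, simplified] sum_divisors_square[simplified])
  also have "\<dots> = (\<Sum>n\<in>(\<lambda>k. k ^ 2) ` {1..K}. (\<Sum>d | d dvd n. f d) * x ^ n)"
    by (subst sum.reindex) (auto simp: inj_on_def)
  also have "\<dots> \<le> (\<Sum>n=1..M. (\<Sum>d | d dvd n. f d) * x ^ n)"
  proof (rule sum_mono2)
    show "(\<lambda>k. k ^ 2) ` {1..K} \<subseteq> {1..M}"
      using K by (auto intro: order_trans[OF power_mono])
    show "0 \<le> (\<Sum>d | d dvd b. f d) * x ^ b" if "b \<in> {1..M} - (\<lambda>k. k\<^sup>2) ` {1..K}" for b
      using that x sum_divisors_nonneg[of b] by simp
  qed simp
  also have "\<dots> = (\<Sum>n=1..M. \<Sum>d | d \<in> {1..M} \<and> d dvd n. f d * x ^ n)"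
  proof (rule sum.cong[OF refl])
    fix n assume "n \<in> {1..M}"
    then have "{d. d dvd n} = {d. d \<in> {1..M} \<and> d dvd n}" by (auto dest: dvd_imp_le intro: Nat.gr0I)
    then show "(\<Sum>d | d dvd n. f d) * x ^ n = (\<Sum>d | d \<in> {1..M} \<and> d dvd n. f d * x ^ n)"
      by (simp add: sum_distrib_right)
  qed
  also have "\<dots> = (\<Sum>d=1..M. \<Sum>n | n \<in> {1..M} \<and> d dvd n. f d * x ^ n)"
    by (rule sum.swap_restrict) auto
  also have "\<dots> \<le> (\<Sum>d=1..M. f d * (x ^ d / (1 - x ^ d)) + x ^ M / (1 - x))"
  proof (rule sum_mono)
    fix d assume d: "d \<in> {1..M}"
    define q where "q = M div d"
    define y where "y = x ^ d"
    have y: "0 < y" "y \<le> x" "y < 1" using x d power_decreasing[of 1 d x] by (auto simp: y_def)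
    have im: "{n. n \<in> {1..M} \<and> d dvd n} = (\<lambda>e. d * Suc e) ` {..<q}"
    proof (intro equalityI subsetI)
      fix n assume n: "n \<in> {n. n \<in> {1..M} \<and> d dvd n}"
      then obtain e where e: "n = d * e" by auto
      then obtain e' where e': "e = Suc e'" using n by (cases e) auto
      have "Suc e' \<le> q" using n d unfolding q_def e e' by (simp add: less_eq_div_iff_mult_less_eq mult.commute)
      then show "n \<in> (\<lambda>e. d * Suc e) ` {..<q}" using e e' by auto
    next
      fix n assume "n \<in> (\<lambda>e. d * Suc e) ` {..<q}"
      then obtain e where e: "n = d * Suc e" "e < q" by blast
      then have "n \<le> M" using d Suc_leI[OF e(2)] unfolding q_def e(1) by (simp add: less_eq_div_iff_mult_less_eq mult.commute)
      then show "n \<in> {n. n \<in> {1..M} \<and> d dvd n}" using e d by auto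
    qed
    have "(\<Sum>n | n \<in> {1..M} \<and> d dvd n. f d * x ^ n) = (\<Sum>e<q. f d * x ^ (d * Suc e))"
      unfolding im using d by (subst sum.reindex) (auto simp: inj_on_def)
    also have "\<dots> = f d * (y * (\<Sum>e<q. y ^ e))"
      unfolding y_def power_mult by (simp add: sum_distrib_left)
    also have "(\<Sum>e<q. y ^ e) = (1 - y ^ q) / (1 - y)"
      using y one_diff_power_eq[of y q] by (simp add: field_simps)
    also have "f d * (y * ((1 - y ^ q) / (1 - y))) = f d * (y / (1 - y)) + (- f d) * (y ^ Suc q / (1 - y))"
      by (simp add: right_diff_distrib diff_divide_distrib)
    also have "(- f d) * (y ^ Suc q / (1 - y)) \<le> 1 * (x ^ M / (1 - x))"
    proof (rule mult_mono)
      \<comment> \<open>Since \<open>q = M div d\<close>, the first omitted exponent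
        \<open>d * Suc q\<close> lies beyond \<open>M\<close>.\<close>
      have "M \<le> d * Suc q" unfolding q_def using d
        by (metis add.commute atLeastAtMost_iff div_mult_mod_eq less_imp_le mod_less_divisor mult.commute mult_Suc_right nat_add_left_cancel_le less_le_trans zero_less_one)
      then have "x ^ (d * Suc q) \<le> x ^ M" using x by (intro power_decreasing) auto
      then show "y ^ Suc q / (1 - y) \<le> x ^ M / (1 - x)"
        unfolding y_def power_mult[symmetric] using x y by (intro frac_le) (auto simp: y_def)
      show "- f d \<le> 1" using sign[of d] by auto
      show "0 \<le> y ^ Suc q / (1 - y)" using y by simp
    qed simp
    finally show "(\<Sum>n | n \<in> {1..M} \<and> d dvd n. f d * x ^ n) \<le> f d * (x ^ d / (1 - x ^ d)) + x ^ M / (1 - x)"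
      by (simp add: y_def)
  qed
  also have "\<dots> = (\<Sum>d=1..M. f d * (x ^ d / (1 - x ^ d))) + real M * x ^ M / (1 - x)"
    by (simp add: sum.distrib)
  finally show ?thesis .
qed

end

text \<open>Arithmetic and geometric mean for the terms \<open>i\<close> and
  \<open>n - 1 - i\<close>. The base is a square so that the mean exponent
  \<open>(n - 1) / 2\<close> is an integral power of \<open>y\<close>.\<close>

lemma sum_power_ge:
  fixes y :: real
  assumes "y \<ge> 0"
  shows "real n * y ^ (n - 1) \<le> (\<Sum>i<n. (y ^ 2) ^ i)"
proof -
  have "2 * (\<Sum>i<n. (y ^ 2) ^ i) = (\<Sum>i<n. (y ^ 2) ^ i) + (\<Sum>i<n. (y ^ 2) ^ (n - Suc i))"
    using sum.nat_diff_reindex[of "\<lambda>i. (y ^ 2) ^ i" n] by simp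
  also have "\<dots> = (\<Sum>i<n. (y ^ 2) ^ i + (y ^ 2) ^ (n - Suc i))" by (simp add: sum.distrib)
  also have "\<dots> \<ge> (\<Sum>i<n. 2 * y ^ (n - 1))"
  proof (rule sum_mono)
    fix i assume i: "i \<in> {..<n}"
    have "0 \<le> (y ^ i - y ^ (n - Suc i)) ^ 2" by simp
    also have "\<dots> = (y ^ 2) ^ i + (y ^ 2) ^ (n - Suc i) - 2 * (y ^ i * y ^ (n - Suc i))"
      by (simp add: power2_diff power_mult[symmetric] mult.commute)
    also have "y ^ i * y ^ (n - Suc i) = y ^ (n - 1)" using i by (simp add: power_add[symmetric])
    finally show "2 * y ^ (n - 1) \<le> (y ^ 2) ^ i + (y ^ 2) ^ (n - Suc i)" by simp
  qed
  finally show ?thesis by (simp add: mult.commute)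
qed

text \<open>With \<open>n = Suc k\<close>, both parts grow like \<open>1 / (n * (1 - x))\<close> as
  \<open>x\<close> tends to 1. The first sums against \<open>chi\<close> to
  \<open>L(1) / (1 - x)\<close>, the second to the Lambert series.\<close>

definition monsky_weight :: "real \<Rightarrow> nat \<Rightarrow> real" where
  "monsky_weight x k = 1 / (real (Suc k) * (1 - x)) - x ^ Suc k / (1 - x ^ Suc k)"

lemma monsky_weight_eq:
  assumes "0 < x" "x < 1"
  shows "monsky_weight x k = (1 / real (Suc k) - x ^ Suc k / (\<Sum>i<Suc k. x ^ i)) / (1 - x)"
  using assms one_diff_power_eq[of x "Suc k"] by (simp add: monsky_weight_def diff_divide_distrib mult.commute)

lemma monsky_weight_nonneg:
  assumes x: "0 < x" "x < 1"
  shows "monsky_weight x k \<ge> 0"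
proof -
  have "(\<Sum>i<Suc k. x ^ Suc k) \<le> (\<Sum>i<Suc k. x ^ i)"
    using x by (intro sum_mono power_decreasing) auto
  then have "real (Suc k) * x ^ Suc k \<le> (\<Sum>i<Suc k. x ^ i)" by (simp only: sum_constant card_lessThan)
  moreover have "(\<Sum>i<Suc k. x ^ i) > 0" using x by (intro sum_pos) auto
  ultimately have "x ^ Suc k / (\<Sum>i<Suc k. x ^ i) \<le> 1 / real (Suc k)"
    by (simp only: divide_le_eq) (simp add: field_simps)
  then show ?thesis using x by (simp only: monsky_weight_eq) simp
qed

text \<open>The claim reduces to \<open>n * (n + 1) * x ^ n \<le> P * Q\<close> for the geometric
  sums \<open>P\<close> and \<open>Q\<close> of lengths \<open>n\<close> and \<open>n + 1\<close>.
  By \<open>sum_power_ge\<close> with \<open>y = sqrt x\<close> the right side is at least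
  \<open>n * (n + 1) * y ^ (2 * n - 1)\<close>, and \<open>y \<le> 1\<close>.\<close>

lemma monsky_weight_decreasing:
  assumes x: "0 < x" "x < 1"
  shows "monsky_weight x (Suc k) \<le> monsky_weight x k"
proof -
  define n where "n = Suc k"
  define P where "P = (\<Sum>i<n. x ^ i)"
  define Q where "Q = (\<Sum>i<Suc n. x ^ i)"
  have Q: "Q = 1 + x * P" unfolding P_def Q_def
    by (simp add: sum.lessThan_Suc_shift sum_distrib_left del: sum.lessThan_Suc)
  have P0: "P > 0" using x unfolding P_def n_def by (intro sum_pos) auto
  have Q0: "Q > 0" using x unfolding Q_def by (intro sum_pos) auto
  have n0: "real n > 0" by (simp add: n_def)
  define y where "y = sqrt x"
  have y: "y ^ 2 = x" "0 \<le> y" "y \<le> 1" using x by (auto simp: y_def)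
  have "real n * y ^ (n - 1) \<le> P" "real (Suc n) * y ^ n \<le> Q"
    using sum_power_ge[OF y(2), of n] sum_power_ge[OF y(2), of "Suc n"] unfolding P_def Q_def y by auto
  then have "(real n * y ^ (n - 1)) * (real (Suc n) * y ^ n) \<le> P * Q"
    using y P0 by (intro mult_mono) auto
  moreover have "x ^ n \<le> y ^ (n - 1) * y ^ n"
    unfolding y(1)[symmetric] power_mult[symmetric] power_add[symmetric] using y by (intro power_decreasing) auto
  then have "(real n * real (Suc n)) * x ^ n \<le> (real n * real (Suc n)) * (y ^ (n - 1) * y ^ n)"
    by (intro mult_left_mono) auto
  ultimately have key: "real n * real (Suc n) * x ^ n \<le> P * Q" by (simp add: mult_ac)
  have "x ^ n / P - x ^ Suc n / Q = x ^ n / (P * Q)"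
    using P0 Q0 by (simp add: field_simps) (simp add: Q algebra_simps)
  also have "\<dots> \<le> 1 / (real n * real (Suc n))"
    using divide_left_mono[OF key, of "x ^ n"] key P0 Q0 n0 x by (simp add: divide_simps mult_ac)
  also have "\<dots> = 1 / real n - 1 / real (Suc n)" using n0 by (simp add: field_simps)
  finally have "1 / real (Suc n) - x ^ Suc n / Q \<le> 1 / real n - x ^ n / P" by linarith
  then have "(1 / real (Suc n) - x ^ Suc n / Q) / (1 - x) \<le> (1 / real n - x ^ n / P) / (1 - x)"
    using x by (intro divide_right_mono) auto
  then show ?thesis using monsky_weight_eq[OF x, of k] monsky_weight_eq[OF x, of "Suc k"] by (simp only: n_def P_def Q_def)
qed

context nonprincipal_character
begin

text \<open>Monsky's argument: were \<open>L(1, \<chi>) = 0\<close>, the Lambert series of \<open>\<chi>\<close> would be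
  \<open>- (\<Sum>n. \<chi> n * monsky_weight x (n - 1))\<close>, which is bounded as \<open>x\<close> tends to 1, whereas its
  coefficients \<open>\<Sum>d | d dvd n. \<chi> d\<close> are nonnegative and at least 1 on squares.\<close>

lemma L1_nonzero_if_real:
  assumes re: "\<And>x. coprime x N \<Longrightarrow> chi x ^ 2 = 1"
  shows "\<not> (\<lambda>k. chi (Suc k) / Suc k) sums 0"
proof
  assume L1: "(\<lambda>k. chi (Suc k) / Suc k) sums 0"
  define f where "f n = Re (chi n)" for n
  have vals: "chi n \<in> {-1, 0, 1}" for n
    using re[of n] chi_0[of n] by (cases "coprime n N") (auto simp: power2_eq_1_iff)
  have chi_f: "chi n = of_real (f n)" for n using vals[of n] by (auto simp: f_def)
  interpret sign_function f
  proof
    show "f (a * b) = f a * f b" for a b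
      using chi_f by (metis chi_mult of_real_eq_iff of_real_mult)
    show "f n \<in> {-1, 0, 1}" for n using vals[of n] by (auto simp: f_def)
  qed (use chi_1 in \<open>simp add: f_def\<close>)
  have bound: "(\<Sum>k=1..K. x ^ (k ^ 2)) \<le> N" if x: "0 < x" "x < 1" for x :: real and K
  proof -
    let ?T = "\<lambda>M. \<Sum>k<M. chi (Suc k) / Suc k"
    have "(\<Sum>k=1..K. x ^ (k ^ 2)) \<le> norm (?T M) / (1 - x) + N + real M * x ^ M / (1 - x)" if M: "K ^ 2 \<le> M" for M
    proof -
      have s: "(\<Sum>d=1..M. g d) = (\<Sum>k<M. g (Suc k))" for g :: "nat \<Rightarrow> real"
        using sum.atLeast1_atMost_eq[of g M] by simp
      have "complex_of_real (\<Sum>d=1..M. f d * (x ^ d / (1 - x ^ d)))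
          = ?T M / (1 - x) - (\<Sum>k<M. chi (Suc k) * monsky_weight x k)"
      proof -
        have "complex_of_real (f (Suc k) * (x ^ Suc k / (1 - x ^ Suc k)))
           = chi (Suc k) / Suc k / (1 - x) - chi (Suc k) * monsky_weight x k" for k
        proof -
          have "x ^ Suc k / (1 - x ^ Suc k) = 1 / real (Suc k) / (1 - x) - monsky_weight x k"
            by (simp add: monsky_weight_def)
          then show ?thesis by (simp only: of_real_mult chi_f of_real_diff) (simp add: right_diff_distrib)
        qed
        then show ?thesis unfolding s of_real_sum by (simp only: sum_subtractf sum_divide_distrib)
      qed
      then have "\<bar>\<Sum>d=1..M. f d * (x ^ d / (1 - x ^ d))\<bar>
          = norm (?T M / (1 - x) - (\<Sum>k<M. chi (Suc k) * monsky_weight x k))"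
        by (metis norm_of_real)
      also have "\<dots> \<le> norm (?T M / (1 - x)) + norm (\<Sum>k<M. chi (Suc k) * monsky_weight x k)"
        by (rule norm_triangle_ineq4)
      also have "norm (\<Sum>k<M. chi (Suc k) * monsky_weight x k) \<le> N * monsky_weight x 0"
        by (rule norm_sum_decseq_le[OF norm_partial_sum_Suc_le])
          (use monsky_weight_decreasing[OF x] monsky_weight_nonneg[OF x] in auto)
      also have "monsky_weight x 0 = 1" using x by (simp add: monsky_weight_def field_simps)
      also have "norm (?T M / (1 - x)) = norm (?T M) / (1 - x)"
      proof -
        have "norm (1 - complex_of_real x) = 1 - x"
          using x by (metis abs_of_nonneg diff_ge_0_iff_ge less_imp_le norm_of_real of_real_1 of_real_diff)
        then show ?thesis by (simp add: norm_divide)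
      qed
      finally show ?thesis using lambert_sum_ge[OF x M] by linarith
    qed
    \<comment> \<open>As \<open>M\<close> grows, the first term vanishes by the assumed zero and the
      third because \<open>x < 1\<close>; only the weight at 0 times the bound \<open>N\<close> of
      the partial sums is left.\<close>
    moreover have "(\<lambda>M. norm (?T M) / (1 - x) + N + real M * x ^ M / (1 - x)) \<longlonglongrightarrow> norm (0 :: complex) / (1 - x) + N + 0 / (1 - x)"
      using L1 x unfolding sums_def by (intro tendsto_intros powser_times_n_limit_0) (auto simp: divide_simps)
    ultimately show ?thesis
      by (intro LIMSEQ_le_const[where X = "\<lambda>M. norm (?T M) / (1 - x) + N + real M * x ^ M / (1 - x)"]) auto
  qed
  \<comment> \<open>The bound is uniform in \<open>x\<close> and in the number of squares:
    \<open>N + 1\<close> of them, each tending to 1 with \<open>x\<close>, exceed it.\<close>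
  have "real (N + 1) \<le> N"
  proof (rule tendsto_upperbound)
    have "((\<lambda>x::real. \<Sum>k=1..N+1. x ^ (k ^ 2)) \<longlongrightarrow> (\<Sum>k=1..N+1. 1 ^ (k ^ 2))) (at_left 1)"
      by (intro tendsto_intros)
    then show "((\<lambda>x::real. \<Sum>k=1..N+1. x ^ (k ^ 2)) \<longlongrightarrow> real (N + 1)) (at_left 1)" by simp
    have "eventually (\<lambda>x::real. x \<in> {0<..<1}) (at_left 1)" by (rule eventually_at_left_real) simp
    then show "eventually (\<lambda>x::real. (\<Sum>k=1..N+1. x ^ (k ^ 2)) \<le> N) (at_left 1)"
      by eventually_elim (rule bound, auto)
  qed simp
  then show False by simp
qed

end

section \<open>Odd characters and sawtooth sums\<close>

context nonprincipal_character
begin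

theorem L1_nonzero: "\<not> (\<lambda>k. chi (Suc k) / Suc k) sums 0"
  using L1_nonzero_if_real L1_nonzero_if_complex by blast

end

text \<open>Logarithmic derivative of the reflection formula of the Gamma function.\<close>

lemma Digamma_reflection_real:
  fixes t :: real
  assumes t: "0 < t" "t < 1"
  shows "Digamma (1 - t) - Digamma t = pi * cot (pi * t)"
proof -
  have refl: "Gamma u * Gamma (1 - u) = pi / sin (pi * u)" for u :: real
  proof -
    have "complex_of_real (Gamma u * Gamma (1 - u)) = complex_of_real (pi / sin (pi * u))"
      using Gamma_reflection_complex[of "complex_of_real u"]
      by (simp add: Gamma_complex_of_real[symmetric] sin_of_real[symmetric])
    then show ?thesis using of_real_eq_iff by blast
  qed
  have s: "sin (pi * t) > 0" using t by (intro sin_gt_zero) auto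
  have np: "t \<notin> \<int>\<^sub>\<le>\<^sub>0" "1 - t \<notin> \<int>\<^sub>\<le>\<^sub>0" using t by (auto elim!: nonpos_Ints_cases)
  have "((\<lambda>u. Gamma u * Gamma (1 - u)) has_field_derivative
      Gamma t * Gamma (1 - t) * (Digamma t - Digamma (1 - t))) (at t)"
    using np by (auto intro!: derivative_eq_intros simp: algebra_simps)
  moreover have "((\<lambda>u. pi / sin (pi * u)) has_field_derivative
      pi / sin (pi * t) * (- pi * cot (pi * t))) (at t)"
    using s by (auto intro!: derivative_eq_intros simp: cot_def field_simps power2_eq_square)
  ultimately have "pi / sin (pi * t) * (Digamma t - Digamma (1 - t)) = pi / sin (pi * t) * (- pi * cot (pi * t))"
    unfolding refl by (rule DERIV_unique)
  moreover have "pi / sin (pi * t) \<noteq> 0" using s by simp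
  ultimately have "Digamma t - Digamma (1 - t) = - pi * cot (pi * t)" using mult_left_cancel by blast
  then show ?thesis by simp
qed

text \<open>The limits for Digamma at \<open>1 - t\<close> and at \<open>t\<close> carry the same
  \<open>ln M\<close>, which cancels.\<close>

lemma cot_partial_fractions:
  fixes t :: real
  assumes t: "0 < t" "t < 1"
  shows "(\<lambda>M. \<Sum>q<M. 1 / (t + real q) - 1 / (1 - t + real q)) \<longlonglongrightarrow> pi * cot (pi * t)"
proof -
  have "(\<lambda>M. (of_real (ln (real M)) - (\<Sum>q<M. inverse (1 - t + of_nat q)))
       - (of_real (ln (real M)) - (\<Sum>q<M. inverse (t + of_nat q)))) \<longlonglongrightarrow> Digamma (1 - t) - Digamma t"
    using t by (intro tendsto_diff Digamma_LIMSEQ) auto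
  then show ?thesis unfolding Digamma_reflection_real[OF t] by (simp add: sum_subtractf inverse_eq_divide)
qed

text \<open>The sum is \<open>2 * N / pi\<close> times \<open>L(1)\<close>: group the series by
  residues and, by oddness, average the class of \<open>x\<close> with that of \<open>N - x\<close>;
  the partial fractions then give the cotangent.\<close>

lemma odd_character_cot_sum_nonzero:
  assumes "residue_character N chi" and odd: "chi (N - 1) = -1"
  shows "(\<Sum>x\<in>{1..<N}. chi x * cot (pi * x / N)) \<noteq> 0"
proof
  assume cot0: "(\<Sum>x\<in>{1..<N}. chi x * cot (pi * x / N)) = 0"
  interpret residue_character N chi by fact
  have "coprime (N - 1) N" using odd chi_0 by fastforce
  then interpret nonprincipal_character N chi "N - 1"
    by unfold_locales (use odd in auto)
  define g where "g n = chi n / of_nat n" for n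
  have sm: "summable g" using summable_L1 unfolding g_def by (subst summable_Suc_iff[symmetric]) simp
  have g0: "g 0 = 0" by (simp add: g_def)
  define A where "A M x = (\<Sum>q<M. 1 / (real (q * N + x)))" for M x
  have per: "chi (q * N + x) = chi x" for q x using chi_mod[of "q * N + x"] chi_mod[of x] by simp
  have flip: "chi (N - x) = - chi x" if "x \<le> N" for x
  proof -
    have "[(N - 1) * x = N - x] (mod N)"
    proof -
      have "(N - 1) * x + x = N * x" using N_pos by (cases N) auto
      then have "[(N - 1) * x + x = N - x + x] (mod N)" using that by (simp add: cong_def)
      then show ?thesis using cong_add_rcancel_nat by blast
    qed
    then have "chi (N - x) = chi ((N - 1) * x)" by (metis chi_mod cong_def)
    then show ?thesis using odd by (simp add: chi_mult)
  qed
  have split: "2 * (\<Sum>n<M * N. g n) = (\<Sum>x\<in>{1..<N}. chi x * complex_of_real (A M x - A M (N - x)))" for M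
  proof -
    have "(\<Sum>n<M * N. g n) = (\<Sum>q<M. \<Sum>n\<in>{q * N..<q * N + N}. g n)"
      by (rule sum.nat_group[symmetric])
    also have "\<dots> = (\<Sum>q<M. \<Sum>x<N. g (q * N + x))"
      by (rule sum.cong[OF refl], subst sum.atLeastLessThan_shift_0) (simp add: lessThan_atLeast0 add.commute)
    also have "\<dots> = (\<Sum>x<N. \<Sum>q<M. g (q * N + x))" by (rule sum.swap)
    also have "\<dots> = (\<Sum>x\<in>{1..<N}. \<Sum>q<M. g (q * N + x))"
    proof (rule sum.mono_neutral_right)
      have "{..<N} - {1..<N} \<subseteq> {0}" by auto
      moreover have "g (q * N) = 0" for q using per[of q 0] by (simp add: g_def chi_zero)
      ultimately show "\<forall>x\<in>{..<N} - {1..<N}. (\<Sum>q<M. g (q * N + x)) = 0" by auto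
    qed auto
    also have "\<dots> = (\<Sum>x\<in>{1..<N}. chi x * complex_of_real (A M x))"
      unfolding A_def by (intro sum.cong refl) (simp only: g_def per of_real_sum sum_distrib_left, simp)
    finally have 1: "(\<Sum>n<M * N. g n) = (\<Sum>x\<in>{1..<N}. chi x * complex_of_real (A M x))" .
    also have "\<dots> = (\<Sum>x\<in>{1..<N}. chi (N - x) * complex_of_real (A M (N - x)))"
      by (rule sum.reindex_bij_witness[of _ "\<lambda>x. N - x" "\<lambda>x. N - x"]) auto
    also have "\<dots> = (\<Sum>x\<in>{1..<N}. - chi x * complex_of_real (A M (N - x)))"
      by (intro sum.cong refl) (simp add: flip)
    finally have 2: "(\<Sum>n<M * N. g n) = (\<Sum>x\<in>{1..<N}. - chi x * complex_of_real (A M (N - x)))" .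
    have "2 * (\<Sum>n<M * N. g n) = (\<Sum>n<M * N. g n) + (\<Sum>n<M * N. g n)" by simp
    also have "\<dots> = (\<Sum>x\<in>{1..<N}. chi x * complex_of_real (A M x)) + (\<Sum>x\<in>{1..<N}. - chi x * complex_of_real (A M (N - x)))"
      using 1 2 by simp
    also have "\<dots> = (\<Sum>x\<in>{1..<N}. chi x * complex_of_real (A M x - A M (N - x)))"
      by (simp only: sum.distrib[symmetric] of_real_diff right_diff_distrib) simp
    finally show ?thesis .
  qed
  have limA: "(\<lambda>M. A M x - A M (N - x)) \<longlonglongrightarrow> pi * cot (pi * x / N) / N" if x: "x \<in> {1..<N}" for x
  proof -
    define t where "t = real x / real N"
    have t: "0 < t" "t < 1" using x by (auto simp: t_def)
    have "A M x - A M (N - x) = (\<Sum>q<M. 1 / (t + real q) - 1 / (1 - t + real q)) / N" for M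
    proof -
      have Nt: "real N * t = real x" using N_pos by (simp add: t_def)
      have "real (q * N + x) = (t + real q) * N" "real (q * N + (N - x)) = (1 - t + real q) * N" for q
        using x Nt by (simp_all add: of_nat_diff algebra_simps)
      then have e: "1 / real (q * N + x) = 1 / (t + real q) / N" "1 / real (q * N + (N - x)) = 1 / (1 - t + real q) / N" for q
        by (simp_all only: divide_divide_eq_left)
      show ?thesis unfolding A_def e by (simp add: sum_subtractf sum_divide_distrib diff_divide_distrib)
    qed
    then show ?thesis using tendsto_divide[OF cot_partial_fractions[OF t] tendsto_const[of "real N"]] N_pos
      by (simp add: t_def)
  qed
  have "(\<lambda>M. 2 * (\<Sum>n<M * N. g n)) \<longlonglongrightarrow> (\<Sum>x\<in>{1..<N}. chi x * complex_of_real (pi * cot (pi * x / N) / N))"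
    unfolding split by (intro tendsto_intros limA)
  also have "(\<Sum>x\<in>{1..<N}. chi x * complex_of_real (pi * cot (pi * x / N) / N))
      = complex_of_real (pi / N) * (\<Sum>x\<in>{1..<N}. chi x * cot (pi * x / N))"
    unfolding sum_distrib_left by (intro sum.cong refl) simp
  finally have lim0: "(\<lambda>M. 2 * (\<Sum>n<M * N. g n)) \<longlonglongrightarrow> 0" by (simp only: cot0 mult_zero_right)
  \<comment> \<open>Grouping by residues reaches only sums over full periods. As the series is known
    to converge, this subsequence determines its value.\<close>
  have "strict_mono (\<lambda>M. M * N)" using N_pos by (simp add: strict_mono_def)
  from LIMSEQ_subseq_LIMSEQ[OF summable_LIMSEQ[OF sm] this]
  have "(\<lambda>M. 2 * (\<Sum>n<M * N. g n)) \<longlonglongrightarrow> 2 * suminf g"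
    by (intro tendsto_mult tendsto_const) (simp add: o_def)
  from LIMSEQ_unique[OF this lim0] have "suminf g = 0" by simp
  then have "g sums 0" using sm by (simp add: sums_iff)
  then have "(\<lambda>k. g (Suc k)) sums 0" using sums_Suc_iff[of g 0] g0 by simp
  then show False using L1_nonzero by (simp add: g_def)
qed

section \<open>Finite Fourier transform of the sawtooth function\<close>

lemma ex_inverse_mod:
  fixes N :: nat
  assumes "N > 0"
  obtains iv where "\<And>y. coprime y N \<Longrightarrow> [y * iv y = 1] (mod N)" "\<And>y. iv y < N"
    "bij_betw iv {y. y < N \<and> coprime y N} {y. y < N \<and> coprime y N}"
proof -
  have "\<exists>z<N. coprime y N \<longrightarrow> [y * z = 1] (mod N)" for y
  proof (cases "coprime y N")
    case True
    then obtain z where "[y * z = Suc 0] (mod N)" using cong_solve_coprime_nat by blast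
    then have "[y * (z mod N) = 1] (mod N)" by (simp add: cong_def mod_mult_right_eq)
    then show ?thesis using assms by (intro exI[of _ "z mod N"]) auto
  qed (use assms in auto)
  then obtain iv where iv: "\<And>y. iv y < N" "\<And>y. coprime y N \<Longrightarrow> [y * iv y = 1] (mod N)" by metis
  let ?U = "{y. y < N \<and> coprime y N}"
  have inj: "inj_on iv ?U"
  proof (rule inj_onI)
    fix y z assume yz: "y \<in> ?U" "z \<in> ?U" "iv y = iv z"
    have "[y * (z * iv z) = y * 1] (mod N)" "[z * (y * iv y) = z * 1] (mod N)"
      using yz iv(2) by (blast intro: cong_mult cong_refl)+
    then have "[y = z] (mod N)" using yz(3) by (auto simp: cong_def mult_ac)
    then show "y = z" using yz by (simp add: cong_def)
  qed
  have "iv ` ?U \<subseteq> ?U"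
  proof
    fix z assume "z \<in> iv ` ?U"
    then obtain y where y: "z = iv y" "coprime y N" by auto
    then have "coprime (y * z) N" using iv(2)[of y] by (metis cong_imp_coprime cong_sym coprime_1_left)
    then show "z \<in> ?U" using y iv(1) by (simp add: coprime_mult_left_iff)
  qed
  then have "bij_betw iv ?U ?U" using inj endo_inj_surj[of ?U iv] by (auto simp: bij_betw_def)
  then show ?thesis using that iv by blast
qed

lemma sum_index_root_of_unity:
  fixes z :: complex
  assumes "z ^ N = 1" "z \<noteq> 1"
  shows "(\<Sum>k<N. of_nat k * z ^ k) = of_nat N / (z - 1)"
proof -
  have *: "(z - 1) * (\<Sum>k<n. of_nat k * z ^ k) = of_nat n * z ^ n - (\<Sum>k<n. z ^ Suc k)" for n
    by (induction n) (auto simp: algebra_simps)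
  have "(\<Sum>k<N. z ^ Suc k) = 0"
    using assms by (simp add: sum_distrib_left[symmetric] geometric_sum)
  then have "(z - 1) * (\<Sum>k<N. of_nat k * z ^ k) = of_nat N" using *[of N] assms by simp
  then show ?thesis using assms(2) by (simp add: eq_divide_eq mult.commute)
qed

text \<open>Dividing by \<open>exp (\<i> * t / 2)\<close> turns the denominator into
  \<open>2 * \<i> * sin (t / 2)\<close>.\<close>

lemma inverse_cis_minus_1:
  assumes "sin (t / 2) \<noteq> 0"
  shows "1 / (exp (\<i> * of_real t) - 1) = - 1 / 2 - \<i> / 2 * of_real (cot (t / 2))"
proof -
  define s c where "s = sin (t / 2)" and "c = cos (t / 2)"
  have e: "exp (\<i> * of_real t) = (of_real c + \<i> * of_real s) ^ 2"
  proof -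
    have "exp (\<i> * of_real t) = exp (\<i> * of_real (t / 2)) ^ 2"
      by (simp add: power2_eq_square exp_add[symmetric] field_simps)
    then show ?thesis by (simp add: exp_Euler c_def s_def cos_of_real sin_of_real del: of_real_divide)
  qed
  have cs: "c ^ 2 + s ^ 2 = 1" by (simp add: c_def s_def)
  have s0: "s \<noteq> 0" using assms by (simp add: s_def)
  have cs': "complex_of_real c ^ 2 + of_real s ^ 2 = 1" using cs by (metis of_real_1 of_real_add of_real_power)
  define X where "X = - 1 / 2 - \<i> / 2 * (complex_of_real c / of_real s)"
  have X: "of_real s * X = - (of_real s + \<i> * of_real c) / 2"
    using s0 by (simp add: X_def field_simps)
  have "exp (\<i> * of_real t) - 1 = (of_real c + \<i> * of_real s) ^ 2 - (complex_of_real c ^ 2 + of_real s ^ 2)"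
    using e cs' by simp
  also have "\<dots> = of_real s * (2 * (\<i> * of_real c - of_real s))"
    by (simp add: power2_eq_square algebra_simps)
  finally have "(exp (\<i> * of_real t) - 1) * X = (of_real s * X) * (2 * (\<i> * of_real c - of_real s))"
    by (simp add: mult_ac)
  also have "\<dots> = complex_of_real c ^ 2 + of_real s ^ 2" unfolding X by (simp add: power2_eq_square field_simps)
  finally have "(exp (\<i> * of_real t) - 1) * X = 1" using cs' by simp
  then have "1 / (exp (\<i> * of_real t) - 1) = X" by (metis divide_eq_eq mult.commute mult_zero_left zero_neq_one)
  moreover have "cot (t / 2) = c / s" by (simp add: cot_def c_def s_def)
  ultimately show ?thesis by (simp add: X_def)
qed

context residue_character
begin

lemma sum_chi_eq_units: "(\<Sum>x<N. chi x * g x) = (\<Sum>x | x < N \<and> coprime x N. chi x * g x)"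
  by (rule sum.mono_neutral_right) (auto simp: chi_0)

text \<open>Were all these sums 0, so would be their Fourier transform in \<open>k\<close> at
  frequency 1. For a unit with inverse \<open>y\<close> that transform is
  \<open>N / (w y - 1)\<close>, whose imaginary part is a cotangent, so it leads to the cotangent
  sum of the conjugate character.\<close>

lemma sawtooth_sum_nonzero_if_odd:
  assumes odd: "chi (N - 1) = -1"
  shows "\<exists>k. (\<Sum>x<N. chi x * of_nat (k * x mod N)) \<noteq> 0"
proof (rule ccontr)
  assume "\<not> (\<exists>k. (\<Sum>x<N. chi x * of_nat (k * x mod N)) \<noteq> 0)"
  then have zero: "(\<Sum>x<N. chi x * of_nat (k * x mod N)) = 0" for k by simp
  let ?U = "{y. y < N \<and> coprime y N}"
  have copN: "coprime (N - 1) N" using odd chi_0 by fastforce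
  then interpret nonprincipal_character N chi "N - 1"
    by unfold_locales (use odd in auto)
  interpret cj: residue_character N "\<lambda>x. cnj (chi x)" by (rule residue_character_cnj)
  interpret cj: nonprincipal_character N "\<lambda>x. cnj (chi x)" "N - 1"
    by unfold_locales (use odd copN in auto)
  obtain iv where iv: "\<And>y. coprime y N \<Longrightarrow> [y * iv y = 1] (mod N)" "\<And>y. iv y < N" "bij_betw iv ?U ?U"
    using ex_inverse_mod[OF N_pos] by blast
  define w where "w j = exp (2 * of_real pi * \<i> * of_nat j / of_nat N)" for j :: nat
  have w_eq: "w j = w k \<longleftrightarrow> j mod N = k mod N" and w_1: "w j = 1 \<longleftrightarrow> N dvd j" for j k
    using N_pos by (simp_all add: w_def complex_root_unity_eq complex_root_unity_eq_1)
  have w_mult: "w (j * k) = w j ^ k" for j k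
    by (simp add: w_def exp_of_nat_mult[symmetric] mult_ac)
  have chi_iv: "chi (iv y) = cnj (chi y)" if "coprime y N" for y
  proof -
    have "chi (y * iv y) = 1" using iv(1)[OF that] chi_mod chi_1 by (metis cong_def)
    then have "chi y * chi (iv y) = chi y * cnj (chi y)"
      using norm_chi[OF that] by (simp add: chi_mult complex_norm_square[symmetric])
    moreover have "chi y \<noteq> 0" using norm_chi[OF that] by auto
    ultimately show ?thesis by simp
  qed
  have inner: "(\<Sum>k<N. of_nat (k * iv y mod N) * w k) = of_nat N / (w y - 1)" if y: "y < N" "coprime y N" for y
  proof -
    \<comment> \<open>Dilating \<open>k\<close> by \<open>y\<close> undoes \<open>iv y\<close>
      inside the sawtooth and moves \<open>y\<close> into the root of unity.\<close>
    have "(\<Sum>k<N. of_nat (k * iv y mod N) * w k) = (\<Sum>k<N. of_nat ((y * k mod N) * iv y mod N) * w (y * k mod N))"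
      using sum.reindex_bij_betw[OF bij_betw_mult_mod[OF y(2) N_pos], of "\<lambda>k. of_nat (k * iv y mod N) * w k"] by simp
    also have "\<dots> = (\<Sum>k<N. of_nat k * w y ^ k)"
    proof (intro sum.cong refl arg_cong2[where f = "(*)"] arg_cong[where f = of_nat])
      fix k assume k: "k \<in> {..<N}"
      have "[y * iv y * k = 1 * k] (mod N)" using iv(1)[OF y(2)] by (intro cong_mult cong_refl)
      then have "(y * k * iv y) mod N = k" using k by (simp add: cong_def mult_ac)
      then show "(y * k mod N) * iv y mod N = k" by (simp add: mod_mult_left_eq)
      have "w (y * k mod N) = w (y * k)" by (simp add: w_eq)
      then show "w (y * k mod N) = w y ^ k" by (simp add: w_mult)
    qed
    also have "\<dots> = of_nat N / (w y - 1)"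
    proof (rule sum_index_root_of_unity)
      show "w y ^ N = 1" using w_1[of "y * N"] by (simp add: w_mult)
      have "\<not> N dvd y" using y N_gt_1 by (metis coprime_absorb_right nat_dvd_1_iff_1 less_irrefl)
      then show "w y \<noteq> 1" by (simp add: w_1)
    qed
    finally show ?thesis .
  qed
  have "0 = (\<Sum>k<N. w k * (\<Sum>x<N. chi x * of_nat (k * x mod N)))" by (simp add: zero)
  also have "\<dots> = (\<Sum>x<N. chi x * (\<Sum>k<N. of_nat (k * x mod N) * w k))"
    unfolding sum_distrib_left by (subst sum.swap) (intro sum.cong refl, simp add: mult_ac)
  also have "\<dots> = (\<Sum>x\<in>?U. chi x * (\<Sum>k<N. of_nat (k * x mod N) * w k))"
    by (rule sum_chi_eq_units)
  also have "\<dots> = (\<Sum>y\<in>?U. chi (iv y) * (\<Sum>k<N. of_nat (k * iv y mod N) * w k))"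
    using sum.reindex_bij_betw[OF iv(3), of "\<lambda>x. chi x * (\<Sum>k<N. of_nat (k * x mod N) * w k)"] by simp
  also have "\<dots> = (\<Sum>y\<in>?U. cnj (chi y) * (of_nat N * (- 1 / 2 - \<i> / 2 * of_real (cot (pi * y / N)))))"
  proof (intro sum.cong refl arg_cong2[where f = "(*)"])
    fix y assume "y \<in> ?U"
    then have y: "y < N" "coprime y N" by auto
    then show "chi (iv y) = cnj (chi y)" by (simp add: chi_iv)
    have y0: "y > 0" using y N_gt_1 by (intro Nat.gr0I) auto
    define t where "t = 2 * pi * real y / N"
    have "0 < t / 2" "t / 2 < pi" using y y0 by (simp_all add: t_def field_simps)
    then have "sin (t / 2) \<noteq> 0" using sin_gt_zero by fastforce
    from inverse_cis_minus_1[OF this]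
    have "1 / (w y - 1) = - 1 / 2 - \<i> / 2 * of_real (cot (pi * y / N))"
      by (simp add: w_def t_def mult_ac)
    then show "(\<Sum>k<N. of_nat (k * iv y mod N) * w k) = of_nat N * (- 1 / 2 - \<i> / 2 * of_real (cot (pi * y / N)))"
      using inner[OF y] by (simp only: divide_inverse mult_1)
  qed
  also have "\<dots> = of_nat N * (- 1 / 2 * (\<Sum>y\<in>?U. cnj (chi y) * 1) - \<i> / 2 * (\<Sum>y\<in>?U. cnj (chi y) * of_real (cot (pi * y / N))))"
    unfolding sum_distrib_left sum_subtractf[symmetric] by (intro sum.cong refl) (simp add: algebra_simps)
  \<comment> \<open>The constant \<open>- 1 / 2\<close> disappears because a nonprincipal character
    sums to 0 over a period.\<close>
  also have "\<dots> = of_nat N * (- \<i> / 2 * (\<Sum>y<N. cnj (chi y) * of_real (cot (pi * y / N))))"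
    unfolding cj.sum_chi_eq_units[symmetric] using cj.sum_period by simp
  also have "(\<Sum>y<N. cnj (chi y) * of_real (cot (pi * y / N))) = (\<Sum>y\<in>{1..<N}. cnj (chi y) * of_real (cot (pi * y / N)))"
  proof (rule sum.mono_neutral_right)
    have "{..<N} - {1..<N} \<subseteq> {0}" by auto
    then show "\<forall>y\<in>{..<N} - {1..<N}. cnj (chi y) * of_real (cot (pi * y / N)) = 0" by (auto simp: chi_zero)
  qed auto
  finally have "(\<Sum>y\<in>{1..<N}. cnj (chi y) * of_real (cot (pi * y / N))) = 0" using N_pos by simp
  then show False
    using odd_character_cot_sum_nonzero[OF residue_character_cnj] odd by simp
qed

end

section \<open>Residues with balanced sawtooth sums\<close>

text \<open>Dilations by units act on the space of these functions, so if it were nonzero it would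
  contain a common eigenvector, that is, an odd character.\<close>

definition sawtooth_null :: "nat \<Rightarrow> (nat \<Rightarrow> complex) \<Rightarrow> bool" where
  "sawtooth_null N h \<longleftrightarrow> (\<forall>x. h (x mod N) = h x) \<and> (\<forall>x. \<not> coprime x N \<longrightarrow> h x = 0) \<and>
     (\<forall>x. h ((N - 1) * x) = - h x) \<and> (\<forall>k. (\<Sum>x<N. h x * of_nat (k * x mod N)) = 0)"

text \<open>Dilating the argument by \<open>m\<close> amounts to replacing the multiplier
  \<open>k\<close> by \<open>k\<close> times the inverse of \<open>m\<close>, so the condition for
  all multipliers is preserved.\<close>

lemma sawtooth_null_dilate:
  assumes N: "N > 0" and m: "coprime m N" and h: "sawtooth_null N h"
  shows "sawtooth_null N (\<lambda>x. h (m * x))"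
  unfolding sawtooth_null_def
proof (intro conjI allI impI)
  have per: "h (x mod N) = h x" and odd: "h ((N - 1) * x) = - h x"
    and nul: "(\<Sum>x<N. h x * of_nat (k * x mod N)) = 0" for x k
    using h by (auto simp: sawtooth_null_def)
  show "h (m * (x mod N)) = h (m * x)" for x
    by (metis per mod_mult_right_eq)
  show "h (m * x) = 0" if "\<not> coprime x N" for x
    using h that by (auto simp: sawtooth_null_def)
  show "h (m * ((N - 1) * x)) = - h (m * x)" for x
    using odd[of "m * x"] by (simp add: mult_ac)
  fix k
  obtain i where i: "[m * i = 1] (mod N)" using cong_solve_coprime_nat[OF m] by auto
  have "(\<Sum>x<N. h (m * x) * of_nat (k * x mod N)) = (\<Sum>x<N. h (m * x mod N) * of_nat (k * i * (m * x mod N) mod N))"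
  proof (intro sum.cong refl arg_cong2[where f = "(*)"] arg_cong[where f = of_nat])
    fix x
    have "[k * i * (m * x) = k * x * 1] (mod N)"
      using cong_mult[OF cong_refl i, of "k * x"] by (simp add: mult_ac)
    then show "k * x mod N = k * i * (m * x mod N) mod N"
      by (simp add: cong_def mod_mult_right_eq)
  qed (simp add: per)
  also have "\<dots> = (\<Sum>x<N. h x * of_nat (k * i * x mod N))"
    by (rule sum.reindex_bij_betw[OF bij_betw_mult_mod[OF m N]])
  finally show "(\<Sum>x<N. h (m * x) * of_nat (k * x mod N)) = 0" by (simp add: nul)
qed

lemma sawtooth_null_sum:
  assumes "\<And>i. i \<in> I \<Longrightarrow> sawtooth_null N (h i)"
  shows "sawtooth_null N (\<lambda>x. \<Sum>i\<in>I. c i * h i x)"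
  unfolding sawtooth_null_def
proof (intro conjI allI impI)
  show "(\<Sum>i\<in>I. c i * h i (x mod N)) = (\<Sum>i\<in>I. c i * h i x)" for x
    using assms by (intro sum.cong refl) (auto simp: sawtooth_null_def)
  show "(\<Sum>i\<in>I. c i * h i x) = 0" if "\<not> coprime x N" for x
    using assms that by (intro sum.neutral) (auto simp: sawtooth_null_def)
  show "(\<Sum>i\<in>I. c i * h i ((N - 1) * x)) = - (\<Sum>i\<in>I. c i * h i x)" for x
    unfolding sum_negf[symmetric] using assms by (intro sum.cong refl) (auto simp: sawtooth_null_def)
  show "(\<Sum>x<N. (\<Sum>i\<in>I. c i * h i x) * of_nat (k * x mod N)) = 0" for k
  proof -
    have "(\<Sum>x<N. (\<Sum>i\<in>I. c i * h i x) * of_nat (k * x mod N)) = (\<Sum>i\<in>I. c i * (\<Sum>x<N. h i x * of_nat (k * x mod N)))"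
      unfolding sum_distrib_left sum_distrib_right by (subst sum.swap) (simp add: mult_ac)
    also have "\<dots> = 0" using assms by (intro sum.neutral) (auto simp: sawtooth_null_def)
    finally show ?thesis .
  qed
qed

text \<open>By Euler's theorem dilation by \<open>m\<close> has order dividing
  \<open>n = totient N\<close>. Weighting its powers by those of an \<open>n\<close>-th root of
  unity projects \<open>h\<close>, up to the factor \<open>n\<close>, to an eigenspace; these
  projections add up to \<open>n\<close> times \<open>h\<close>, so one of them is nonzero.\<close>

lemma sawtooth_null_dilate_eigenvector:
  assumes N: "N > 0" and h: "sawtooth_null N h" and h0: "h x0 \<noteq> 0" and m: "coprime m N"
  shows "\<exists>c d. sawtooth_null N (\<lambda>x. \<Sum>i<totient N. c ^ i * h (m ^ i * x)) \<and>
    (\<exists>x. (\<Sum>i<totient N. c ^ i * h (m ^ i * x)) \<noteq> 0) \<and>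
    (\<forall>x. (\<Sum>i<totient N. c ^ i * h (m ^ i * (m * x))) = d * (\<Sum>i<totient N. c ^ i * h (m ^ i * x)))"
proof -
  define n where "n = totient N"
  have n: "n > 0" using N by (simp add: n_def)
  define w where "w j = exp (2 * of_real pi * \<i> * of_nat j / of_nat n)" for j :: nat
  have w_1: "w j = 1 \<longleftrightarrow> n dvd j" for j
    using n by (simp add: w_def complex_root_unity_eq_1)
  have w_mult: "w (j * k) = w j ^ k" for j k
    by (simp add: w_def exp_of_nat_mult[symmetric] mult_ac)
  have wn: "w j ^ n = 1" for j using w_1[of "j * n"] by (simp add: w_mult)
  define P where "P j x = (\<Sum>i<n. w j ^ i * h (m ^ i * x))" for j x
  have "(\<Sum>j<n. P j x0) = (\<Sum>i<n. h (m ^ i * x0) * (\<Sum>j<n. w i ^ j))"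
    unfolding P_def sum_distrib_left
    by (subst sum.swap) (intro sum.cong refl, metis mult.commute w_mult)
  also have "\<dots> = (\<Sum>i<n. if i = 0 then of_nat n * h x0 else 0)"
  proof (intro sum.cong refl)
    fix i assume i: "i \<in> {..<n}"
    show "h (m ^ i * x0) * (\<Sum>j<n. w i ^ j) = (if i = 0 then of_nat n * h x0 else 0)"
    proof (cases "i = 0")
      case True
      then show ?thesis by (simp add: w_def)
    next
      case False
      then have "w i \<noteq> 1" using i by (auto simp: w_1 dest: dvd_imp_le)
      then show ?thesis using False by (simp add: geometric_sum wn)
    qed
  qed
  also have "\<dots> = of_nat n * h x0" using n by (simp add: sum.delta)
  also have "\<dots> \<noteq> 0" using n h0 by simp
  finally obtain j where j: "P j x0 \<noteq> 0" using sum.neutral[of "{..<n}" "\<lambda>j. P j x0"] by blast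
  have cyc: "w j * P j (m * x) = P j x" for x
  proof -
    have "h (m ^ n * x) = h x"
    proof -
      have "[m ^ n * x = 1 * x] (mod N)" unfolding n_def by (intro cong_mult cong_refl euler_theorem m)
      then have "(m ^ n * x) mod N = x mod N" by (simp add: cong_def)
      moreover have "h (y mod N) = h y" for y using h by (simp add: sawtooth_null_def)
      ultimately show ?thesis by metis
    qed
    then have "(\<Sum>i<Suc n. w j ^ i * h (m ^ i * x)) = P j x + h x"
      by (simp add: P_def wn)
    moreover have "(\<Sum>i<Suc n. w j ^ i * h (m ^ i * x)) = h x + w j * P j (m * x)"
      by (simp add: P_def sum.lessThan_Suc_shift sum_distrib_left mult_ac del: sum.lessThan_Suc)
    ultimately show ?thesis by simp
  qed
  show ?thesis
  proof (rule exI[of _ "w j"], rule exI[of _ "1 / w j"], intro conjI allI)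
    show "sawtooth_null N (\<lambda>x. \<Sum>i<totient N. w j ^ i * h (m ^ i * x))"
      by (intro sawtooth_null_sum sawtooth_null_dilate N h) (use m in simp)
    show "\<exists>x. (\<Sum>i<totient N. w j ^ i * h (m ^ i * x)) \<noteq> 0"
      using j unfolding P_def n_def by blast
    have "w j \<noteq> 0" by (simp add: w_def)
    then show "(\<Sum>i<totient N. w j ^ i * h (m ^ i * (m * x))) = 1 / w j * (\<Sum>i<totient N. w j ^ i * h (m ^ i * x))" for x
      using cyc[of x] unfolding P_def n_def by (simp add: field_simps)
  qed
qed

text \<open>Dilations commute, so projecting for a new \<open>m\<close> keeps the eigenvector
  property for the earlier ones.\<close>

lemma sawtooth_null_common_eigenvector:
  assumes N: "N > 0" and h: "sawtooth_null N h" and h0: "h x0 \<noteq> 0"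
    and A: "finite A" "\<And>m. m \<in> A \<Longrightarrow> coprime m N"
  shows "\<exists>g. sawtooth_null N g \<and> (\<exists>x. g x \<noteq> 0) \<and> (\<forall>m\<in>A. \<exists>c. \<forall>x. g (m * x) = c * g x)"
  using A
proof (induction A rule: finite_induct)
  case empty
  then show ?case using h h0 by blast
next
  case (insert m A)
  then obtain g where g: "sawtooth_null N g" "\<exists>x. g x \<noteq> 0" "\<forall>m\<in>A. \<exists>c. \<forall>x. g (m * x) = c * g x" by auto
  then obtain x1 where x1: "g x1 \<noteq> 0" by blast
  have m: "coprime m N" using insert.prems by simp
  obtain c d where cd: "sawtooth_null N (\<lambda>x. \<Sum>i<totient N. c ^ i * g (m ^ i * x))"
    "\<exists>x. (\<Sum>i<totient N. c ^ i * g (m ^ i * x)) \<noteq> 0"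
    "\<forall>x. (\<Sum>i<totient N. c ^ i * g (m ^ i * (m * x))) = d * (\<Sum>i<totient N. c ^ i * g (m ^ i * x))"
    using sawtooth_null_dilate_eigenvector[OF N g(1) x1 m] by blast
  have "\<exists>e. \<forall>x. (\<Sum>i<totient N. c ^ i * g (m ^ i * (l * x))) = e * (\<Sum>i<totient N. c ^ i * g (m ^ i * x))" if "l \<in> A" for l
  proof -
    obtain e where "\<And>x. g (l * x) = e * g x" using g(3) \<open>l \<in> A\<close> by blast
    then have "(\<Sum>i<totient N. c ^ i * g (m ^ i * (l * x))) = e * (\<Sum>i<totient N. c ^ i * g (m ^ i * x))" for x
      unfolding sum_distrib_left by (intro sum.cong refl) (simp add: mult.left_commute[of _ l])
    then show ?thesis by blast
  qed
  then show ?case using cd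
    by (intro exI[of _ "\<lambda>x. \<Sum>i<totient N. c ^ i * g (m ^ i * x)"]) blast
qed

lemma sawtooth_null_eq_0:
  assumes N: "N > 0" and h: "sawtooth_null N h"
  shows "h x = 0"
proof (rule ccontr)
  assume "h x \<noteq> 0"
  let ?A = "{m. m < N \<and> coprime m N}"
  obtain g where g: "sawtooth_null N g" "\<exists>x. g x \<noteq> 0" "\<forall>m\<in>?A. \<exists>c. \<forall>x. g (m * x) = c * g x"
  proof -
    have "\<exists>g. sawtooth_null N g \<and> (\<exists>x. g x \<noteq> 0) \<and> (\<forall>m\<in>?A. \<exists>c. \<forall>x. g (m * x) = c * g x)"
      by (rule sawtooth_null_common_eigenvector[OF N h \<open>h x \<noteq> 0\<close>]) simp_all
    then show ?thesis using that by blast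
  qed
  have per: "g (x mod N) = g x" and cop: "\<not> coprime x N \<Longrightarrow> g x = 0" and odd: "g ((N - 1) * x) = - g x"
    and nul: "(\<Sum>x<N. g x * of_nat (k * x mod N)) = 0" for x k
    using g(1) by (auto simp: sawtooth_null_def)
  have eig: "\<exists>c. \<forall>x. g (m * x) = c * g x" if "coprime m N" for m
  proof -
    have "m mod N \<in> ?A" using that N by simp
    then obtain c where "\<And>x. g ((m mod N) * x) = c * g x" using g(3) by blast
    moreover have "g ((m mod N) * x) = g (m * x)" for x by (metis per mod_mult_left_eq)
    ultimately show ?thesis by auto
  qed
  have g1: "g 1 \<noteq> 0"
  proof
    assume "g 1 = 0"
    obtain x where x: "g x \<noteq> 0" using g(2) by blast
    then obtain c where "\<And>y. g (x * y) = c * g y" using eig[of x] cop by blast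
    from this[of 1] show False using x \<open>g 1 = 0\<close> by simp
  qed
  \<comment> \<open>Evaluating \<open>g (x * y) = c * g y\<close> at \<open>y = 1\<close> gives
    \<open>c = g x / g 1\<close>, so the normalised eigenvector is multiplicative.\<close>
  define chi where "chi x = g x / g 1" for x
  have "chi (x * y) = chi x * chi y" for x y
  proof (cases "coprime x N")
    case True
    then obtain c where c: "\<And>y. g (x * y) = c * g y" using eig by blast
    show ?thesis using c[of y] c[of 1] g1 by (simp add: chi_def)
  next
    case False
    then show ?thesis using cop[of x] cop[of "x * y"] by (simp add: chi_def)
  qed
  then interpret residue_character N chi
    by unfold_locales (use N g1 per cop in \<open>simp_all add: chi_def\<close>)
  have "chi (N - 1) = -1" using odd[of 1] g1 by (simp add: chi_def)
  then obtain k where "(\<Sum>x<N. chi x * of_nat (k * x mod N)) \<noteq> 0"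
    using sawtooth_sum_nonzero_if_odd by blast
  moreover have "(\<Sum>x<N. chi x * of_nat (k * x mod N)) = (\<Sum>x<N. g x * of_nat (k * x mod N)) / g 1"
    unfolding sum_divide_distrib by (simp add: chi_def)
  ultimately show False using nul by simp
qed

text \<open>The difference of the two counts is odd, and the hypothesis on \<open>sums\<close> makes
  it orthogonal to all sawtooth functions; such a function is 0.\<close>

theorem residues_balanced:
  fixes a :: "'w \<Rightarrow> nat"
  assumes N: "N > 0" and W: "finite W" "card W = 2 * d"
    and cop: "\<And>w. w \<in> W \<Longrightarrow> coprime (a w) N"
    and sums: "\<And>k. \<not> N dvd k \<Longrightarrow> (\<Sum>w\<in>W. k * a w mod N) = d * N"
  shows "card {w \<in> W. [a w = x] (mod N)} = card {w \<in> W. [(N - 1) * a w = x] (mod N)}"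
proof -
  define g :: "nat \<Rightarrow> complex" where
    "g x = (\<Sum>w\<in>W. of_bool ([a w = x] (mod N)) - of_bool ([(N - 1) * a w = x] (mod N)))" for x
  have sq: "[(N - 1) * (N - 1) = 1] (mod N)"
  proof (cases "N = 1")
    case False
    then have "(N - 1) * (N - 1) = 1 + N * (N - 2)" using N by (cases N rule: nat.exhaust; cases "N - 1") (auto simp: algebra_simps)
    then show ?thesis by (simp only: cong_def mod_mult_self2)
  qed simp
  have flip: "[c = (N - 1) * x] (mod N) \<longleftrightarrow> [(N - 1) * c = x] (mod N)" for c x
  proof
    assume "[c = (N - 1) * x] (mod N)"
    then have "[(N - 1) * c = (N - 1) * ((N - 1) * x)] (mod N)" by (intro cong_mult cong_refl)
    also have "[(N - 1) * ((N - 1) * x) = 1 * x] (mod N)"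
      unfolding mult.assoc[symmetric] by (intro cong_mult sq cong_refl)
    finally show "[(N - 1) * c = x] (mod N)" by simp
  next
    assume "[(N - 1) * c = x] (mod N)"
    then have "[(N - 1) * ((N - 1) * c) = (N - 1) * x] (mod N)" by (intro cong_mult cong_refl)
    moreover have "[(N - 1) * ((N - 1) * c) = 1 * c] (mod N)"
      unfolding mult.assoc[symmetric] by (intro cong_mult sq cong_refl)
    ultimately show "[c = (N - 1) * x] (mod N)" by (metis cong_sym cong_trans mult_1)
  qed
  have cop1: "coprime (N - 1) N" using N by (cases N) auto
  have "sawtooth_null N g"
    unfolding sawtooth_null_def
  proof (intro conjI allI impI)
    show "g (x mod N) = g x" for x by (simp add: g_def cong_def)
    show "g x = 0" if "\<not> coprime x N" for x
    proof -
      have "\<not> [c = x] (mod N)" if "coprime c N" for c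
        using \<open>\<not> coprime x N\<close> that cong_imp_coprime by blast
      then show ?thesis using cop cop1 unfolding g_def by (intro sum.neutral) simp
    qed
    show "g ((N - 1) * x) = - g x" for x
    proof -
      have "[(N - 1) * c = (N - 1) * x] (mod N) \<longleftrightarrow> [c = x] (mod N)" for c
        using cop1 by (rule cong_mult_lcancel_nat)
      then show ?thesis unfolding g_def sum_negf[symmetric] by (simp only: flip minus_diff_eq)
    qed
    fix k
    have pick: "(\<Sum>x<N. of_bool ([c = x] (mod N)) * (of_nat (k * x mod N) :: complex)) = of_nat (k * c mod N)" for c
    proof -
      have "(\<Sum>x<N. of_bool ([c = x] (mod N)) * (of_nat (k * x mod N) :: complex))
          = (\<Sum>x<N. if x = c mod N then of_nat (k * x mod N) else 0)"
        by (intro sum.cong refl) (auto simp: cong_def)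
      then show ?thesis using N by (simp add: mod_mult_right_eq)
    qed
    have "(\<Sum>x<N. g x * of_nat (k * x mod N)) = (\<Sum>w\<in>W. of_nat (k * a w mod N) - of_nat (k * ((N - 1) * a w) mod N))"
      unfolding g_def sum_distrib_right by (subst sum.swap) (simp add: left_diff_distrib sum_subtractf pick)
    also have "\<dots> = 0"
    proof (cases "N dvd k")
      case True
      then have "k * y mod N = 0" for y by simp
      then show ?thesis by simp
    next
      case False
      \<comment> \<open>Complementary residues, valid since \<open>k * a w\<close> is not divisible
        by \<open>N\<close>. Each difference becomes \<open>2 * (k * a w mod N) - N\<close>, and
        these add up to \<open>2 * d * N - 2 * d * N\<close>.\<close>
      have "k * ((N - 1) * a w) mod N = N - k * a w mod N" if w: "w \<in> W" for w
      proof -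
        have "\<not> N dvd k * a w" using False cop[OF w] by (simp add: coprime_commute coprime_dvd_mult_left_iff)
        then have r: "k * a w mod N > 0" "k * a w mod N < N" using N by (auto simp: dvd_eq_mod_eq_0)
        have "[k * ((N - 1) * a w) + k * a w = 0] (mod N)"
        proof -
          have "k * ((N - 1) * a w) + k * a w = N * (k * a w)" using N by (cases N) (auto simp: algebra_simps)
          then show ?thesis by (simp add: cong_def)
        qed
        moreover have "[N - k * a w mod N + k * a w = 0] (mod N)"
        proof -
          have "[N - k * a w mod N + k * a w = N - k * a w mod N + k * a w mod N] (mod N)"
            by (simp add: cong_def mod_add_right_eq)
          then show ?thesis using r by (simp add: cong_def)
        qed
        ultimately have "[k * ((N - 1) * a w) = N - k * a w mod N] (mod N)"
          by (metis cong_add_rcancel_nat cong_sym cong_trans)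
        then show ?thesis using r by (simp add: cong_def)
      qed
      then have "(\<Sum>w\<in>W. of_nat (k * a w mod N) - of_nat (k * ((N - 1) * a w) mod N))
          = (\<Sum>w\<in>W. 2 * of_nat (k * a w mod N) - (of_nat N :: complex))"
        using N by (intro sum.cong refl) (simp add: of_nat_diff less_imp_le)
      also have "\<dots> = 2 * of_nat (\<Sum>w\<in>W. k * a w mod N) - of_nat (card W) * of_nat N"
        by (simp only: sum_subtractf sum_distrib_left[symmetric] of_nat_sum sum_constant)
      also have "\<dots> = 0" using sums[OF False] W by simp
      finally show ?thesis .
    qed
    finally show "(\<Sum>x<N. g x * of_nat (k * x mod N)) = 0" .
  qed
  from sawtooth_null_eq_0[OF N this, of x]
  have "(\<Sum>w\<in>W. of_bool ([a w = x] (mod N)) :: complex) = (\<Sum>w\<in>W. of_bool ([(N - 1) * a w = x] (mod N)))"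
    by (simp add: g_def sum_subtractf)
  moreover have "(\<Sum>w\<in>W. of_bool (Q w) :: complex) = of_nat (card {w \<in> W. Q w})" for Q
    using W(1) by (simp add: sum.If_cases of_bool_def Int_def)
  ultimately show ?thesis by simp
qed

section \<open>The lattice points of a simplex with basic facets\<close>

lemma integer_lattice_add: "x \<in> integer_lattice \<Longrightarrow> y \<in> integer_lattice \<Longrightarrow> x + y \<in> integer_lattice"
  by (auto simp: integer_lattice_def inner_add_left)

lemma integer_lattice_diff: "x \<in> integer_lattice \<Longrightarrow> y \<in> integer_lattice \<Longrightarrow> x - y \<in> integer_lattice"
  by (auto simp: integer_lattice_def inner_diff_left)

lemma integer_lattice_scale: "k \<in> \<int> \<Longrightarrow> x \<in> integer_lattice \<Longrightarrow> k *\<^sub>R x \<in> integer_lattice"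
  by (auto simp: integer_lattice_def)

lemma integer_lattice_sum: "(\<And>i. i \<in> I \<Longrightarrow> f i \<in> integer_lattice) \<Longrightarrow> (\<Sum>i\<in>I. f i) \<in> integer_lattice"
  by (auto simp: integer_lattice_def inner_sum_left intro!: Ints_sum)

text \<open>The common total is arbitrary, since coordinates of points in dilates have total
  \<open>k\<close>.\<close>

lemma affine_independent_unique_coords:
  fixes W :: "'a::euclidean_space set"
  assumes W: "\<not> affine_dependent W" and s: "sum \<kappa> W = sum \<kappa>' W"
    and e: "(\<Sum>v\<in>W. \<kappa> v *\<^sub>R v) = (\<Sum>v\<in>W. \<kappa>' v *\<^sub>R v)" and v: "v \<in> W"
  shows "\<kappa> v = \<kappa>' v"
proof (rule ccontr)
  assume "\<kappa> v \<noteq> \<kappa>' v"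
  then have "\<exists>v\<in>W. \<kappa> v - \<kappa>' v \<noteq> 0" using v by auto
  moreover have "(\<Sum>v\<in>W. \<kappa> v - \<kappa>' v) = 0" using s by (simp add: sum_subtractf)
  moreover have "(\<Sum>v\<in>W. (\<kappa> v - \<kappa>' v) *\<^sub>R v) = 0" using e by (simp add: sum_subtractf scaleR_diff_left)
  ultimately have "affine_dependent W"
    unfolding affine_dependent_explicit_finite[OF aff_independent_finite[OF W]]
    by (intro exI[of _ "\<lambda>v. \<kappa> v - \<kappa>' v"] conjI)
  then show False using W by simp
qed

text \<open>Integral combinations of edge vectors at \<open>w0\<close> inside the facet opposite to
  \<open>w\<close> become weights of total 0 that vanish at \<open>w\<close>.\<close>

lemma sum_diff_as_affine_comb:
  fixes W :: "'a::euclidean_space set" and c :: "'a \<Rightarrow> int"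
  assumes W: "finite W" "w \<in> W" "w0 \<in> W" "w \<noteq> w0"
  shows "\<exists>E :: 'a \<Rightarrow> int. sum E W = 0 \<and> E w = 0 \<and>
    (\<Sum>v\<in>W. of_int (E v) *\<^sub>R v) = (\<Sum>v\<in>W - {w} - {w0}. of_int (c v) *\<^sub>R (v - w0))"
proof -
  let ?S = "W - {w} - {w0}"
  define E where "E v = (if v = w then 0 else if v = w0 then - sum c ?S else c v)" for v
  have split: "sum F W = F w + F w0 + sum F ?S" for F :: "'a \<Rightarrow> 'b::comm_monoid_add"
    using W by (simp add: sum.remove[of W w] sum.remove[of "W - {w}" w0] add.assoc)
  have ES: "E v = c v" if "v \<in> ?S" for v using that by (auto simp: E_def)
  have Ew: "E w = 0" "E w0 = - sum c ?S" using W by (auto simp: E_def)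
  have "sum E W = 0" unfolding split[of E] Ew using ES by simp
  moreover have "(\<Sum>v\<in>W. of_int (E v) *\<^sub>R v) = (\<Sum>v\<in>?S. of_int (c v) *\<^sub>R (v - w0))"
  proof -
    have "(\<Sum>v\<in>W. of_int (E v) *\<^sub>R v) = of_int (E w) *\<^sub>R w + of_int (E w0) *\<^sub>R w0 + (\<Sum>v\<in>?S. of_int (c v) *\<^sub>R v)"
      unfolding split[of "\<lambda>v. of_int (E v) *\<^sub>R v"] using ES by simp
    then show ?thesis unfolding Ew by (simp add: scaleR_diff_right sum_subtractf scaleR_sum_left)
  qed
  ultimately show ?thesis using Ew by blast
qed

lemma lattice_basis_card:
  fixes B :: "'a::euclidean_space set"
  assumes "lattice_basis B"
  shows "card B = DIM('a)"
proof -
  have ind: "independent B" and L: "{\<Sum>b\<in>B. of_int (c b) *\<^sub>R b | c :: 'a \<Rightarrow> int. True} = integer_lattice"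
    using assms by (auto simp: lattice_basis_def)
  have "Basis \<subseteq> (integer_lattice :: 'a set)" by (auto simp: integer_lattice_def inner_Basis)
  also have "\<dots> \<subseteq> span B" unfolding L[symmetric] by (auto intro: span_sum span_scale span_base)
  finally have "span B = UNIV" by (metis span_Basis span_mono span_span top.extremum_uniqueI)
  then show ?thesis using ind by (metis dim_UNIV dim_span_eq_card_independent)
qed

text \<open>Modulo the lattice spanned by the vertices, all lattice points are multiples of a single
  point whose coordinate at \<open>w\<close> is \<open>1 / N\<close>: the facet opposite to \<open>w\<close> completes to a lattice basis
  by one more vector.\<close>

lemma basic_facet_generator:
  fixes W :: "'a::euclidean_space set"
  assumes Wl: "W \<subseteq> integer_lattice" and W: "\<not> affine_dependent W" "card W = DIM('a) + 1"
    and w: "w \<in> W" and basic: "basic_simplex (convex hull (W - {w}))"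
  shows "\<exists>(N::nat) (a :: 'a \<Rightarrow> int). (0::nat) < N \<and> a w = (1::int) \<and> sum a W = (0::int) \<and>
    (\<Sum>v\<in>W. (a v / N) *\<^sub>R v) \<in> integer_lattice \<and>
    (\<forall>\<kappa>. sum \<kappa> W \<in> \<int> \<longrightarrow> (\<Sum>v\<in>W. \<kappa> v *\<^sub>R v) \<in> integer_lattice \<longrightarrow>
       (\<exists>j :: int. \<forall>v\<in>W. \<kappa> v - of_int j * of_int (a v) / N \<in> \<int>))"
proof -
  have fin: "finite W" using W(1) by (rule aff_independent_finite)
  obtain W' w0 B where W': "\<not> affine_dependent W'" "w0 \<in> W'" "convex hull (W - {w}) = convex hull W'"
    and B: "lattice_basis B" "(\<lambda>u. u - w0) ` (W' - {w0}) \<subseteq> B"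
    using basic unfolding basic_simplex_def by auto
  have "\<not> affine_dependent (W - {w})" using W(1) affine_dependent_subset by blast
  then have "W' = W - {w}"
    using W'(1,3) extreme_point_of_convex_hull_affine_independent by (metis subsetI subset_antisym)
  then have w0: "w0 \<in> W" "w \<noteq> w0" using W'(2) by auto
  let ?S = "W - {w} - {w0}"
  define D where "D = (\<lambda>u. u - w0) ` ?S"
  have DB: "D \<subseteq> B" using B(2) \<open>W' = W - {w}\<close> by (simp add: D_def)
  have cD: "card D = DIM('a) - 1" unfolding D_def using fin w w0 W(2) by (subst card_image) (auto simp: inj_on_def)
  have finB: "finite B" using B(1) by (auto simp: lattice_basis_def independent_imp_finite)
  have "card (B - D) = 1" using cD DB lattice_basis_card[OF B(1)] finB
    by (simp add: card_Diff_subset finite_subset)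
  then obtain u where "B - D = {u}" using card_1_singletonE by blast
  then have u: "u \<notin> D" "B = insert u D" using DB by auto
  have L: "integer_lattice = {\<Sum>b\<in>B. of_int (c b) *\<^sub>R b | c :: 'a \<Rightarrow> int. True}"
    using B(1) by (simp add: lattice_basis_def)
  have rep: "\<exists>(t::int) (E::'a \<Rightarrow> int). sum E W = 0 \<and> E w = 0 \<and> x = of_int t *\<^sub>R u + (\<Sum>v\<in>W. of_int (E v) *\<^sub>R v)"
    if xl: "x \<in> integer_lattice" for x
  proof -
    obtain c :: "'a \<Rightarrow> int" where "x = (\<Sum>b\<in>B. of_int (c b) *\<^sub>R b)" using xl unfolding L by blast
    also have "\<dots> = of_int (c u) *\<^sub>R u + (\<Sum>b\<in>D. of_int (c b) *\<^sub>R b)"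
      using u finB by simp
    also have "(\<Sum>b\<in>D. of_int (c b) *\<^sub>R b) = (\<Sum>v\<in>?S. of_int (c (v - w0)) *\<^sub>R (v - w0))"
      unfolding D_def by (subst sum.reindex) (auto simp: inj_on_def)
    finally have x: "x = of_int (c u) *\<^sub>R u + (\<Sum>v\<in>?S. of_int (c (v - w0)) *\<^sub>R (v - w0))" .
    obtain E :: "'a \<Rightarrow> int" where "sum E W = 0" "E w = 0"
      "(\<Sum>v\<in>W. of_int (E v) *\<^sub>R v) = (\<Sum>v\<in>?S. of_int (c (v - w0)) *\<^sub>R (v - w0))"
      using sum_diff_as_affine_comb[OF fin w w0, of "\<lambda>v. c (v - w0)"] by blast
    then show ?thesis using x by (intro exI[of _ "c u"] exI[of _ E]) simp
  qed
  have "w - w0 \<in> integer_lattice" using Wl w w0 by (blast intro: integer_lattice_diff)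
  from rep[OF this] obtain n E where E: "sum E W = 0" "E w = 0"
    "w - w0 = of_int n *\<^sub>R u + (\<Sum>v\<in>W. of_int (E v) *\<^sub>R v)" by blast
  define e :: "'a \<Rightarrow> int" where "e v = of_bool (v = w) - of_bool (v = w0)" for v
  have esum: "sum e W = 0" "(\<Sum>v\<in>W. of_int (e v) *\<^sub>R v) = w - w0"
    using fin w w0(1) by (simp_all add: e_def sum_subtractf scaleR_diff_left of_bool_def if_distrib[of "\<lambda>x. x *\<^sub>R _"] if_distrib[of of_int] sum.delta cong: if_cong)
  \<comment> \<open>Removing from \<open>w - w0\<close> its part along the facet leaves
    \<open>n *\<^sub>R u\<close>. So \<open>b\<close> divided by \<open>N = \<bar>n\<bar>\<close>,
    the lattice height of \<open>w\<close> over the facet, represents \<open>u\<close> up to sign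
    and has coordinate \<open>1 / N\<close> at \<open>w\<close>.\<close>
  define b where "b v = e v - E v" for v
  have bw: "b w = 1" using E w0 by (simp add: b_def e_def)
  have bs: "sum b W = 0" using E esum by (simp add: b_def sum_subtractf)
  have bu: "(\<Sum>v\<in>W. of_int (b v) *\<^sub>R v) = of_int n *\<^sub>R u"
    using E(3) esum(2) by (simp add: b_def scaleR_diff_left sum_subtractf)
  have n0: "n \<noteq> 0"
  proof
    assume "n = 0"
    then have "(\<Sum>v\<in>W. of_int (b v) *\<^sub>R v) = (\<Sum>v\<in>W. (0::real) *\<^sub>R v)" using bu by simp
    moreover have "(\<Sum>v\<in>W. real_of_int (b v)) = (\<Sum>v\<in>W. 0)" using bs by (simp flip: of_int_sum)
    ultimately have "real_of_int (b w) = 0"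
      using affine_independent_unique_coords[OF W(1), of "\<lambda>v. real_of_int (b v)" "\<lambda>v. 0" w] w by blast
    then show False using bw by simp
  qed
  define N where "N = nat \<bar>n\<bar>"
  have N: "N > 0" "real N = \<bar>of_int n\<bar>" using n0 by (simp_all add: N_def)
  have nsgn: "real_of_int n = sgn n * N" using N(2) by (auto simp: sgn_if)
  have ul: "u \<in> integer_lattice"
    unfolding L by (rule CollectI, rule exI[of _ "\<lambda>b. of_bool (b = u)"])
      (use finB u in \<open>simp add: of_bool_def if_distrib[of "\<lambda>x. x *\<^sub>R _"] if_distrib[of of_int] cong: if_cong\<close>)
  have su: "(\<Sum>v\<in>W. (of_int (b v) / N) *\<^sub>R v) = of_int (sgn n) *\<^sub>R u"
  proof -
    have "(\<Sum>v\<in>W. (of_int (b v) / N) *\<^sub>R v) = (1 / N) *\<^sub>R (\<Sum>v\<in>W. of_int (b v) *\<^sub>R v)"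
      by (simp add: scaleR_sum_right)
    also have "\<dots> = (of_int n / N) *\<^sub>R u" by (simp add: bu)
    also have "of_int n / N = of_int (sgn n)" using N(1) nsgn by (simp add: field_simps)
    finally show ?thesis .
  qed
  show ?thesis
  proof (rule exI[of _ N], rule exI[of _ b], intro conjI allI impI N(1) bw bs)
    show "(\<Sum>v\<in>W. (of_int (b v) / N) *\<^sub>R v) \<in> integer_lattice"
      unfolding su by (intro integer_lattice_scale ul) simp
    fix \<kappa> :: "'a \<Rightarrow> real" assume k: "sum \<kappa> W \<in> \<int>" "(\<Sum>v\<in>W. \<kappa> v *\<^sub>R v) \<in> integer_lattice"
    define k where "k = sum \<kappa> W"
    have "(\<Sum>v\<in>W. \<kappa> v *\<^sub>R v) - k *\<^sub>R w0 \<in> integer_lattice"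
      using k Wl w0 unfolding k_def by (intro integer_lattice_diff integer_lattice_scale) auto
    from rep[OF this] obtain t F where F: "sum F W = 0"
      "(\<Sum>v\<in>W. \<kappa> v *\<^sub>R v) - k *\<^sub>R w0 = of_int t *\<^sub>R u + (\<Sum>v\<in>W. of_int (F v) *\<^sub>R v)" by blast
    \<comment> \<open>The sign occurs because the generator is \<open>sgn n\<close> times
      \<open>u\<close>.\<close>
    define j where "j = t * sgn n"
    define \<kappa>' where "\<kappa>' v = (if v = w0 then k else 0) + of_int j * of_int (b v) / N + of_int (F v)" for v
    have "sum \<kappa>' W = k"
    proof -
      have "sum \<kappa>' W = k + of_int j / N * of_int (sum b W) + of_int (sum F W)"
        using fin w0(1) by (simp add: \<kappa>'_def sum.distrib sum_distrib_left)
      then show ?thesis using bs F(1) by simp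
    qed
    moreover have "(\<Sum>v\<in>W. \<kappa>' v *\<^sub>R v) = (\<Sum>v\<in>W. \<kappa> v *\<^sub>R v)"
    proof -
      have "(\<Sum>v\<in>W. \<kappa>' v *\<^sub>R v) = k *\<^sub>R w0 + of_int j *\<^sub>R (\<Sum>v\<in>W. (of_int (b v) / N) *\<^sub>R v) + (\<Sum>v\<in>W. of_int (F v) *\<^sub>R v)"
        using fin w0(1) by (simp add: \<kappa>'_def scaleR_add_left sum.distrib scaleR_sum_right if_distrib[of "\<lambda>x. x *\<^sub>R _"] sum.delta cong: if_cong)
      moreover have "of_int j * of_int (sgn n) = (of_int t :: real)"
        using n0 by (auto simp: j_def sgn_if)
      ultimately show ?thesis using F(2) by (simp add: su algebra_simps)
    qed
    ultimately have "\<kappa> v = \<kappa>' v" if "v \<in> W" for v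
      using affine_independent_unique_coords[OF W(1), of \<kappa>' \<kappa> v] that by (simp add: k_def)
    moreover have "k \<in> \<int>" using k by (simp add: k_def)
    ultimately show "\<exists>j :: int. \<forall>v\<in>W. \<kappa> v - of_int j * of_int (b v) / N \<in> \<int>"
      by (intro exI[of _ j]) (auto simp: \<kappa>'_def)
  qed
qed

text \<open>Coprimality compares the generators at \<open>w\<close> and at \<open>v\<close>. If
  \<open>g\<close> divides \<open>a v\<close> and \<open>N\<close>, the lattice vector with
  coordinates \<open>a x / g\<close> is integral at \<open>v\<close>; as the generator at
  \<open>v\<close> has numerator 1 there, all its coordinates are integral. At \<open>w\<close> this
  says \<open>1 / g\<close> is an integer.\<close>

lemma lattice_points_of_simplex:
  fixes W :: "'a::euclidean_space set"
  assumes Wl: "W \<subseteq> integer_lattice" and W: "\<not> affine_dependent W" "card W = DIM('a) + 1"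
    and w: "w \<in> W" and basic: "\<And>v. v \<in> W \<Longrightarrow> basic_simplex (convex hull (W - {v}))"
  shows "\<exists>(N::nat) (a :: 'a \<Rightarrow> int). (0::nat) < N \<and> a w = (1::int) \<and> sum a W = (0::int) \<and>
    (\<forall>v\<in>W. coprime (a v) (int N)) \<and>
    (\<forall>\<kappa>. sum \<kappa> W \<in> \<int> \<longrightarrow> ((\<Sum>v\<in>W. \<kappa> v *\<^sub>R v) \<in> integer_lattice \<longleftrightarrow>
       (\<exists>j :: int. \<forall>v\<in>W. \<kappa> v - of_int j * of_int (a v) / N \<in> \<int>)))"
proof -
  obtain N :: nat and a :: "'a \<Rightarrow> int" where Na: "N > 0" "a w = 1" "sum a W = 0"
    "(\<Sum>v\<in>W. (a v / N) *\<^sub>R v) \<in> integer_lattice"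
    "\<forall>\<kappa>. sum \<kappa> W \<in> \<int> \<longrightarrow> (\<Sum>v\<in>W. \<kappa> v *\<^sub>R v) \<in> integer_lattice \<longrightarrow>
       (\<exists>j :: int. \<forall>v\<in>W. \<kappa> v - of_int j * of_int (a v) / N \<in> \<int>)"
    using basic_facet_generator[OF Wl W w basic[OF w]] by blast
  have conv: "(\<Sum>v\<in>W. \<kappa> v *\<^sub>R v) \<in> integer_lattice" if j: "\<forall>v\<in>W. \<kappa> v - of_int j * of_int (a v) / N \<in> \<int>" for \<kappa> and j :: int
  proof -
    have "(\<Sum>v\<in>W. (\<kappa> v - of_int j * of_int (a v) / N) *\<^sub>R v) + of_int j *\<^sub>R (\<Sum>v\<in>W. (a v / N) *\<^sub>R v) \<in> integer_lattice"
    proof (rule integer_lattice_add)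
      show "(\<Sum>v\<in>W. (\<kappa> v - of_int j * of_int (a v) / N) *\<^sub>R v) \<in> integer_lattice"
        using j Wl by (intro integer_lattice_sum integer_lattice_scale) auto
      show "of_int j *\<^sub>R (\<Sum>v\<in>W. (a v / N) *\<^sub>R v) \<in> integer_lattice"
        using Na(4) by (intro integer_lattice_scale) auto
    qed
    then show ?thesis by (simp add: scaleR_diff_left sum_subtractf scaleR_sum_right)
  qed
  have "coprime (a v) (int N)" if v: "v \<in> W" for v
  proof -
    define g where "g = gcd (a v) (int N)"
    have g: "g > 0" "g dvd a v" "g dvd int N" using Na(1) by (auto simp: g_def)
    obtain N' :: nat and a' :: "'a \<Rightarrow> int" where N': "N' > 0" "a' v = 1"
      "\<forall>\<kappa>. sum \<kappa> W \<in> \<int> \<longrightarrow> (\<Sum>v\<in>W. \<kappa> v *\<^sub>R v) \<in> integer_lattice \<longrightarrow>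
         (\<exists>j :: int. \<forall>v\<in>W. \<kappa> v - of_int j * of_int (a' v) / N' \<in> \<int>)"
      using basic_facet_generator[OF Wl W v basic[OF v]] by blast
    define \<kappa> where "\<kappa> x = real_of_int (a x) / real_of_int g" for x
    obtain q where q: "int N = g * q" using g(3) by auto
    have "\<kappa> x = real_of_int q * real_of_int (a x) / N" for x
    proof -
      have "real N = of_int g * of_int q" by (metis q of_int_mult of_int_of_nat_eq)
      moreover have "q \<noteq> 0" using q Na(1) by auto
      ultimately show ?thesis using g(1) by (simp add: \<kappa>_def)
    qed
    then have "\<forall>x\<in>W. \<kappa> x - real_of_int q * real_of_int (a x) / N \<in> \<int>" by simp
    then have "(\<Sum>v\<in>W. \<kappa> v *\<^sub>R v) \<in> integer_lattice" by (rule conv)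
    moreover have "sum \<kappa> W = 0" unfolding \<kappa>_def sum_divide_distrib[symmetric] of_int_sum[symmetric] Na(3) by simp
    ultimately obtain j :: int where j: "\<forall>v\<in>W. \<kappa> v - of_int j * of_int (a' v) / N' \<in> \<int>" using N'(3)[rule_format, of \<kappa>] by auto
    have "\<kappa> v \<in> \<int>" using g(1,2) by (auto simp: \<kappa>_def)
    moreover have "\<kappa> v - of_int j / N' \<in> \<int>" using j v N'(2) by force
    ultimately have "of_int j / real N' \<in> \<int>" by (metis Ints_diff diff_diff_eq2 add_diff_cancel_left')
    then have "of_int j / real N' * of_int (a' w) \<in> \<int>" by (intro Ints_mult) auto
    moreover have "\<kappa> w - of_int j * of_int (a' w) / N' \<in> \<int>" using j w by blast
    ultimately have "\<kappa> w - of_int j * of_int (a' w) / N' + of_int j / real N' * of_int (a' w) \<in> \<int>" by (rule Ints_add[rotated])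
    then have "1 / real_of_int g \<in> \<int>" by (simp add: \<kappa>_def Na(2))
    then obtain z :: int where "1 / real_of_int g = of_int z" by (auto elim: Ints_cases)
    then have "1 = real_of_int (z * g)" using g(1) by (simp add: field_simps)
    then have "z * g = 1" by linarith
    then have "g = 1" using g(1) by (metis dvd_triv_right zdvd1_eq abs_of_pos)
    then show ?thesis by (simp add: g_def coprime_iff_gcd_eq_1)
  qed
  then show ?thesis using Na conv by (intro exI[of _ N] exI[of _ a] conjI) blast+
qed

section \<open>Affine maps, interiors and pairings\<close>

lemma affine_map_sum:
  assumes "affine_map f" "sum \<kappa> W = 1"
  shows "f (\<Sum>v\<in>W. \<kappa> v *\<^sub>R v) = (\<Sum>v\<in>W. \<kappa> v *\<^sub>R f v)"
proof -
  obtain L c where L: "linear L" "\<And>x. f x = L x + c" using assms(1) unfolding affine_map_def by blast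
  have "(\<Sum>v\<in>W. \<kappa> v *\<^sub>R f v) = (\<Sum>v\<in>W. \<kappa> v *\<^sub>R L v) + sum \<kappa> W *\<^sub>R c"
    by (simp add: L(2) scaleR_add_right sum.distrib scaleR_sum_left)
  then show ?thesis using assms(2) L by (simp add: linear_sum linear_scale)
qed

lemma affine_map_convex_hull:
  assumes "affine_map f"
  shows "f ` (convex hull S) = convex hull (f ` S)"
proof -
  obtain L c where L: "linear L" "\<And>x. f x = L x + c" using assms unfolding affine_map_def by blast
  have f: "f ` X = (+) c ` L ` X" for X unfolding image_image by (simp add: L(2) add.commute)
  show ?thesis unfolding f using L(1) by (simp add: convex_hull_translation convex_hull_linear_image)
qed

lemma affine_map_extend:
  fixes W :: "'a::euclidean_space set" and f :: "'a \<Rightarrow> 'b::euclidean_space"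
  assumes W: "\<not> affine_dependent W"
  shows "\<exists>\<phi>. affine_map \<phi> \<and> (\<forall>w\<in>W. \<phi> w = f w)"
proof (cases "W = {}")
  case True
  have "affine_map (\<lambda>x::'a. 0 :: 'b)" unfolding affine_map_def by (intro exI[of _ "\<lambda>x. 0"] exI[of _ 0]) (simp add: linear_zero)
  then show ?thesis using True by blast
next
  case False
  then obtain w0 where w0: "w0 \<in> W" by blast
  have "independent ((\<lambda>x. - w0 + x) ` (W - {w0}))" using W affine_dependent_iff_dependent2[OF w0] by blast
  from linear_independent_extend[OF this, of "\<lambda>x. f (x + w0) - f w0"]
  obtain L where L: "linear L" "\<And>x. x \<in> (\<lambda>x. - w0 + x) ` (W - {w0}) \<Longrightarrow> L x = f (x + w0) - f w0" by blast
  have "L (w - w0) + f w0 = f w" if "w \<in> W" for w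
    using L(2)[of "- w0 + w"] that linear_0[OF L(1)] by (cases "w = w0") auto
  moreover have "affine_map (\<lambda>x. L (x - w0) + f w0)"
    unfolding affine_map_def using L(1) by (intro exI[of _ L] exI[of _ "f w0 - L w0"]) (simp add: linear_diff)
  ultimately show ?thesis by (intro exI[of _ "\<lambda>x. L (x - w0) + f w0"]) blast
qed

lemma ex_barycentric_coords:
  fixes W :: "'a::euclidean_space set"
  assumes W: "\<not> affine_dependent W" "card W = DIM('a) + 1"
  shows "\<exists>\<kappa>. sum \<kappa> W = 1 \<and> (\<Sum>v\<in>W. \<kappa> v *\<^sub>R v) = x"
proof -
  have "x \<in> affine hull W" using affine_independent_span_eq[OF W(1)] W(2) by simp
  then show ?thesis unfolding affine_hull_finite[OF aff_independent_finite[OF W(1)]] by blast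
qed

lemma mem_interior_scaled_simplex:
  fixes W :: "'a::euclidean_space set"
  assumes W: "\<not> affine_dependent W" "card W = DIM('a) + 1" and k: "k > 0"
  shows "y \<in> interior ((\<lambda>x. k *\<^sub>R x) ` (convex hull W)) \<longleftrightarrow>
    (\<exists>\<kappa>. (\<forall>v\<in>W. 0 < \<kappa> v) \<and> sum \<kappa> W = k \<and> (\<Sum>v\<in>W. \<kappa> v *\<^sub>R v) = y)"
proof -
  have int: "interior ((\<lambda>x. k *\<^sub>R x) ` (convex hull W)) = (\<lambda>x. k *\<^sub>R x) ` interior (convex hull W)"
    using k by (intro interior_injective_linear_image) (auto simp: inj_on_def)
  have ex: "interior (convex hull W) = {y. \<exists>u. (\<forall>x\<in>W. 0 < u x) \<and> sum u W = 1 \<and> (\<Sum>x\<in>W. u x *\<^sub>R x) = y}"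
    using W by (simp add: interior_convex_hull_explicit_minimal)
  show ?thesis
  proof
    assume "y \<in> interior ((\<lambda>x. k *\<^sub>R x) ` (convex hull W))"
    then obtain u where u: "\<forall>x\<in>W. 0 < u x" "sum u W = 1" "y = k *\<^sub>R (\<Sum>x\<in>W. u x *\<^sub>R x)"
      unfolding int ex by blast
    then show "\<exists>\<kappa>. (\<forall>v\<in>W. 0 < \<kappa> v) \<and> sum \<kappa> W = k \<and> (\<Sum>v\<in>W. \<kappa> v *\<^sub>R v) = y"
      using k by (intro exI[of _ "\<lambda>v. k * u v"]) (auto simp: sum_distrib_left[symmetric] scaleR_sum_right)
  next
    assume "\<exists>\<kappa>. (\<forall>v\<in>W. 0 < \<kappa> v) \<and> sum \<kappa> W = k \<and> (\<Sum>v\<in>W. \<kappa> v *\<^sub>R v) = y"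
    then obtain \<kappa> where \<kappa>: "\<forall>v\<in>W. 0 < \<kappa> v" "sum \<kappa> W = k" "(\<Sum>v\<in>W. \<kappa> v *\<^sub>R v) = y" by blast
    have "(\<Sum>v\<in>W. (\<kappa> v / k) *\<^sub>R v) = (1 / k) *\<^sub>R y"
      unfolding \<kappa>(3)[symmetric] scaleR_sum_right by simp
    moreover have "sum (\<lambda>v. \<kappa> v / k) W = 1" using \<kappa>(2) k by (simp add: sum_divide_distrib[symmetric])
    ultimately have "(1 / k) *\<^sub>R y \<in> interior (convex hull W)"
      unfolding ex using \<kappa>(1) k by (intro CollectI exI[of _ "\<lambda>v. \<kappa> v / k"]) auto
    then show "y \<in> interior ((\<lambda>x. k *\<^sub>R x) ` (convex hull W))"
      unfolding int using k by (intro image_eqI[of _ _ "(1 / k) *\<^sub>R y"]) auto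
  qed
qed

text \<open>Two vertices with opposite residues are removed at each step, which keeps the counts
  balanced.\<close>

lemma pairing_of_balanced_residues:
  fixes a :: "'w \<Rightarrow> int" and N :: nat
  assumes "finite W" "card W = 2 * n" "\<And>w. w \<in> W \<Longrightarrow> coprime (a w) (int N)"
    "\<And>x. (\<Sum>w\<in>W. of_bool ([a w = x] (mod int N)) :: nat) = (\<Sum>w\<in>W. of_bool ([a w = - x] (mod int N)))"
  shows "\<exists>f g :: nat \<Rightarrow> 'w. W = f ` {..<n} \<union> g ` {..<n} \<and> (\<forall>i<n. int N dvd a (f i) + a (g i))"
  using assms
proof (induction n arbitrary: W)
  case 0
  then show ?case by simp
next
  case (Suc n)
  note fin = Suc.prems(1) and crd = Suc.prems(2) and cop = Suc.prems(3) and bal = Suc.prems(4)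
  obtain w where w: "w \<in> W" using crd by fastforce
  have "\<exists>w'\<in>W - {w}. int N dvd a w + a w'"
  \<comment> \<open>A residue equal to its own negative could be paired with itself. Being a unit it
    forces \<open>N \<le> 2\<close>; then all units coincide, and any other vertex is a
    partner.\<close>
  proof (cases "int N dvd 2 * a w")
    case True
    then have N2: "int N dvd 2" using cop[OF w] by (simp add: coprime_commute coprime_dvd_mult_left_iff)
    have "card (W - {w}) > 0" using crd w fin by simp
    then obtain w' where w': "w' \<in> W - {w}" by (metis card_gt_0_iff ex_in_conv)
    have "int N \<le> 2" using N2 zdvd_imp_le by fastforce
    then consider "N = 1" | "N = 2" using N2 by (cases "N = 0") (force, linarith)
    then have "int N dvd a w + a w'"
    proof cases
      case 2
      then have "odd (a w)" "odd (a w')" using cop[OF w] cop[of w'] w' by auto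
      then show ?thesis using 2 by simp
    qed simp
    then show ?thesis using w' by blast
  next
    case False
    have "(\<Sum>v\<in>W. of_bool ([a v = a w] (mod int N)) :: nat) \<noteq> 0"
      using w fin by auto
    then have "(\<Sum>v\<in>W. of_bool ([a v = - a w] (mod int N)) :: nat) \<noteq> 0" using bal[of "a w"] by simp
    then obtain w' where w': "w' \<in> W" "[a w' = - a w] (mod int N)"
      using sum.neutral[of W "\<lambda>v. of_bool ([a v = - a w] (mod int N)) :: nat"] by fastforce
    then have "int N dvd a w + a w'" by (simp add: cong_iff_dvd_diff add.commute)
    moreover have "w' \<noteq> w" using calculation False by auto
    ultimately show ?thesis using w' by blast
  qed
  then obtain w' where w': "w' \<in> W" "w' \<noteq> w" "int N dvd a w + a w'" by blast
  let ?V = "W - {w} - {w'}"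
  have split: "sum F W = F w + (F w' + sum F ?V)" for F :: "'w \<Rightarrow> nat"
    using fin w w' by (simp add: sum.remove[of W w] sum.remove[of "W - {w}" w'])
  have sw: "[a w = x] (mod int N) \<longleftrightarrow> [a w' = - x] (mod int N)" for x
  proof -
    have "int N dvd a w - x \<longleftrightarrow> int N dvd (a w + a w') - (a w - x)"
      using dvd_diff_left_iff[OF w'(3)] by (metis dvd_diff_right_iff w'(3) dvd_minus_iff minus_diff_eq)
    also have "(a w + a w') - (a w - x) = a w' - (- x)" by simp
    finally show ?thesis by (simp add: cong_iff_dvd_diff)
  qed
  have "\<exists>f g :: nat \<Rightarrow> 'w. ?V = f ` {..<n} \<union> g ` {..<n} \<and> (\<forall>i<n. int N dvd a (f i) + a (g i))"
  proof (rule Suc.IH)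
    show "card ?V = 2 * n" using crd fin w w' by simp
    show "(\<Sum>w\<in>?V. of_bool ([a w = x] (mod int N)) :: nat) = (\<Sum>w\<in>?V. of_bool ([a w = - x] (mod int N)))" for x
      using bal[of x] sw[of x] sw[of "- x"] unfolding split by simp
  qed (use fin cop in auto)
  then obtain f g where fg: "?V = f ` {..<n} \<union> g ` {..<n}" "\<forall>i<n. int N dvd a (f i) + a (g i)" by blast
  have "W = (f(n := w)) ` {..<Suc n} \<union> (g(n := w')) ` {..<Suc n}"
  proof -
    have im: "(f(n := w)) ` {..<Suc n} = insert w (f ` {..<n})" "(g(n := w')) ` {..<Suc n} = insert w' (g ` {..<n})"
      by (auto simp: lessThan_Suc)
    have "W = insert w (insert w' (f ` {..<n} \<union> g ` {..<n}))"
      unfolding fg(1)[symmetric] using w w' by auto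
    then show ?thesis unfolding im by (simp only: Un_insert_left Un_insert_right insert_commute)
  qed
  moreover have "\<forall>i<Suc n. int N dvd a ((f(n := w)) i) + a ((g(n := w')) i)"
    using fg(2) w'(3) by (auto simp: less_Suc_eq)
  ultimately show ?case by blast
qed

section \<open>Cayley polytopes of segments\<close>

lemma cayley_polytope_fst_nonneg:
  fixes \<Sigma> :: "'r::finite \<Rightarrow> 'a::euclidean_space set"
  assumes "p \<in> cayley_polytope \<Sigma>"
  shows "fst p $ i \<ge> 0"
proof -
  have "convex {p :: (real ^ 'r) \<times> 'a. fst p $ i \<ge> 0}" by (auto simp: convex_def)
  then have "cayley_polytope \<Sigma> \<subseteq> {p. fst p $ i \<ge> 0}"
    unfolding cayley_polytope_def by (rule hull_minimal[rotated]) (auto simp: axis_def)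
  then show ?thesis using assms by auto
qed

lemma cayley_polytope_no_interior_lattice_point:
  fixes W :: "'a::euclidean_space set" and \<Sigma> :: "'d::finite \<Rightarrow> (real ^ 'd) set"
  assumes Wl: "W \<subseteq> integer_lattice" and W: "\<not> affine_dependent W" "card W = DIM('a) + 1"
    and iso: "cayley_isomorphic (convex hull W) (cayley_polytope \<Sigma>)"
    and ne: "\<And>i. \<Sigma> i \<noteq> {}" and k: "1 \<le> k" "k < CARD('d)"
  shows "interior ((\<lambda>x. real k *\<^sub>R x) ` (convex hull W)) \<inter> integer_lattice = {}"
proof (rule ccontr)
  assume "\<not> ?thesis"
  then obtain y where y: "y \<in> interior ((\<lambda>x. real k *\<^sub>R x) ` (convex hull W))" "y \<in> integer_lattice" by blast
  obtain \<kappa> where \<kappa>: "\<forall>v\<in>W. 0 < \<kappa> v" "sum \<kappa> W = real k" "(\<Sum>v\<in>W. \<kappa> v *\<^sub>R v) = y"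
    using y(1) k mem_interior_scaled_simplex[OF W, of "real k" y] by auto
  obtain \<phi> where \<phi>: "affine_map \<phi>" "bij_betw \<phi> UNIV cayley_hyperplane"
    "\<phi> ` integer_lattice = cayley_hyperplane \<inter> integer_lattice" "\<phi> ` (convex hull W) = cayley_polytope \<Sigma>"
    using iso unfolding cayley_isomorphic_def by blast
  have fin: "finite W" using W(1) by (rule aff_independent_finite)
  obtain w0 where w0: "w0 \<in> W" using W(2) by fastforce
  have \<phi>_int: "fst (\<phi> x) $ i \<in> \<int>" if "x \<in> integer_lattice" for x i
  proof -
    have "\<phi> x \<in> integer_lattice" using \<phi>(3) that by blast
    then show ?thesis unfolding integer_lattice_prod_eq by (auto simp: mem_Times_iff integer_lattice_vec_iff)
  qed
  \<comment> \<open>The first block of coordinates of the point in the \<open>k\<close>-th dilate of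
    the Cayley polytope. An entry 0 would put every vertex, hence the whole polytope, into a
    coordinate hyperplane that misses the slice over \<open>\<Sigma> i\<close>.\<close>
  define m where "m i = (\<Sum>v\<in>W. \<kappa> v * fst (\<phi> v) $ i)" for i
  have nonneg: "fst (\<phi> v) $ i \<ge> 0" if "v \<in> W" for v i
    using \<phi>(4) that by (metis cayley_polytope_fst_nonneg hull_inc imageI)
  have m_pos: "m i > 0" for i
  proof -
    have terms: "0 \<le> \<kappa> v * fst (\<phi> v) $ i" if "v \<in> W" for v using nonneg[OF that] \<kappa>(1) that by (simp add: less_imp_le)
    have "m i \<noteq> 0"
    proof
      assume "m i = 0"
      then have "\<kappa> v * fst (\<phi> v) $ i = 0" if "v \<in> W" for v
        using sum_nonneg_0[OF fin, of "\<lambda>v. \<kappa> v * fst (\<phi> v) $ i"] terms that unfolding m_def by blast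
      then have "\<phi> ` W \<subseteq> {p. fst p $ i = 0}" using \<kappa>(1) by fastforce
      moreover have "convex {p :: (real ^ 'd) \<times> (real ^ 'd). fst p $ i = 0}" by (auto simp: convex_def)
      ultimately have sub: "cayley_polytope \<Sigma> \<subseteq> {p. fst p $ i = 0}"
        unfolding \<phi>(4)[symmetric] affine_map_convex_hull[OF \<phi>(1)] by (rule hull_minimal)
      obtain s where "s \<in> \<Sigma> i" using ne by blast
      then have "(axis i 1, s) \<in> cayley_polytope \<Sigma>" unfolding cayley_polytope_def by (auto intro!: hull_inc)
      then show False using sub by (auto simp: axis_def)
    qed
    moreover have "m i \<ge> 0" unfolding m_def by (rule sum_nonneg) (rule terms)
    ultimately show ?thesis by simp
  qed
  have m_int: "m i \<in> \<int>" for i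
  proof -
    \<comment> \<open>An affine map respects only weights of total 1, so the excess
      \<open>k - 1\<close> is taken off at the lattice point \<open>w0\<close> and restored
      afterwards.\<close>
    define \<kappa>' where "\<kappa>' v = \<kappa> v - (if v = w0 then real k - 1 else 0)" for v
    have "sum \<kappa>' W = 1" using fin w0 \<kappa>(2) by (simp add: \<kappa>'_def sum_subtractf)
    from affine_map_sum[OF \<phi>(1) this]
    have e: "\<phi> (\<Sum>v\<in>W. \<kappa>' v *\<^sub>R v) = (\<Sum>v\<in>W. \<kappa>' v *\<^sub>R \<phi> v)" .
    have "(\<Sum>v\<in>W. \<kappa>' v *\<^sub>R v) = y - (real k - 1) *\<^sub>R w0"
      using fin w0 \<kappa>(3) by (simp add: \<kappa>'_def scaleR_diff_left sum_subtractf if_distrib[of "\<lambda>x. x *\<^sub>R _"] cong: if_cong)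
    moreover have "y - (real k - 1) *\<^sub>R w0 \<in> integer_lattice"
      using y(2) w0 Wl by (intro integer_lattice_diff integer_lattice_scale) auto
    ultimately have 1: "fst (\<Sum>v\<in>W. \<kappa>' v *\<^sub>R \<phi> v) $ i \<in> \<int>" using \<phi>_int e by metis
    have "fst (\<Sum>v\<in>W. \<kappa>' v *\<^sub>R \<phi> v) $ i = (\<Sum>v\<in>W. \<kappa>' v * fst (\<phi> v) $ i)"
      by (simp add: fst_sum)
    also have "\<dots> = m i - (real k - 1) * fst (\<phi> w0) $ i"
      using fin w0 by (simp add: m_def \<kappa>'_def left_diff_distrib sum_subtractf if_distrib[of "\<lambda>x. x * _"] cong: if_cong)
    finally have 2: "m i = fst (\<Sum>v\<in>W. \<kappa>' v *\<^sub>R \<phi> v) $ i + (real k - 1) * fst (\<phi> w0) $ i" by simp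
    show ?thesis unfolding 2 using w0 Wl by (intro Ints_add 1 Ints_mult \<phi>_int) auto
  qed
  have "m i \<ge> 1" for i
  proof -
    obtain z :: int where "m i = of_int z" using m_int[of i] by (auto elim: Ints_cases)
    then show ?thesis using m_pos[of i] by simp
  qed
  then have "(\<Sum>i\<in>(UNIV::'d set). 1) \<le> (\<Sum>i\<in>UNIV. m i)" by (intro sum_mono)
  also have "(\<Sum>i\<in>UNIV. m i) = (\<Sum>v\<in>W. \<kappa> v * (\<Sum>i\<in>UNIV. fst (\<phi> v) $ i))"
    unfolding m_def by (subst sum.swap) (simp add: sum_distrib_left)
  also have "\<dots> = (\<Sum>v\<in>W. \<kappa> v)"
  proof (rule sum.cong[OF refl])
    fix v
    have "\<phi> v \<in> cayley_hyperplane" using \<phi>(2) by (auto simp: bij_betw_def)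
    then show "\<kappa> v * (\<Sum>i\<in>UNIV. fst (\<phi> v) $ i) = \<kappa> v" by (auto simp: cayley_hyperplane_def)
  qed
  finally show False using \<kappa>(2) k by simp
qed

lemma convex_hull_Union_slices:
  "convex hull (\<Union>i. {e i} \<times> (convex hull (S i))) = convex hull (\<Union>i. {e i} \<times> S i)"
proof (rule subset_antisym)
  have "{e i} \<times> (convex hull (S i)) \<subseteq> convex hull (\<Union>i. {e i} \<times> S i)" for i
  proof -
    have "{e i} \<times> (convex hull (S i)) = convex hull ({e i} \<times> S i)" by (simp add: convex_hull_Times)
    also have "\<dots> \<subseteq> convex hull (\<Union>i. {e i} \<times> S i)" by (rule hull_mono) blast
    finally show ?thesis .
  qed
  then show "convex hull (\<Union>i. {e i} \<times> (convex hull (S i))) \<subseteq> convex hull (\<Union>i. {e i} \<times> S i)"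
    by (intro hull_minimal) auto
  show "convex hull (\<Union>i. {e i} \<times> S i) \<subseteq> convex hull (\<Union>i. {e i} \<times> (convex hull (S i)))"
    by (rule hull_mono) (auto intro: hull_inc)
qed

text \<open>Allows vertex images and barycentric coordinates to be prescribed separately on the two
  halves of the vertex set.\<close>

lemma ex_pair_extension:
  assumes "inj v0" "inj v1" "range v0 \<inter> range v1 = {}"
  shows "\<exists>F. (\<forall>i. F (v0 i) = g i) \<and> (\<forall>i. F (v1 i) = h i)"
proof (intro exI conjI allI)
  let ?F = "\<lambda>w. if w \<in> range v0 then g (inv_into UNIV v0 w) else h (inv_into UNIV v1 w)"
  show "?F (v0 i) = g i" for i using assms(1) by simp
  have "v1 i \<notin> range v0" for i using assms(3) by blast
  then show "?F (v1 i) = h i" for i using assms(2) by simp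
qed

text \<open>In the coordinates \<open>\<kappa>\<close> of a point with respect to the vertices, the isomorphism is
  \<open>\<mu> i = \<kappa> (v0 i) + \<kappa> (v1 i)\<close> together with \<open>\<psi> i = \<kappa> (v1 i) - a (v1 i) * \<kappa> (v1 s)\<close> for
  \<open>i \<noteq> s\<close> and \<open>\<psi> s = N * \<kappa> (v1 s)\<close>; these are integral exactly at the lattice points.\<close>

lemma cayley_isomorphic_of_pairing:
  fixes W :: "'a::euclidean_space set" and v0 v1 :: "'d::finite \<Rightarrow> 'a" and a :: "'a \<Rightarrow> int" and N :: nat
  assumes Wl: "W \<subseteq> integer_lattice" and W: "\<not> affine_dependent W" "card W = DIM('a) + 1" "card W = 2 * CARD('d)"
    and v: "W = range v0 \<union> range v1" and N: "N > 0" and s: "a (v1 s) = 1"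
    and dvd: "\<And>i. int N dvd a (v0 i) + a (v1 i)"
    and lat: "\<And>\<kappa>. sum \<kappa> W \<in> \<int> \<Longrightarrow> (\<Sum>v\<in>W. \<kappa> v *\<^sub>R v) \<in> integer_lattice \<longleftrightarrow>
       (\<exists>j :: int. \<forall>v\<in>W. \<kappa> v - of_int j * of_int (a v) / N \<in> \<int>)"
  shows "\<exists>\<Sigma> :: 'd \<Rightarrow> (real ^ 'd) set. (\<forall>i. lattice_simplex 1 (\<Sigma> i)) \<and>
    cayley_isomorphic (convex hull W) (cayley_polytope \<Sigma>)"
proof -
  have c: "card (range v0) \<le> CARD('d)" "card (range v1) \<le> CARD('d)" by (simp_all add: card_image_le)
  have "card (range v0) + card (range v1) = card W + card (range v0 \<inter> range v1)"
    unfolding v by (intro card_Un_Int) auto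
  \<comment> \<open>Two families of \<open>CARD('d)\<close> vertices cover
    \<open>2 * CARD('d)\<close> vertices, so they can have no repetition.\<close>
  then have c': "card (range v0) = CARD('d)" "card (range v1) = CARD('d)" "card (range v0 \<inter> range v1) = 0"
    using c W(3) by linarith+
  then have inj: "inj v0" "inj v1" by (simp_all add: eq_card_imp_inj_on)
  have disj: "range v0 \<inter> range v1 = {}" using c'(3) by simp
  have sumW: "sum F W = (\<Sum>i\<in>UNIV. F (v0 i)) + (\<Sum>i\<in>UNIV. F (v1 i))" for F :: "'a \<Rightarrow> 'b::comm_monoid_add"
    unfolding v using disj inj by (simp add: sum.union_disjoint sum.reindex)
  define b where "b i = real_of_int (a (v1 i))" for i
  have bs: "b s = 1" using s by (simp add: b_def)
  define q where "q j = (if j = s then real N else 0) - b j" for j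
  \<comment> \<open>Read off from the formula for \<open>\<psi>\<close>: \<open>p i\<close> is the
    image of the vertex \<open>v1 i\<close>, a unit vector for \<open>i \<noteq> s\<close>, while
    \<open>p s\<close> has entry \<open>N\<close> at \<open>s\<close> and \<open>- b j\<close> at
    the other \<open>j\<close>.\<close>
  define p :: "'d \<Rightarrow> real ^ 'd" where "p i = (\<chi> j. (if j = i then 1 else 0) + (if i = s then q j else 0))" for i
  have N0: "real N \<noteq> 0" using N by simp
  obtain f :: "'a \<Rightarrow> (real ^ 'd) \<times> (real ^ 'd)" where f: "\<And>i. f (v0 i) = (axis i 1, 0)" "\<And>i. f (v1 i) = (axis i 1, p i)"
    using ex_pair_extension[OF inj disj, of "\<lambda>i. (axis i 1, 0)" "\<lambda>i. (axis i 1, p i)"] by blast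
  obtain \<phi> where \<phi>: "affine_map \<phi>" "\<forall>w\<in>W. \<phi> w = f w" using affine_map_extend[OF W(1), of f] by blast
  have \<phi>v: "\<phi> (v0 i) = (axis i 1, 0)" "\<phi> (v1 i) = (axis i 1, p i)" for i
    using \<phi>(2) f v by auto
  have coords: "fst (\<phi> (\<Sum>v\<in>W. \<kappa> v *\<^sub>R v)) $ j = \<kappa> (v0 j) + \<kappa> (v1 j)"
    "snd (\<phi> (\<Sum>v\<in>W. \<kappa> v *\<^sub>R v)) $ j = \<kappa> (v1 j) + \<kappa> (v1 s) * q j" if "sum \<kappa> W = 1" for \<kappa> j
  proof -
    have \<phi>s: "\<phi> (\<Sum>v\<in>W. \<kappa> v *\<^sub>R v) = (\<Sum>i\<in>UNIV. \<kappa> (v0 i) *\<^sub>R (axis i 1, 0)) + (\<Sum>i\<in>UNIV. \<kappa> (v1 i) *\<^sub>R (axis i 1, p i))"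
      unfolding affine_map_sum[OF \<phi>(1) that] by (subst sumW) (simp only: \<phi>v)
    show "fst (\<phi> (\<Sum>v\<in>W. \<kappa> v *\<^sub>R v)) $ j = \<kappa> (v0 j) + \<kappa> (v1 j)"
      unfolding \<phi>s by (simp add: fst_sum axis_def if_distrib[of "\<lambda>x. _ * x"] cong: if_cong)
    have "snd (\<phi> (\<Sum>v\<in>W. \<kappa> v *\<^sub>R v)) $ j = (\<Sum>i\<in>UNIV. \<kappa> (v1 i) * p i $ j)"
      unfolding \<phi>s by (simp add: snd_sum)
    also have "\<dots> = (\<Sum>i\<in>UNIV. (if i = j then \<kappa> (v1 i) else 0) + (if i = s then \<kappa> (v1 i) * q j else 0))"
      by (intro sum.cong refl) (auto simp: p_def distrib_left)
    also have "\<dots> = \<kappa> (v1 j) + \<kappa> (v1 s) * q j" by (simp add: sum.distrib)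
    finally show "snd (\<phi> (\<Sum>v\<in>W. \<kappa> v *\<^sub>R v)) $ j = \<kappa> (v1 j) + \<kappa> (v1 s) * q j" .
  qed
  have surj: "\<exists>\<kappa>. sum \<kappa> W = 1 \<and> \<phi> (\<Sum>v\<in>W. \<kappa> v *\<^sub>R v) = (\<mu>, \<psi>) \<and>
      (\<forall>i. \<kappa> (v1 i) = \<psi> $ i - \<psi> $ s / N * q i \<and> \<kappa> (v0 i) = \<mu> $ i - \<kappa> (v1 i))"
    if \<mu>: "(\<Sum>i\<in>UNIV. \<mu> $ i) = 1" for \<mu> \<psi>
  proof -
    obtain \<kappa> where \<kappa>: "\<And>i. \<kappa> (v0 i) = \<mu> $ i - (\<psi> $ i - \<psi> $ s / N * q i)" "\<And>i. \<kappa> (v1 i) = \<psi> $ i - \<psi> $ s / N * q i"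
      using ex_pair_extension[OF inj disj, of "\<lambda>i. \<mu> $ i - (\<psi> $ i - \<psi> $ s / N * q i)" "\<lambda>i. \<psi> $ i - \<psi> $ s / N * q i"] by blast
    have k1: "sum \<kappa> W = 1" unfolding sumW \<kappa> using \<mu> by (simp add: sum_subtractf)
    have ks: "\<kappa> (v1 s) = \<psi> $ s / N" unfolding \<kappa> using bs N0 by (simp add: q_def right_diff_distrib)
    have "fst (\<phi> (\<Sum>v\<in>W. \<kappa> v *\<^sub>R v)) = \<mu>"
      by (simp add: vec_eq_iff coords[OF k1] \<kappa>)
    moreover have "snd (\<phi> (\<Sum>v\<in>W. \<kappa> v *\<^sub>R v)) = \<psi>"
      unfolding vec_eq_iff coords[OF k1] ks by (simp add: \<kappa>)
    ultimately show ?thesis using k1 \<kappa> by (intro exI[of _ \<kappa>]) (simp add: prod_eq_iff)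
  qed
  have bij: "bij_betw \<phi> UNIV cayley_hyperplane"
  proof (rule bij_betw_imageI)
    show "inj \<phi>"
    proof (rule injI)
      fix x y assume xy: "\<phi> x = \<phi> y"
      obtain \<kappa> where \<kappa>: "sum \<kappa> W = 1" "x = (\<Sum>v\<in>W. \<kappa> v *\<^sub>R v)" using ex_barycentric_coords[OF W(1,2), of x] by blast
      obtain \<kappa>' where \<kappa>': "sum \<kappa>' W = 1" "y = (\<Sum>v\<in>W. \<kappa>' v *\<^sub>R v)" using ex_barycentric_coords[OF W(1,2), of y] by blast
      have 1: "\<kappa> (v0 j) + \<kappa> (v1 j) = \<kappa>' (v0 j) + \<kappa>' (v1 j)" for j
        using arg_cong[OF xy, of "\<lambda>z. fst z $ j"] unfolding \<kappa>(2) \<kappa>'(2) coords[OF \<kappa>(1)] coords[OF \<kappa>'(1)] .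
      have 2: "\<kappa> (v1 j) + \<kappa> (v1 s) * q j = \<kappa>' (v1 j) + \<kappa>' (v1 s) * q j" for j
        using arg_cong[OF xy, of "\<lambda>z. snd z $ j"] unfolding \<kappa>(2) \<kappa>'(2) coords[OF \<kappa>(1)] coords[OF \<kappa>'(1)] .
      have "\<kappa> (v1 s) * N = \<kappa>' (v1 s) * N" using 2[of s] bs by (simp add: q_def algebra_simps)
      then have "\<kappa> (v1 s) = \<kappa>' (v1 s)" using N0 by simp
      then have "\<kappa> (v1 j) = \<kappa>' (v1 j)" for j using 2[of j] by simp
      moreover from this have "\<kappa> (v0 j) = \<kappa>' (v0 j)" for j using 1[of j] by simp
      ultimately show "x = y" unfolding \<kappa>(2) \<kappa>'(2) sumW by simp
    qed
    show "range \<phi> = cayley_hyperplane"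
    proof (intro equalityI subsetI)
      fix z assume "z \<in> range \<phi>"
      then obtain x where "z = \<phi> x" by blast
      moreover obtain \<kappa> where \<kappa>: "sum \<kappa> W = 1" "x = (\<Sum>v\<in>W. \<kappa> v *\<^sub>R v)" using ex_barycentric_coords[OF W(1,2), of x] by blast
      ultimately have "(\<Sum>i\<in>UNIV. fst z $ i) = (\<Sum>i\<in>UNIV. \<kappa> (v0 i) + \<kappa> (v1 i))"
        by (simp only: coords[OF \<kappa>(1)])
      also have "\<dots> = sum \<kappa> W" by (simp only: sum.distrib sumW)
      finally have "(\<Sum>i\<in>UNIV. fst z $ i) = sum \<kappa> W" .
      then show "z \<in> cayley_hyperplane" using \<kappa>(1) by (simp add: cayley_hyperplane_def split_beta)
    next
      fix z :: "(real ^ 'd) \<times> (real ^ 'd)" assume "z \<in> cayley_hyperplane"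
      then have "(\<Sum>i\<in>UNIV. fst z $ i) = 1" by (auto simp: cayley_hyperplane_def)
      from surj[OF this, of "snd z"] obtain \<kappa> where "\<phi> (\<Sum>v\<in>W. \<kappa> v *\<^sub>R v) = z" by auto
      then show "z \<in> range \<phi>" by (metis rangeI)
    qed
  qed
  have lattice: "\<phi> ` integer_lattice = cayley_hyperplane \<inter> integer_lattice"
  proof (intro equalityI subsetI)
    fix z assume "z \<in> \<phi> ` integer_lattice"
    then obtain x where x: "z = \<phi> x" "x \<in> integer_lattice" by blast
    obtain \<kappa> where \<kappa>: "sum \<kappa> W = 1" "x = (\<Sum>v\<in>W. \<kappa> v *\<^sub>R v)" using ex_barycentric_coords[OF W(1,2), of x] by blast
    obtain j :: int where j: "\<forall>v\<in>W. \<kappa> v - of_int j * of_int (a v) / N \<in> \<int>" using lat[of \<kappa>] \<kappa> x by auto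
    define n where "n v = \<kappa> v - of_int j * of_int (a v) / N" for v
    have n: "n (v0 i) \<in> \<int>" "n (v1 i) \<in> \<int>" for i using j v by (auto simp: n_def)
    have \<kappa>n: "\<kappa> v = n v + of_int j * of_int (a v) / N" for v by (simp add: n_def)
    have "fst z $ i \<in> \<int>" for i
    proof -
      obtain e where e: "a (v0 i) + a (v1 i) = int N * e" using dvd[of i] by blast
      have "fst z $ i = n (v0 i) + n (v1 i) + of_int j * (of_int (a (v0 i) + a (v1 i)) / N)"
        unfolding x(1) \<kappa>(2) coords[OF \<kappa>(1)] by (simp add: \<kappa>n add_divide_distrib distrib_left)
      also have "of_int (a (v0 i) + a (v1 i)) / real N = of_int e" unfolding e using N0 by simp
      finally show ?thesis using n by auto
    qed
    moreover have "snd z $ i \<in> \<int>" for i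
    proof -
      have "snd z $ i = n (v1 i) + of_int j * b i / N + (n (v1 s) + of_int j / N) * q i"
        unfolding x(1) \<kappa>(2) coords[OF \<kappa>(1)] by (simp add: \<kappa>n b_def s)
      \<comment> \<open>The fractional contributions \<open>j * b i / N\<close> cancel; at
        \<open>i = s\<close> the extra \<open>N\<close> in \<open>q\<close> leaves the integer
        \<open>j\<close>.\<close>
      also have "\<dots> = n (v1 i) + n (v1 s) * q i + of_int j * (if i = s then 1 else 0)"
        using N0 by (simp add: q_def field_simps)
      also have "\<dots> \<in> \<int>" using n by (auto simp: q_def b_def)
      finally show ?thesis .
    qed
    moreover have "z \<in> cayley_hyperplane" using bij x by (auto simp: bij_betw_def)
    ultimately show "z \<in> cayley_hyperplane \<inter> integer_lattice"
      unfolding integer_lattice_prod_eq by (auto simp: mem_Times_iff integer_lattice_vec_iff)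
  next
    fix z :: "(real ^ 'd) \<times> (real ^ 'd)" assume z: "z \<in> cayley_hyperplane \<inter> integer_lattice"
    obtain \<mu> \<psi> where z': "z = (\<mu>, \<psi>)" by (cases z)
    have ints: "\<mu> $ i \<in> \<int>" "\<psi> $ i \<in> \<int>" and sum1: "(\<Sum>i\<in>UNIV. \<mu> $ i) = 1" for i
      using z unfolding integer_lattice_prod_eq z' by (auto simp: integer_lattice_vec_iff cayley_hyperplane_def)
    obtain \<kappa> where \<kappa>: "sum \<kappa> W = 1" "\<phi> (\<Sum>v\<in>W. \<kappa> v *\<^sub>R v) = z"
      "\<And>i. \<kappa> (v1 i) = \<psi> $ i - \<psi> $ s / N * q i" "\<And>i. \<kappa> (v0 i) = \<mu> $ i - \<kappa> (v1 i)"
      using surj[OF sum1, of \<psi>] z' by blast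
    \<comment> \<open>The multiple of the generator is forced:
      \<open>\<kappa> (v1 s) = \<psi> $ s / N\<close>, while the generator has coordinate
      \<open>1 / N\<close> there.\<close>
    obtain j where j: "\<psi> $ s = of_int j" using ints(2)[of s] by (auto elim: Ints_cases)
    have 1: "\<kappa> (v1 i) - of_int j * of_int (a (v1 i)) / N = \<psi> $ i - (if i = s then \<psi> $ s else 0)" for i
      unfolding \<kappa>(3) j using N0 by (simp add: q_def b_def field_simps)
    have 2: "\<kappa> (v0 i) - of_int j * of_int (a (v0 i)) / N \<in> \<int>" for i
    proof -
      obtain e where e: "a (v0 i) + a (v1 i) = int N * e" using dvd[of i] by blast
      have "\<kappa> (v0 i) - of_int j * of_int (a (v0 i)) / N
          = \<mu> $ i - (\<kappa> (v1 i) - of_int j * of_int (a (v1 i)) / N) - of_int j * (of_int (a (v0 i) + a (v1 i)) / N)"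
        unfolding \<kappa>(4) by (simp add: add_divide_distrib distrib_left)
      also have "of_int (a (v0 i) + a (v1 i)) / real N = of_int e" unfolding e using N0 by simp
      finally show ?thesis unfolding 1 using ints by auto
    qed
    have "\<forall>v\<in>W. \<kappa> v - of_int j * of_int (a v) / N \<in> \<int>"
      using 1 2 ints unfolding v by auto
    then have "(\<Sum>v\<in>W. \<kappa> v *\<^sub>R v) \<in> integer_lattice" using lat[of \<kappa>] \<kappa>(1) by auto
    then show "z \<in> \<phi> ` integer_lattice" using \<kappa>(2) by blast
  qed
  define \<Sigma> where "\<Sigma> i = convex hull {0, p i}" for i
  have "\<phi> ` W = (\<Union>i. {axis i 1} \<times> {0, p i})" unfolding v using \<phi>v by (auto simp: image_Un image_image)
  then have "\<phi> ` (convex hull W) = cayley_polytope \<Sigma>"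
    unfolding affine_map_convex_hull[OF \<phi>(1)] cayley_polytope_def \<Sigma>_def convex_hull_Union_slices by simp
  then have "cayley_isomorphic (convex hull W) (cayley_polytope \<Sigma>)"
    unfolding cayley_isomorphic_def using \<phi>(1) bij lattice by blast
  moreover have "lattice_simplex 1 (\<Sigma> i)" for i
  proof -
    have "p i $ i \<noteq> 0" using N0 bs by (auto simp: p_def q_def)
    then have "p i \<noteq> 0" by auto
    moreover have "{0, p i} \<subseteq> integer_lattice" by (auto simp: integer_lattice_vec_iff p_def q_def b_def)
    moreover have "\<not> affine_dependent {0, p i}" by (rule affine_independent_2)
    ultimately show ?thesis unfolding lattice_simplex_def \<Sigma>_def by (intro exI[of _ "{0, p i}"]) auto
  qed
  ultimately show ?thesis by blast
qed

section \<open>From empty dilates to opposite residues\<close>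

text \<open>The residues of \<open>j * a v\<close> divided by \<open>N\<close> are positive
  coordinates of a lattice point. Their total \<open>t\<close> is an integer because
  \<open>a\<close> sums to 0, so the point is interior to the \<open>t\<close>-th dilate, and
  \<open>t\<close> below \<open>d\<close> is excluded.\<close>

lemma residue_sum_ge_if_no_interior_lattice_point:
  fixes W :: "'a::euclidean_space set" and a :: "'a \<Rightarrow> int" and N :: nat and j :: int
  assumes W: "\<not> affine_dependent W" "card W = DIM('a) + 1" and N: "N > 0" and a: "sum a W = 0"
    and cop: "\<And>v. v \<in> W \<Longrightarrow> coprime (a v) (int N)"
    and lat: "\<And>\<kappa>. sum \<kappa> W \<in> \<int> \<Longrightarrow> (\<Sum>v\<in>W. \<kappa> v *\<^sub>R v) \<in> integer_lattice \<longleftrightarrow>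
       (\<exists>j :: int. \<forall>v\<in>W. \<kappa> v - of_int j * of_int (a v) / N \<in> \<int>)"
    and free: "\<And>k. k \<in> {1..d - 1} \<Longrightarrow> interior ((\<lambda>x. real k *\<^sub>R x) ` (convex hull W)) \<inter> integer_lattice = {}"
    and j: "\<not> int N dvd j"
  shows "(\<Sum>v\<in>W. (j * a v) mod int N) \<ge> int d * int N"
proof -
  define r where "r v = (j * a v) mod int N" for v
  define \<kappa> where "\<kappa> v = real_of_int (r v) / N" for v
  have rpos: "r v > 0" if "v \<in> W" for v
  proof -
    have "\<not> int N dvd j * a v" using j cop[OF that] by (simp add: coprime_commute coprime_dvd_mult_left_iff)
    then have "r v \<noteq> 0" by (simp add: r_def dvd_eq_mod_eq_0)
    moreover have "r v \<ge> 0" using N by (simp add: r_def)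
    ultimately show ?thesis by simp
  qed
  have fin: "finite W" "W \<noteq> {}" using W aff_independent_finite[OF W(1)] by auto
  have "int N dvd sum r W"
  proof -
    have "(\<Sum>v\<in>W. j * a v) mod int N = 0" using a by (simp add: sum_distrib_left[symmetric])
    then have "sum r W mod int N = 0" unfolding r_def by (simp add: mod_sum_eq)
    then show ?thesis by auto
  qed
  then obtain t where t: "sum r W = int N * t" by blast
  have "sum r W > 0" using fin rpos by (intro sum_pos)
  then have tpos: "t > 0" using t N by (simp add: zero_less_mult_iff)
  have sk: "sum \<kappa> W = of_int t"
    unfolding \<kappa>_def sum_divide_distrib[symmetric] of_int_sum[symmetric] t using N by simp
  have "\<forall>v\<in>W. \<kappa> v - of_int j * of_int (a v) / N \<in> \<int>"
  proof
    fix v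
    have "r v = j * a v - int N * ((j * a v) div int N)" by (simp add: r_def minus_mult_div_eq_mod)
    then have "real_of_int (r v) = of_int j * of_int (a v) - real N * of_int ((j * a v) div int N)" by simp
    then have "\<kappa> v - of_int j * of_int (a v) / N = - of_int ((j * a v) div int N)"
      using N by (simp add: \<kappa>_def diff_divide_distrib)
    then show "\<kappa> v - of_int j * of_int (a v) / N \<in> \<int>" by simp
  qed
  then have "(\<Sum>v\<in>W. \<kappa> v *\<^sub>R v) \<in> integer_lattice" using lat[of \<kappa>] sk by auto
  moreover have "(\<Sum>v\<in>W. \<kappa> v *\<^sub>R v) \<in> interior ((\<lambda>x. real (nat t) *\<^sub>R x) ` (convex hull W))"
  proof -
    have "\<forall>v\<in>W. 0 < \<kappa> v" using rpos N by (simp add: \<kappa>_def)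
    moreover have "sum \<kappa> W = real (nat t)" using sk tpos by simp
    ultimately show ?thesis using mem_interior_scaled_simplex[OF W, of "real (nat t)"] tpos by auto
  qed
  ultimately have "nat t \<notin> {1..d - 1}" using free[of "nat t"] by blast
  then have "int d \<le> t" using tpos by auto
  then have "int d * int N \<le> t * int N" by (intro mult_right_mono) auto
  then show ?thesis using t by (simp add: r_def mult.commute)
qed

lemma pairing_if_no_interior_lattice_point:
  fixes W :: "'a::euclidean_space set" and a :: "'a \<Rightarrow> int" and N :: nat
  assumes W: "\<not> affine_dependent W" "card W = DIM('a) + 1" "card W = 2 * d" and N: "N > 0" and a: "sum a W = 0"
    and cop: "\<And>v. v \<in> W \<Longrightarrow> coprime (a v) (int N)"
    and lat: "\<And>\<kappa>. sum \<kappa> W \<in> \<int> \<Longrightarrow> (\<Sum>v\<in>W. \<kappa> v *\<^sub>R v) \<in> integer_lattice \<longleftrightarrow>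
       (\<exists>j :: int. \<forall>v\<in>W. \<kappa> v - of_int j * of_int (a v) / N \<in> \<int>)"
    and free: "\<And>k. k \<in> {1..d - 1} \<Longrightarrow> interior ((\<lambda>x. real k *\<^sub>R x) ` (convex hull W)) \<inter> integer_lattice = {}"
  shows "\<exists>f g :: nat \<Rightarrow> 'a. W = f ` {..<d} \<union> g ` {..<d} \<and> (\<forall>i<d. int N dvd a (f i) + a (g i))"
proof -
  have fin: "finite W" using W(1) by (rule aff_independent_finite)
  have ge: "(\<Sum>v\<in>W. (j * a v) mod int N) \<ge> int d * int N" if "\<not> int N dvd j" for j :: int
    by (rule residue_sum_ge_if_no_interior_lattice_point[OF W(1,2) N a cop lat free that])
  \<comment> \<open>The sums for \<open>j\<close> and \<open>- j\<close> add up to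
    \<open>2 * d * N\<close>, and each is at least \<open>d * N\<close>.\<close>
  have eq: "(\<Sum>v\<in>W. (j * a v) mod int N) = int d * int N" if j: "\<not> int N dvd j" for j :: int
  proof -
    have "(- j * a v) mod int N = int N - (j * a v) mod int N" if v: "v \<in> W" for v
    proof -
      have "\<not> int N dvd j * a v" using j cop[OF v] by (simp add: coprime_commute coprime_dvd_mult_left_iff)
      then show ?thesis by (simp add: zmod_zminus1_eq_if dvd_eq_mod_eq_0)
    qed
    then have "(\<Sum>v\<in>W. (- j * a v) mod int N) = (\<Sum>v\<in>W. int N - (j * a v) mod int N)" by (intro sum.cong refl)
    also have "\<dots> = 2 * int d * int N - (\<Sum>v\<in>W. (j * a v) mod int N)" using W(3) by (simp add: sum_subtractf)
    finally show ?thesis using ge[OF j] ge[of "- j"] j by (simp add: mult.commute)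
  qed
  \<comment> \<open>Natural representatives, as characters take natural arguments; the equivalences
    below translate back, with \<open>N - 1\<close> for -1.\<close>
  define a' where "a' v = nat (a v mod int N)" for v
  have a': "int (a' v) = a v mod int N" for v using N by (simp add: a'_def)
  have bal: "card {v \<in> W. [a' v = x] (mod N)} = card {v \<in> W. [(N - 1) * a' v = x] (mod N)}" for x
  proof (rule residues_balanced[OF N fin W(3)])
    show "coprime (a' v) N" if "v \<in> W" for v
    proof -
      have "coprime (int (a' v)) (int N)" unfolding a' using cop[OF that] N by simp
      then show ?thesis by simp
    qed
    fix k assume k: "\<not> N dvd k"
    have "int (\<Sum>v\<in>W. k * a' v mod N) = (\<Sum>v\<in>W. (int k * a v) mod int N)"
      by (simp add: zmod_int a' mod_mult_right_eq)
    also have "\<dots> = int (d * N)" using eq[of "int k"] k by simp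
    finally show "(\<Sum>v\<in>W. k * a' v mod N) = d * N" by linarith
  qed
  have counts: "(\<Sum>v\<in>W. of_bool ([a v = x] (mod int N)) :: nat) = (\<Sum>v\<in>W. of_bool ([a v = - x] (mod int N)))" for x
  proof -
    define y where "y = nat (x mod int N)"
    have y: "[int y = x] (mod int N)" using N by (simp add: y_def cong_def)
    have av: "[int (a' v) = a v] (mod int N)" for v by (simp add: a' cong_def)
    have 1: "[a' v = y] (mod N) \<longleftrightarrow> [a v = x] (mod int N)" for v
      unfolding cong_int_iff[symmetric] using y av[of v] by (meson cong_sym cong_trans)
    have 2: "[(N - 1) * a' v = y] (mod N) \<longleftrightarrow> [a v = - x] (mod int N)" for v
    proof -
      have "[int ((N - 1) * a' v) = - a v] (mod int N)"
      proof -
        have "int ((N - 1) * a' v) = - int (a' v) + int N * int (a' v)" using N by (simp add: of_nat_diff algebra_simps)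
        then have "[int ((N - 1) * a' v) = - int (a' v)] (mod int N)" by (simp only: cong_def mod_mult_self2)
        moreover have "[- int (a' v) = - a v] (mod int N)" using av[of v] by (simp add: cong_minus_minus_iff)
        ultimately show ?thesis by (rule cong_trans)
      qed
      then have "[(N - 1) * a' v = y] (mod N) \<longleftrightarrow> [- a v = x] (mod int N)"
        unfolding cong_int_iff[symmetric] using y by (meson cong_sym cong_trans)
      also have "\<dots> \<longleftrightarrow> [a v = - x] (mod int N)" using cong_minus_minus_iff[of "a v" "- x"] by simp
      finally show ?thesis .
    qed
    have cnt: "(\<Sum>v\<in>W. of_bool (Q v) :: nat) = card {v \<in> W. Q v}" for Q
      using fin by (simp add: sum.If_cases of_bool_def Int_def)
    show ?thesis unfolding cnt using bal[of y] unfolding 1 2 .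
  qed
  show ?thesis by (rule pairing_of_balanced_residues[OF fin W(3) cop counts])
qed

theorem theorem1p6:
  fixes d :: nat and \<Delta> :: "(real ^ 'm) set"
  assumes "d \<ge> 1" and "CARD('d::finite) = d" and "CARD('m) = 2 * d - 1"
    and "lattice_simplex (2 * d - 1) \<Delta>"
    and "\<And>F. F facet_of \<Delta> \<Longrightarrow> basic_simplex F"
  shows "(\<forall>k\<in>{1..d - 1}. interior ((\<lambda>x. real k *\<^sub>R x) ` \<Delta>) \<inter> integer_lattice = {}) \<longleftrightarrow>
    (\<exists>\<Sigma> :: 'd \<Rightarrow> (real ^ 'd) set.
       (\<forall>i. lattice_simplex 1 (\<Sigma> i)) \<and> cayley_isomorphic \<Delta> (cayley_polytope \<Sigma>))"
proof -
  obtain W where Wl: "W \<subseteq> integer_lattice" and W: "\<not> affine_dependent W" "card W = (2 * d - 1) + 1"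
    and \<Delta>: "\<Delta> = convex hull W"
    using assms(4) unfolding lattice_simplex_def by blast
  have card: "card W = DIM(real ^ 'm) + 1" "card W = 2 * d" using W(2) assms(1,3) by auto
  have basic: "basic_simplex (convex hull (W - {v}))" if "v \<in> W" for v
  proof (rule assms(5))
    have "card (W - {v}) > 0" using card(2) assms(1) that aff_independent_finite[OF W(1)] by simp
    then have "W - {v} \<noteq> {}" by (metis card.empty less_irrefl)
    then show "convex hull (W - {v}) facet_of \<Delta>"
      unfolding \<Delta> facet_of_convex_hull_affine_independent[OF W(1)] using that by auto
  qed
  show ?thesis
  proof
    assume free: "\<forall>k\<in>{1..d - 1}. interior ((\<lambda>x. real k *\<^sub>R x) ` \<Delta>) \<inter> integer_lattice = {}"
    obtain w where w: "w \<in> W" using card(1) by fastforce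
    obtain N :: nat and a :: "real ^ 'm \<Rightarrow> int" where N: "N > 0" and a: "a w = 1" "sum a W = 0"
      and cop: "\<forall>v\<in>W. coprime (a v) (int N)"
      and lat: "\<forall>\<kappa>. sum \<kappa> W \<in> \<int> \<longrightarrow> ((\<Sum>v\<in>W. \<kappa> v *\<^sub>R v) \<in> integer_lattice \<longleftrightarrow>
         (\<exists>j :: int. \<forall>v\<in>W. \<kappa> v - of_int j * of_int (a v) / N \<in> \<int>))"
      using lattice_points_of_simplex[OF Wl W(1) card(1) w basic] by blast
    have "\<exists>f g :: nat \<Rightarrow> real ^ 'm. W = f ` {..<d} \<union> g ` {..<d} \<and> (\<forall>i<d. int N dvd a (f i) + a (g i))"
      by (rule pairing_if_no_interior_lattice_point[OF W(1) card N a(2)])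
        (use cop lat free \<Delta> in auto)
    then obtain f g :: "nat \<Rightarrow> real ^ 'm" where fg: "W = f ` {..<d} \<union> g ` {..<d}" "\<forall>i<d. int N dvd a (f i) + a (g i)" by blast
    obtain h :: "'d \<Rightarrow> nat" where h: "bij_betw h UNIV {..<d}"
      using ex_bij_betw_finite_nat[of "UNIV :: 'd set"] assms(2) by (auto simp: atLeast0LessThan)
    define F where "F = f \<circ> h"
    define G where "G = g \<circ> h"
    have "range h = {..<d}" using h by (simp add: bij_betw_def)
    then have FG: "W = range F \<union> range G" unfolding F_def G_def image_comp[symmetric] using fg(1) by simp
    have dvd: "int N dvd a (F i) + a (G i)" for i using fg(2) h by (auto simp: F_def G_def bij_betw_def)
    have lat': "\<And>\<kappa>. sum \<kappa> W \<in> \<int> \<Longrightarrow> (\<Sum>v\<in>W. \<kappa> v *\<^sub>R v) \<in> integer_lattice \<longleftrightarrow>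
         (\<exists>j :: int. \<forall>v\<in>W. \<kappa> v - of_int j * of_int (a v) / N \<in> \<int>)" using lat by blast
    have card': "card W = 2 * CARD('d)" using card(2) assms(2) by simp
    show "\<exists>\<Sigma> :: 'd \<Rightarrow> (real ^ 'd) set. (\<forall>i. lattice_simplex 1 (\<Sigma> i)) \<and> cayley_isomorphic \<Delta> (cayley_polytope \<Sigma>)"
    \<comment> \<open>The isomorphism needs the vertex with numerator 1 in the second family; the
      pairing is symmetric, so the families may be exchanged.\<close>
    proof (cases "w \<in> range G")
      case True
      then obtain s where "a (G s) = 1" using a(1) by auto
      then show ?thesis unfolding \<Delta>
        by (rule cayley_isomorphic_of_pairing[OF Wl W(1) card(1) card' FG N _ dvd lat'])
    next
      case False
      then obtain s where s: "a (F s) = 1" using a(1) w FG by auto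
      have FG': "W = range G \<union> range F" using FG by blast
      have dvd': "int N dvd a (G i) + a (F i)" for i using dvd[of i] by (simp add: add.commute)
      show ?thesis unfolding \<Delta>
        by (rule cayley_isomorphic_of_pairing[OF Wl W(1) card(1) card' FG' N s dvd' lat'])
    qed
  next
    assume "\<exists>\<Sigma> :: 'd \<Rightarrow> (real ^ 'd) set. (\<forall>i. lattice_simplex 1 (\<Sigma> i)) \<and> cayley_isomorphic \<Delta> (cayley_polytope \<Sigma>)"
    then obtain \<Sigma> :: "'d \<Rightarrow> (real ^ 'd) set" where \<Sigma>: "\<And>i. lattice_simplex 1 (\<Sigma> i)"
      "cayley_isomorphic \<Delta> (cayley_polytope \<Sigma>)" by blast
    have "\<Sigma> i \<noteq> {}" for i
    proof -
      obtain V where "card V = 1 + 1" "\<Sigma> i = convex hull V" using \<Sigma>(1)[of i] unfolding lattice_simplex_def by blast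
      then show ?thesis by (metis card.empty add_is_0 convex_hull_eq_empty one_neq_zero)
    qed
    then have "interior ((\<lambda>x. real k *\<^sub>R x) ` (convex hull W)) \<inter> integer_lattice = {}" if "k \<in> {1..d - 1}" for k
      by (rule cayley_polytope_no_interior_lattice_point[OF Wl W(1) card(1) \<Sigma>(2)[unfolded \<Delta>]])
        (use that assms(1,2) in auto)
    then show "\<forall>k\<in>{1..d - 1}. interior ((\<lambda>x. real k *\<^sub>R x) ` \<Delta>) \<inter> integer_lattice = {}"
      unfolding \<Delta> by blast
  qed
qed

end
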